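(* Let $F$, $H$, $m_0$ satisfy the standing assumptions stated in the context, with constants $C_o\ge 1$, $L>0$. There exists $\lambda_0\ge1$ depending only on $n,C_o,L$ such that the following holds. For all $\tau>0$ there exists a constant $C_\tau>0$, depending only on $\tau,C_o,L$, such that for every $\lambda\ge\lambda_0$ and every solution $(u_\lambda,m_\lambda)$ of $({\rm MFG}_\lambda)$, denoting by $m$ the solution of $({\rm MF}_\infty)$ (with the same initial datum $m_0$), $$\sup_{t\in[0,\tau]}\ \sup_{x\in\mathbb{R}^n}\left|\lambda Du_\lambda(x,t)-D_xF(x,m(t))\right|\le\frac{C_\tau}{\sqrt\lambda};$$ that is, $\lambda Du_\lambda$ converges uniformly to $D_xF(\cdot,m(\cdot))$ on $\mathbb{R}^n\times[0,\tau]$ as $\lambda\to\infty$, for all $\tau>0$. Furthermore, $$\sup_{t\in[0,\tau]}d_1(m_\lambda(t),m(t))\le\frac{C_\tau}{\sqrt\lambda}.$$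
   Context: Fix $n\ge1$ and $\alpha\in(0,1)$. $\mathcal{P}_1(\mathbb{R}^n)$ is the set of Borel probability measures on $\mathbb{R}^n$ with finite first moment and $d_1$ is the $1$-Wasserstein distance. For functions on $\mathbb{R}^n\times[0,\infty)$, $\|u\|_\infty=\sup_{(x,t)}|u(x,t)|$. $D=D_x$ is the gradient in $x$. Standing assumptions: $m_0\in\mathcal{P}_1(\mathbb{R}^n)$, $F:\mathbb{R}^n\times\mathcal{P}_1(\mathbb{R}^n)\to\mathbb{R}$, $H=H(p,x):\mathbb{R}^n\times\mathbb{R}^n\to\mathbb{R}$, and there are constants $C_o\ge1$, $L>0$ such that: - $F(\cdot,m)$ is of class $C^{2,\alpha}$ for all $m$, and $|F(x,m)|\le C_o(1+|x|)$ for all $(x,m)$. - For all $x,y\in\mathbb{R}^n$, $m,\tilde m\in\mathcal{P}_1(\mathbb{R}^n)$: $|F(x,m)-F(y,\tilde m)|\le L(|x-y|+d_1(m,\tilde m))$ and $|D_xF(x,m)-D_xF(y,\tilde m)|\le L(|x-y|+d_1(m,\tilde m))$. - $H$ is of class $C^{2,\alpha}$ and convex in its first variable $p$. - For all $p,x$: $-C_o\le H(p,x)\le C_o(1+|p|^2)$; $C_o^{-1}I_d\le D^2_{pp}H(p,x)\le C_oI_d$; $|D_xH(p,x)|+|D^2_{px}H(p,x)|\le C_o(1+|p|)$; $|D^2_{xx}H(p,x)|\le C_o$. For $\lambda>0$, the system $({\rm MFG}_\lambda)$ for $(u_\lambda,m_\lambda)$ is $$\begin{cases}-\partial_tu_\lambda-\Delta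 u_\lambda+\frac1\lambda H(\lambda Du_\lambda,x)+\lambda u_\lambda=F(x,m_\lambda(t)), & x\in\mathbb{R}^n,\ t\in(0,\infty),\\ \partial_tm_\lambda-\Delta m_\lambda-\mathrm{div}(m_\lambda D_pH(\lambda Du_\lambda,x))=0,& x\in\mathbb{R}^n,\ t\in(0,\infty),\\ m_\lambda(x,0)=m_0(x),& x\in\mathbb{R}^n.\end{cases}$$ Convention: a solution of $({\rm MFG}_\lambda)$ always means a classical solution satisfying $$\inf_{\mathbb{R}^n\times[0,\infty)}u_\lambda>-\infty,\quad\sup_{(x,t)}\frac{u_\lambda(x,t)}{1+|x|}<\infty,\quad\|Du_\lambda\|_\infty<\infty,\quad\|D^2u_\lambda\|_\infty\le1.$$ Here classical solution means: $u_\lambda$ is $C^{2}$ in $x$ and $C^1$ in $t$ on $\mathbb{R}^n\times[0,\infty)$ and satisfies its equation pointwise; $t\mapsto m_\lambda(t)\in\mathcal{P}_1(\mathbb{R}^n)$ is $d_1$-continuous on $[0,\infty)$ with $m_\lambda(0)=m_0$, and for $t>0$ it is identified with a density solving the second equation. The limit problem $({\rm MF}_\infty)$ is the McKean–Vlasov equation $$\partial_tm-\Delta m-\mathrm{div}(mD_pH(D_xF(x,m(t)),x))=0\ \text{ in }\mathbb{R}^n\times(0,\infty),\qquad m(\cdot,0)=m_0,$$ whose solution is a $d_1$-continuous curve $t\mapsto m(t)\in\mathcal{P}_1(\mathbb{R}^n)$ (equation in the sense of distributions); under the standing assumptions it is unique.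
   Formalization: The constant C_τ is allowed to depend also on the fixed dimension n, not only on τ, C_o, L; a constant independent of n is impossible, since for m_0 a Dirac mass the error can be of order √(n/λ). *)

theory Defs
  imports "HOL-Probability.Probability"
begin

definition grad :: "('a::euclidean_space \<Rightarrow> real) \<Rightarrow> 'a \<Rightarrow> 'a"
  where "grad f x = (THE D. GDERIV f x :> D)"

lemma gderiv_grad:
  assumes "f differentiable (at x)"
  shows "GDERIV f x :> grad f x"
proof -
  obtain f' where f': "(f has_derivative f') (at x)"
    using assms by (auto simp: differentiable_def)
  then interpret bounded_linear f'
    by (rule has_derivative_bounded_linear)
  have "f' h = (\<Sum>i\<in>Basis. f' i *\<^sub>R i) \<bullet> h" for h
  proof -
    have "f' h = f' (\<Sum>i\<in>Basis. (h \<bullet> i) *\<^sub>R i)"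
      by (simp add: euclidean_representation)
    also have "\<dots> = (\<Sum>i\<in>Basis. (h \<bullet> i) * f' i)"
      by (simp add: sum scaleR)
    also have "\<dots> = (\<Sum>i\<in>Basis. f' i *\<^sub>R i) \<bullet> h"
      unfolding inner_sum_left by (intro sum.cong) (simp_all add: inner_commute)
    finally show ?thesis .
  qed
  then have "f' = (\<lambda>h. h \<bullet> (\<Sum>i\<in>Basis. f' i *\<^sub>R i))"
    by (metis inner_commute)
  with f' have D: "GDERIV f x :> (\<Sum>i\<in>Basis. f' i *\<^sub>R i)"
    unfolding gderiv_def by metis
  have "D' = D''" if "GDERIV f x :> D'" "GDERIV f x :> D''" for D' D''
  proof -
    have "(\<lambda>h. h \<bullet> D') = (\<lambda>h. h \<bullet> D'')"
      using that has_derivative_unique unfolding gderiv_def by blast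
    then show ?thesis
      by (metis vector_eq_ldot)
  qed
  with D show ?thesis
    unfolding grad_def by (metis (no_types, lifting) theI)
qed

definition hessian :: "(real^'n \<Rightarrow> real) \<Rightarrow> real^'n \<Rightarrow> real^'n^'n"
  where "hessian f x = jacobian (grad f) (at x)"

definition laplacian :: "(real^'n \<Rightarrow> real) \<Rightarrow> real^'n \<Rightarrow> real"
  where "laplacian f x = trace (hessian f x)"

definition divergence :: "(real^'n \<Rightarrow> real^'n) \<Rightarrow> real^'n \<Rightarrow> real"
  where "divergence V x = trace (jacobian V (at x))"

text \<open>The library norm on \<^typ>\<open>real^'n^'n\<close> is the Frobenius norm; matrices are
  measured in the operator norm here.\<close>

definition opnorm :: "real^'n^'m \<Rightarrow> real"
  where "opnorm A = onorm ((*v) A)"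

abbreviation Dp :: "(real^'n \<Rightarrow> real^'n \<Rightarrow> real) \<Rightarrow> real^'n \<Rightarrow> real^'n \<Rightarrow> real^'n"
  where "Dp H p x \<equiv> grad (\<lambda>q. H q x) p"

abbreviation Dx :: "(real^'n \<Rightarrow> real^'n \<Rightarrow> real) \<Rightarrow> real^'n \<Rightarrow> real^'n \<Rightarrow> real^'n"
  where "Dx H p x \<equiv> grad (\<lambda>y. H p y) x"

abbreviation Dpp :: "(real^'n \<Rightarrow> real^'n \<Rightarrow> real) \<Rightarrow> real^'n \<Rightarrow> real^'n \<Rightarrow> real^'n^'n"
  where "Dpp H p x \<equiv> hessian (\<lambda>q. H q x) p"

abbreviation Dpx :: "(real^'n \<Rightarrow> real^'n \<Rightarrow> real) \<Rightarrow> real^'n \<Rightarrow> real^'n \<Rightarrow> real^'n^'n"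
  where "Dpx H p x \<equiv> jacobian (\<lambda>y. Dp H p y) (at x)"

abbreviation Dxx :: "(real^'n \<Rightarrow> real^'n \<Rightarrow> real) \<Rightarrow> real^'n \<Rightarrow> real^'n \<Rightarrow> real^'n^'n"
  where "Dxx H p x \<equiv> hessian (\<lambda>y. H p y) x"

text \<open>Hoelder spaces are understood locally: the functions considered grow at infinity,
  so the top order derivatives are Hoelder continuous on bounded sets.\<close>

definition locally_holder :: "real \<Rightarrow> ('a::euclidean_space \<Rightarrow> real) \<Rightarrow> bool"
  where "locally_holder \<alpha> f \<longleftrightarrow>
    (\<forall>R. \<exists>K. \<forall>x\<in>cball 0 R. \<forall>y\<in>cball 0 R. \<bar>f x - f y\<bar> \<le> K * dist x y powr \<alpha>)"

primrec C_holder :: "nat \<Rightarrow> real \<Rightarrow> ('a::euclidean_space \<Rightarrow> real) \<Rightarrow> bool" where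
  "C_holder 0 \<alpha> f \<longleftrightarrow> locally_holder \<alpha> f"
| "C_holder (Suc k) \<alpha> f \<longleftrightarrow>
    (\<forall>x. f differentiable (at x)) \<and>
    (\<forall>i\<in>Basis. C_holder k \<alpha> (\<lambda>x. frechet_derivative f (at x) i))"

primrec C_class :: "nat \<Rightarrow> ('a::euclidean_space \<Rightarrow> real) \<Rightarrow> bool" where
  "C_class 0 f \<longleftrightarrow> continuous_on UNIV f"
| "C_class (Suc k) f \<longleftrightarrow>
    (\<forall>x. f differentiable (at x)) \<and>
    (\<forall>i\<in>Basis. C_class k (\<lambda>x. frechet_derivative f (at x) i))"

text \<open>Test functions in \<open>C\<^sub>c\<^sup>\<infinity>(\<real>\<^sup>n \<times> (0,\<infinity>))\<close>, extended by zero.\<close>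

definition test_function :: "((real^'n) \<times> real \<Rightarrow> real) \<Rightarrow> bool"
  where "test_function \<phi> \<longleftrightarrow> (\<forall>k. C_class k \<phi>) \<and>
    compact (closure {z. \<phi> z \<noteq> 0}) \<and> closure {z. \<phi> z \<noteq> 0} \<subseteq> UNIV \<times> {0<..}"

definition dt_on :: "real set \<Rightarrow> (real^'n \<Rightarrow> real \<Rightarrow> real) \<Rightarrow> real^'n \<Rightarrow> real \<Rightarrow> real"
  where "dt_on T u x t = vector_derivative (\<lambda>s. u x s) (at t within T)"

text \<open>\<open>C\<^sup>2\<close> in space and \<open>C\<^sup>1\<close> in time on \<open>\<real>\<^sup>n \<times> T\<close>, all derivatives being jointly
  continuous; the time derivative is one-sided at an endpoint of \<open>T\<close>.\<close>

definition C21_on :: "real set \<Rightarrow> (real^'n \<Rightarrow> real \<Rightarrow> real) \<Rightarrow> bool"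
  where "C21_on T u \<longleftrightarrow>
    (\<forall>t\<in>T. \<forall>x. (\<lambda>y. u y t) differentiable (at x) \<and>
      grad (\<lambda>y. u y t) differentiable (at x) \<and>
      (\<lambda>s. u x s) differentiable (at t within T)) \<and>
    continuous_on (UNIV \<times> T) (\<lambda>(x, t). u x t) \<and>
    continuous_on (UNIV \<times> T) (\<lambda>(x, t). grad (\<lambda>y. u y t) x) \<and>
    continuous_on (UNIV \<times> T) (\<lambda>(x, t). hessian (\<lambda>y. u y t) x) \<and>
    continuous_on (UNIV \<times> T) (\<lambda>(x, t). dt_on T u x t)"

definition P1 :: "(real^'n) measure set"
  where "P1 = {\<mu>. prob_space \<mu> \<and> sets \<mu> = sets borel \<and> integrable \<mu> norm}"

definition couplings :: "'a::second_countable_topology measure \<Rightarrow> 'a measure \<Rightarrow> ('a \<times> 'a) measure set"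
  where "couplings \<mu> \<nu> = {\<gamma>. prob_space \<gamma> \<and> sets \<gamma> = sets borel \<and>
    distr \<gamma> borel fst = \<mu> \<and> distr \<gamma> borel snd = \<nu>}"

text \<open>The 1-Wasserstein distance; the infimum is finite for measures in \<^const>\<open>P1\<close>.\<close>

definition d1 :: "(real^'n) measure \<Rightarrow> (real^'n) measure \<Rightarrow> real"
  where "d1 \<mu> \<nu> = enn2real (INF \<gamma>\<in>couplings \<mu> \<nu>. \<integral>\<^sup>+ z. ennreal (dist (fst z) (snd z)) \<partial>\<gamma>)"

definition P1_curve :: "(real \<Rightarrow> (real^'n) measure) \<Rightarrow> bool"
  where "P1_curve m \<longleftrightarrow> (\<forall>t\<ge>0. m t \<in> P1) \<and>
    (\<forall>t\<ge>0. ((\<lambda>s. d1 (m s) (m t)) \<longlongrightarrow> 0) (at t within {0..}))"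

locale mfg_data =
  fixes Co L \<alpha> :: real
    and m0 :: "(real^'n) measure"
    and F :: "real^'n \<Rightarrow> (real^'n) measure \<Rightarrow> real"
    and H :: "real^'n \<Rightarrow> real^'n \<Rightarrow> real" \<comment> \<open>\<open>H p x\<close>: momentum first\<close>
  assumes Co: "1 \<le> Co" and L: "0 < L" and \<alpha>: "0 < \<alpha>" "\<alpha> < 1"
    and m0: "m0 \<in> P1"
    and F_regular: "\<And>m. m \<in> P1 \<Longrightarrow> C_holder 2 \<alpha> (\<lambda>x. F x m)"
    and F_growth: "\<And>x m. m \<in> P1 \<Longrightarrow> \<bar>F x m\<bar> \<le> Co * (1 + norm x)"
    and F_lipschitz: "\<And>x y m m'. m \<in> P1 \<Longrightarrow> m' \<in> P1 \<Longrightarrow>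
      \<bar>F x m - F y m'\<bar> \<le> L * (norm (x - y) + d1 m m')"
    and DF_lipschitz: "\<And>x y m m'. m \<in> P1 \<Longrightarrow> m' \<in> P1 \<Longrightarrow>
      norm (grad (\<lambda>z. F z m) x - grad (\<lambda>z. F z m') y) \<le> L * (norm (x - y) + d1 m m')"
    and H_regular: "C_holder 2 \<alpha> (\<lambda>(p, x). H p x)"
    and H_convex: "\<And>x. convex_on UNIV (\<lambda>p. H p x)"
    and H_bounds: "\<And>p x. - Co \<le> H p x" "\<And>p x. H p x \<le> Co * (1 + (norm p)\<^sup>2)"
    and H_pp: "\<And>p x \<xi>. inverse Co * (\<xi> \<bullet> \<xi>) \<le> \<xi> \<bullet> (Dpp H p x *v \<xi>)"
      "\<And>p x \<xi>. \<xi> \<bullet> (Dpp H p x *v \<xi>) \<le> Co * (\<xi> \<bullet> \<xi>)"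
    and H_x_px: "\<And>p x. norm (Dx H p x) + opnorm (Dpx H p x) \<le> Co * (1 + norm p)"
    and H_xx: "\<And>p x. opnorm (Dxx H p x) \<le> Co"

definition MFG_solution ::
  "real \<Rightarrow> (real^'n) measure \<Rightarrow> (real^'n \<Rightarrow> (real^'n) measure \<Rightarrow> real) \<Rightarrow>
   (real^'n \<Rightarrow> real^'n \<Rightarrow> real) \<Rightarrow> (real^'n \<Rightarrow> real \<Rightarrow> real) \<Rightarrow> (real \<Rightarrow> (real^'n) measure) \<Rightarrow> bool"
  where "MFG_solution lam m0 F H u m \<longleftrightarrow>
    C21_on {0..} u \<and>
    (\<forall>x. \<forall>t>0. - dt_on {0..} u x t - laplacian (\<lambda>y. u y t) x
        + 1 / lam * H (lam *\<^sub>R grad (\<lambda>y. u y t) x) x + lam * u x t = F x (m t)) \<and>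
    P1_curve m \<and> m 0 = m0 \<and>
    (\<exists>\<rho>. C21_on {0<..} \<rho> \<and>
      (\<forall>t>0. (\<forall>x. 0 \<le> \<rho> x t) \<and> m t = density lborel (\<lambda>x. ennreal (\<rho> x t))) \<and>
      (\<forall>x. \<forall>t>0. dt_on {0<..} \<rho> x t - laplacian (\<lambda>y. \<rho> y t) x
        - divergence (\<lambda>y. \<rho> y t *\<^sub>R Dp H (lam *\<^sub>R grad (\<lambda>z. u z t) y) y) x = 0)) \<and>
    bdd_below ((\<lambda>(x, t). u x t) ` (UNIV \<times> {0..})) \<and>
    bdd_above ((\<lambda>(x, t). u x t / (1 + norm x)) ` (UNIV \<times> {0..})) \<and>
    bdd_above ((\<lambda>(x, t). norm (grad (\<lambda>y. u y t) x)) ` (UNIV \<times> {0..})) \<and>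
    (\<forall>x. \<forall>t\<ge>0. opnorm (hessian (\<lambda>y. u y t) x) \<le> 1)"

text \<open>The equation is tested against functions supported in positive times; the initial
  datum is attained through the \<^const>\<open>d1\<close>-continuity of the curve at time 0.\<close>

definition MF_limit_solution ::
  "(real^'n) measure \<Rightarrow> (real^'n \<Rightarrow> (real^'n) measure \<Rightarrow> real) \<Rightarrow>
   (real^'n \<Rightarrow> real^'n \<Rightarrow> real) \<Rightarrow> (real \<Rightarrow> (real^'n) measure) \<Rightarrow> bool"
  where "MF_limit_solution m0 F H m \<longleftrightarrow>
    P1_curve m \<and> m 0 = m0 \<and>
    (\<forall>\<phi>. test_function \<phi> \<longrightarrow>
      (LINT t:{0<..}|lborel. (LINT x|m t.
          vector_derivative (\<lambda>s. \<phi> (x, s)) (at t) + laplacian (\<lambda>y. \<phi> (y, t)) x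
          - Dp H (grad (\<lambda>y. F y (m t)) x) x \<bullet> grad (\<lambda>y. \<phi> (y, t)) x)) = 0)"

end

theory Submission
  imports Defs
begin

text \<open>
  With \<open>w = u(\<cdot> + h) - u\<close>, comparing \<open>\<lambda>w\<close> with a smoothed cone bounds \<open>\<lambda> Du\<close> independently of
  \<open>\<lambda>\<close>. Repeating the comparison with a cone of width \<open>\<lambda>\<^sup>-\<^sup>1\<^sup>/\<^sup>2\<close> centred at a given point gives
  \<open>\<lambda> Du = DF(\<cdot>, m\<^sub>\<lambda>) + O(\<lambda>\<^sup>-\<^sup>1\<^sup>/\<^sup>2)\<close>, because \<open>m\<^sub>\<lambda>\<close> is \<open>1/2\<close>-Hoelder in time for \<open>d\<^sub>1\<close>. Hence \<open>m\<^sub>\<lambda>\<close>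
  solves the limit equation up to an error \<open>O(\<lambda>\<^sup>-\<^sup>1\<^sup>/\<^sup>2) + O(d\<^sub>1(m\<^sub>\<lambda>, m))\<close> in the drift.

  The two curves are then compared by duality, without solving a backward equation: against a
  mollified Lipschitz function, a short time step of the Fokker--Planck flow acts as one step of
  a random walk with drift, which maps Lipschitz functions to Lipschitz functions and commutes with
  the mollification up to a small error. A discrete Gronwall argument, in which the time step
  tends to zero before the mollification parameter does, concludes.
\<close>

section \<open>Kantorovich--Rubinstein duality\<close>

text \<open>\<open>u\<close> has two spatial derivatives, so the Hamilton--Jacobi equation cannot be
  differentiated; increments in a fixed direction \<open>h\<close> are compared instead, with all
  bounds proportional to \<open>norm h\<close>. At a maximum of the penalised increment the discount
  term \<open>lam * u\<close> isolates the quantity sought and bounds it by the increment of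
  \<open>F\<close> at the contact point. The contact time may be later, so the penalty also grows
  linearly in time, which pays for the motion of the measure. With penalty slope of order
  \<open>1 / lam\<close>, a cone of width \<open>\<delta>\<close> costs \<open>\<delta>\<close> at
  its rounded tip and \<open>1 / (lam * \<delta>)\<close> through the Laplacian;
  \<open>\<delta> = 1 / sqrt lam\<close> balances the two. The dependence of \<open>H\<close> on
  \<open>x\<close> contributes \<open>Co * (1 + K) / lam\<close>, where \<open>K\<close> is itself
  the bound sought for \<open>lam * Du\<close>; this is absorbed for
  \<open>lam \<ge> 2 * Co\<close>. The equations see a measure through test functions,
  \<open>d1\<close> through couplings; duality is the bridge. The commutator of mollification and
  drift costs \<open>K * \<sigma>\<close> per unit time for any time step, while the other errors
  carry negative powers of \<open>\<sigma>\<close>; hence the order of the two limits.\<close>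

lemma compact_finite_plans:
  fixes A :: "'b set"
  assumes "finite A"
  shows "compact {w::'b \<Rightarrow> real. (\<forall>z. 0 \<le> w z) \<and> (\<forall>z. z \<notin> A \<longrightarrow> w z = 0) \<and> sum w A = 1}" (is "compact ?S")
proof -
  \<comment> \<open>Off \<open>A\<close> the factor is the singleton of 0, so the product is compact
    even for an infinite index type, and all coordinates outside \<open>A\<close> are
    frozen.\<close>
  let ?X = "\<lambda>z. if z \<in> A then {0..1::real} else {0}"
  let ?P = "PiE UNIV ?X"
  have "compactin (product_topology (\<lambda>i. euclideanreal) UNIV) ?P"
    unfolding compactin_PiE by (simp add: compact_space)
  then have cP: "compact ?P"
    by (simp add: euclidean_product_topology)
  have cc: "continuous_on UNIV (\<lambda>w::'b \<Rightarrow> real. sum w A)"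
    by (intro continuous_on_sum) auto
  have "closed {w::'b \<Rightarrow> real. sum w A = 1}"
    by (rule closed_Collect_eq[OF cc]) auto
  then have "compact (?P \<inter> {w. sum w A = 1})"
    using cP by (rule compact_Int_closed[rotated])
  also have "?P \<inter> {w. sum w A = 1} = ?S"
  proof (intro set_eqI iffI)
    fix w assume w: "w \<in> ?P \<inter> {w. sum w A = 1}"
    then have "w z \<in> ?X z" for z by blast
    note wX = this
    have "0 \<le> w z" for z using wX[of z] by (auto split: if_splits)
    moreover have "w z = 0" if "z \<notin> A" for z using wX[of z] that by simp
    ultimately show "w \<in> ?S" using w by auto
  next
    fix w assume w: "w \<in> ?S"
    have "w z \<le> 1" if "z \<in> A" for z
      using member_le_sum[of z A w] that assms w by auto
    then show "w \<in> ?P \<inter> {w. sum w A = 1}" using w by (auto simp: PiE_iff)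
  qed
  finally show ?thesis .
qed

text \<open>Divide by \<open>t\<close> and let it tend to 0. This is the first-order condition for a
  minimum over a convex set, tested along a segment that points into the set.\<close>

lemma quadratic_nonneg_slope:
  fixes a b :: real
  assumes "\<And>t. 0 < t \<Longrightarrow> t \<le> 1 \<Longrightarrow> 0 \<le> t * a + t\<^sup>2 * b"
  shows "0 \<le> a"
proof (rule ccontr)
  assume "\<not> 0 \<le> a"
  define t where "t = min 1 (- a / (2 * (\<bar>b\<bar> + 1)))"
  have t: "0 < t" "t \<le> 1" using \<open>\<not> 0 \<le> a\<close> by (auto simp: t_def divide_neg_pos)
  have "t \<le> - a / (2 * (\<bar>b\<bar> + 1))" unfolding t_def by simp
  then have "t * (\<bar>b\<bar> + 1) \<le> - a / 2"
    by (simp add: field_simps)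
  then have "t * b \<le> - a / 2"
    using t by (smt (verit) mult_left_mono)
  then have "a + t * b < 0" using \<open>\<not> 0 \<le> a\<close> by auto
  then have "t * (a + t * b) < 0" using t by (simp add: mult_pos_neg)
  then show False using assms[OF t] by (simp add: algebra_simps power2_eq_square)
qed

text \<open>A minimum of 1-Lipschitz functions is 1-Lipschitz. This is the c-transform of the
  potential \<open>g\<close>: it turns numbers attached to the finite set \<open>A\<close> into an
  admissible test function on the whole space.\<close>

lemma lipschitz_on_Min_dist:
  fixes A :: "'a::metric_space set" and g :: "'a \<Rightarrow> real"
  assumes "finite A" "A \<noteq> {}"
  shows "1-lipschitz_on UNIV (\<lambda>x. Min ((\<lambda>b. dist x b - g b) ` A))"
proof (rule lipschitz_onI)
  fix x y :: 'a
  have *: "Min ((\<lambda>b. dist x b - g b) ` A) \<le> Min ((\<lambda>b. dist y b - g b) ` A) + dist x y" for x y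
  proof -
    have "Min ((\<lambda>b. dist y b - g b) ` A) \<in> (\<lambda>b. dist y b - g b) ` A"
      using assms by (intro Min_in) auto
    then obtain b where b: "b \<in> A" "Min ((\<lambda>b. dist y b - g b) ` A) = dist y b - g b" by auto
    have "Min ((\<lambda>b. dist x b - g b) ` A) \<le> dist x b - g b"
      using assms b by (intro Min_le) auto
    then show ?thesis using b dist_triangle[of x b y] by simp
  qed
  show "dist (Min ((\<lambda>b. dist x b - g b) ` A)) (Min ((\<lambda>b. dist y b - g b) ` A)) \<le> 1 * dist x y"
    using *[of x y] *[of y x] by (simp add: dist_real_def dist_commute abs_le_iff)
qed simp

text \<open>An exact optimal plan is found by minimising the squared violation of the marginal and cost
  constraints over all plans: at a minimiser with positive violation, the first-order conditions
  yield dual potentials that contradict the bound \<open>D\<close>.\<close>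

lemma finite_transport_duality:
  fixes A :: "'a::metric_space set" and p q :: "'a \<Rightarrow> real"
  assumes fin: "finite A"
    and p: "\<And>a. 0 \<le> p a" "sum p A = 1" and q: "\<And>a. 0 \<le> q a" "sum q A = 1"
    and D: "\<And>\<phi>. 1-lipschitz_on UNIV \<phi> \<Longrightarrow> (\<Sum>a\<in>A. \<phi> a * p a) - (\<Sum>a\<in>A. \<phi> a * q a) \<le> D"
  obtains w :: "'a \<Rightarrow> 'a \<Rightarrow> real" where "\<And>a b. 0 \<le> w a b"
    "\<And>a. a \<in> A \<Longrightarrow> (\<Sum>b\<in>A. w a b) = p a" "\<And>b. b \<in> A \<Longrightarrow> (\<Sum>a\<in>A. w a b) = q b"
    "(\<Sum>a\<in>A. \<Sum>b\<in>A. w a b * dist a b) \<le> D"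
proof -
  have ne: "A \<noteq> {}" using p by auto
  define S where "S = {w::'a \<times> 'a \<Rightarrow> real. (\<forall>z. 0 \<le> w z) \<and> (\<forall>z. z \<notin> A \<times> A \<longrightarrow> w z = 0) \<and> sum w (A \<times> A) = 1}"
  have cS: "compact S" unfolding S_def by (rule compact_finite_plans) (use fin in auto)
  define r where "r w a = (\<Sum>b\<in>A. w (a, b)) - p a" for w :: "'a \<times> 'a \<Rightarrow> real" and a
  define s where "s w b = (\<Sum>a\<in>A. w (a, b)) - q b" for w :: "'a \<times> 'a \<Rightarrow> real" and b
  define c where "c w = (\<Sum>a\<in>A. \<Sum>b\<in>A. w (a, b) * dist a b)" for w :: "'a \<times> 'a \<Rightarrow> real"
  define Q where "Q w = (\<Sum>a\<in>A. (r w a)\<^sup>2) + (\<Sum>a\<in>A. (s w a)\<^sup>2) + (max 0 (c w - D))\<^sup>2" for w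
  have "continuous_on S Q"
    unfolding Q_def r_def s_def c_def
    by (intro continuous_intros) (auto intro!: continuous_on_subset[OF continuous_on_product_coordinates])
  \<comment> \<open>The product plan shows that \<open>S\<close> is nonempty.\<close>
  moreover have "(\<lambda>z. if z \<in> A \<times> A then p (fst z) * q (snd z) else 0) \<in> S"
  proof -
    have "(\<Sum>z\<in>A \<times> A. p (fst z) * q (snd z)) = 1"
      using sum_product[of p A q A] by (simp add: sum.cartesian_product split_beta p q)
    then show ?thesis using p q by (auto simp: S_def)
  qed
  ultimately obtain w where w: "w \<in> S" and wmin: "\<And>v. v \<in> S \<Longrightarrow> Q w \<le> Q v"
    using continuous_attains_inf[OF cS, of Q] by blast
  define k where "k = max 0 (c w - D)"
  have first: "0 \<le> 2 * ((\<Sum>x\<in>A. r w x * (r v x - r w x)) + (\<Sum>x\<in>A. s w x * (s v x - s w x)) + k * (c v - c w))"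
    if v: "v \<in> S" for v
  proof (rule quadratic_nonneg_slope)
    fix t :: real assume t: "0 < t" "t \<le> 1"
    define vt where "vt = (\<lambda>z. (1 - t) * w z + t * v z)"
    have "vt \<in> S"
      using w v t unfolding S_def vt_def
      by (auto simp: sum.distrib sum_distrib_left[symmetric])
    then have le: "Q w \<le> Q vt" by (rule wmin)
    have r: "r vt a = r w a + t * (r v a - r w a)" for a
      unfolding r_def vt_def by (simp add: sum.distrib sum_distrib_left[symmetric] algebra_simps sum_subtractf)
    have s: "s vt a = s w a + t * (s v a - s w a)" for a
      unfolding s_def vt_def by (simp add: sum.distrib sum_distrib_left[symmetric] algebra_simps sum_subtractf)
    have cc: "c vt = c w + t * (c v - c w)"
      unfolding c_def vt_def by (simp add: sum.distrib sum_distrib_left algebra_simps sum_subtractf)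
    have sq: "(x + t * y)\<^sup>2 = x\<^sup>2 + t * (2 * (x * y)) + t\<^sup>2 * y\<^sup>2" for x y :: real
      by (simp add: power2_eq_square algebra_simps)
    \<comment> \<open>The positive part is not differentiated: its square is bounded by the square
      of an affine function of \<open>t\<close>, with equality at \<open>t = 0\<close>.\<close>
    have "(max 0 (c vt - D))\<^sup>2 \<le> (k + t * (c v - c w))\<^sup>2"
    proof (cases "c vt - D \<le> 0")
      case False
      have "c vt - D \<le> k + t * (c v - c w)" unfolding cc k_def by auto
      then show ?thesis using False by (intro power_mono) auto
    qed simp
    then have "Q vt \<le> (\<Sum>a\<in>A. (r w a + t * (r v a - r w a))\<^sup>2) + (\<Sum>a\<in>A. (s w a + t * (s v a - s w a))\<^sup>2)
        + (k + t * (c v - c w))\<^sup>2"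
      unfolding Q_def r s by simp
    also have "\<dots> = Q w + t * (2 * ((\<Sum>x\<in>A. r w x * (r v x - r w x)) + (\<Sum>x\<in>A. s w x * (s v x - s w x)) + k * (c v - c w)))
       + t\<^sup>2 * ((\<Sum>x\<in>A. (r v x - r w x)\<^sup>2) + (\<Sum>x\<in>A. (s v x - s w x)\<^sup>2) + (c v - c w)\<^sup>2)"
      unfolding Q_def k_def[symmetric] sq sum.distrib sum_distrib_left[symmetric]
      by (simp only: distrib_left add_ac)
    finally show "0 \<le> t * (2 * ((\<Sum>x\<in>A. r w x * (r v x - r w x)) + (\<Sum>x\<in>A. s w x * (s v x - s w x)) + k * (c v - c w)))
       + t\<^sup>2 * ((\<Sum>x\<in>A. (r v x - r w x)\<^sup>2) + (\<Sum>x\<in>A. (s v x - s w x)\<^sup>2) + (c v - c w)\<^sup>2)"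
      using le by simp
  qed
  define rp where "rp = (\<Sum>a\<in>A. r w a * p a) + (\<Sum>a\<in>A. s w a * q a)"
  \<comment> \<open>Tests with the plan concentrated at the pair \<open>(a, b)\<close>. The outcome
    says that \<open>r w\<close> and \<open>s w\<close>, rescaled by \<open>k\<close>, are dual
    potentials for the cost \<open>dist\<close>, with surplus \<open>Q w\<close>.\<close>
  have point: "rp + Q w + k * D \<le> r w a + s w b + k * dist a b" if ab: "a \<in> A" "b \<in> A" for a b
  proof -
    define v where "v = (\<lambda>z. if z = (a, b) then 1 else 0::real)"
    have "v \<in> S" using ab fin unfolding S_def v_def by (auto simp: sum.delta)
    note f = first[OF this]
    have rv: "r v x = (if x = a then 1 else 0) - p x" for x
      unfolding r_def v_def using ab fin by (auto simp: sum.delta)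
    have sv: "s v x = (if x = b then 1 else 0) - q x" for x
      unfolding s_def v_def using ab fin by (auto simp: sum.delta)
    have cv: "c v = dist a b"
    proof -
      have "c v = (\<Sum>x\<in>A. \<Sum>y\<in>A. if y = b then (if x = a then dist a b else 0) else 0)"
        unfolding c_def v_def by (intro sum.cong) auto
      also have "\<dots> = dist a b" using ab fin by (simp add: sum.delta)
      finally show ?thesis .
    qed
    have 1: "(\<Sum>x\<in>A. r w x * (r v x - r w x)) = r w a - (\<Sum>x\<in>A. r w x * p x) - (\<Sum>x\<in>A. (r w x)\<^sup>2)"
    proof -
      have "(\<Sum>x\<in>A. r w x * (r v x - r w x)) = (\<Sum>x\<in>A. (if x = a then r w x else 0) - r w x * p x - (r w x)\<^sup>2)"
        unfolding rv by (intro sum.cong) (auto simp: algebra_simps power2_eq_square)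
      then show ?thesis using ab fin by (simp add: sum_subtractf sum.delta)
    qed
    have 2: "(\<Sum>x\<in>A. s w x * (s v x - s w x)) = s w b - (\<Sum>x\<in>A. s w x * q x) - (\<Sum>x\<in>A. (s w x)\<^sup>2)"
    proof -
      have "(\<Sum>x\<in>A. s w x * (s v x - s w x)) = (\<Sum>x\<in>A. (if x = b then s w x else 0) - s w x * q x - (s w x)\<^sup>2)"
        unfolding sv by (intro sum.cong) (auto simp: algebra_simps power2_eq_square)
      then show ?thesis using ab fin by (simp add: sum_subtractf sum.delta)
    qed
    have 3: "k * (c v - c w) = k * dist a b - k * D - k\<^sup>2"
      unfolding cv k_def by (auto simp: max_def algebra_simps power2_eq_square)
    define X1 X2 X3 X4 where X: "X1 = (\<Sum>x\<in>A. r w x * p x)" "X2 = (\<Sum>x\<in>A. (r w x)\<^sup>2)"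
      "X3 = (\<Sum>x\<in>A. s w x * q x)" "X4 = (\<Sum>x\<in>A. (s w x)\<^sup>2)"
    from f show ?thesis unfolding 1 2 3 rp_def Q_def k_def[symmetric] X[symmetric] by simp
  qed
  have "Q w = 0"
  proof (rule ccontr)
    assume "Q w \<noteq> 0"
    moreover have "0 \<le> Q w" unfolding Q_def by (intro add_nonneg_nonneg sum_nonneg) auto
    ultimately have Q: "0 < Q w" by simp
    show False
    proof (cases "k = 0")
      case True
      \<comment> \<open>No cost term is left, so averaging \<open>point\<close> against
        \<open>p a * q b\<close> gives \<open>rp + Q w \<le> rp\<close>.\<close>
      have "(\<Sum>a\<in>A. \<Sum>b\<in>A. p a * q b * (rp + Q w)) \<le> (\<Sum>a\<in>A. \<Sum>b\<in>A. p a * q b * (r w a + s w b))"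
        using point True p q by (intro sum_mono mult_left_mono) auto
      moreover have "(\<Sum>a\<in>A. \<Sum>b\<in>A. p a * q b * (rp + Q w)) = rp + Q w"
        by (simp add: p q sum_distrib_left[symmetric] sum_distrib_right[symmetric])
      moreover have "(\<Sum>a\<in>A. \<Sum>b\<in>A. p a * q b * (r w a + s w b)) = rp"
      proof -
        have "(\<Sum>a\<in>A. \<Sum>b\<in>A. p a * q b * (r w a + s w b)) =
          (\<Sum>a\<in>A. r w a * p a) * (\<Sum>b\<in>A. q b) + (\<Sum>a\<in>A. p a) * (\<Sum>b\<in>A. s w b * q b)"
          unfolding sum_product sum.distrib[symmetric] by (intro sum.cong refl) (simp add: algebra_simps)
        then show ?thesis by (simp add: q p rp_def)
      qed
      ultimately show False using Q by simp
    next
      case False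
      then have k: "0 < k" unfolding k_def by auto
      \<comment> \<open>The c-transform of \<open>- s w / k\<close> dominates
        \<open>- r w / k\<close> up to a constant on \<open>A\<close> and is dominated by
        \<open>s w / k\<close>. Its integrals against \<open>p\<close> and \<open>q\<close>
        therefore differ by at least \<open>D + Q w / k\<close>.\<close>
      define g where "g b = - s w b / k" for b
      define \<phi> where "\<phi> x = Min ((\<lambda>b. dist x b - g b) ` A)" for x :: 'a
      have lip: "1-lipschitz_on UNIV \<phi>"
        unfolding \<phi>_def[abs_def] by (rule lipschitz_on_Min_dist) fact+
      have lo: "(rp + Q w) / k + D - r w a / k \<le> \<phi> a" if "a \<in> A" for a
      proof -
        have "(rp + Q w) / k + D - r w a / k \<le> dist a b - g b" if b: "b \<in> A" for b
        proof -
          have "(rp + Q w + k * D) / k \<le> (r w a + s w b + k * dist a b) / k"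
            using point[OF \<open>a \<in> A\<close> b] k by (intro divide_right_mono) auto
          then show ?thesis using k by (simp add: add_divide_distrib g_def)
        qed
        then show ?thesis unfolding \<phi>_def using ne fin by (subst Min_ge_iff) auto
      qed
      have hi: "\<phi> b \<le> s w b / k" if "b \<in> A" for b
      proof -
        have "\<phi> b \<le> dist b b - g b" unfolding \<phi>_def using fin that by (intro Min_le imageI finite_imageI)
        then show ?thesis by (simp add: g_def)
      qed
      have "(\<Sum>a\<in>A. ((rp + Q w) / k + D - r w a / k) * p a) \<le> (\<Sum>a\<in>A. \<phi> a * p a)"
        using lo p by (intro sum_mono mult_right_mono) auto
      moreover have "(\<Sum>a\<in>A. ((rp + Q w) / k + D - r w a / k) * p a) = (rp + Q w) / k + D - (\<Sum>a\<in>A. r w a * p a) / k"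
        by (simp add: left_diff_distrib sum_subtractf p sum_distrib_left[symmetric] sum_divide_distrib)
      moreover have "(\<Sum>a\<in>A. \<phi> a * q a) \<le> (\<Sum>a\<in>A. (s w a / k) * q a)"
        using hi q by (intro sum_mono mult_right_mono) auto
      moreover have "(\<Sum>a\<in>A. (s w a / k) * q a) = (\<Sum>a\<in>A. s w a * q a) / k"
        by (simp add: sum_divide_distrib)
      moreover note D[OF lip]
      moreover have "(rp + Q w) / k = (\<Sum>a\<in>A. r w a * p a) / k + (\<Sum>a\<in>A. s w a * q a) / k + Q w / k"
        unfolding rp_def by (simp add: add_divide_distrib)
      moreover have "0 < Q w / k" using Q k by simp
      ultimately show False by linarith
    qed
  qed
  then have 0: "(\<Sum>a\<in>A. (r w a)\<^sup>2) = 0" "(\<Sum>a\<in>A. (s w a)\<^sup>2) = 0" "(max 0 (c w - D))\<^sup>2 = 0"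
    unfolding Q_def by (smt (verit) sum_nonneg zero_le_power2)+
  show ?thesis
  proof (rule that[of "\<lambda>a b. w (a, b)"])
    show "0 \<le> w (a, b)" for a b using w by (auto simp: S_def)
    show "(\<Sum>b\<in>A. w (a, b)) = p a" if "a \<in> A" for a
      using 0(1) fin that by (auto simp: sum_nonneg_eq_0_iff r_def)
    show "(\<Sum>a\<in>A. w (a, b)) = q b" if "b \<in> A" for b
      using 0(2) fin that by (auto simp: sum_nonneg_eq_0_iff s_def)
    show "(\<Sum>a\<in>A. \<Sum>b\<in>A. w (a, b) * dist a b) \<le> D"
      using 0(3) by (auto simp: c_def)
  qed
qed

section \<open>First moments, couplings and the elementary half of the duality\<close>

lemma P1_D:
  assumes "\<mu> \<in> P1"
  shows "prob_space \<mu>" "sets \<mu> = sets borel" "space \<mu> = UNIV" "integrable \<mu> norm"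
  using assms sets_eq_imp_space_eq[of \<mu> borel] by (auto simp: P1_def)

lemma P1_integrable_affine_bound:
  fixes f :: "real^'n \<Rightarrow> 'b::{banach, second_countable_topology}"
  assumes \<mu>: "\<mu> \<in> P1" and f: "f \<in> borel_measurable borel" and le: "\<And>x. norm (f x) \<le> a + b * norm x"
  shows "integrable \<mu> f"
proof (rule Bochner_Integration.integrable_bound)
  interpret prob_space \<mu> by (rule P1_D[OF \<mu>])
  show "integrable \<mu> (\<lambda>x. a + b * norm x)"
    using P1_D(4)[OF \<mu>] by simp
  show "f \<in> borel_measurable \<mu>" using f P1_D(2)[OF \<mu>] by (simp cong: measurable_cong_sets)
  show "AE x in \<mu>. norm (f x) \<le> norm (a + b * norm x)"
    using le by (auto intro!: AE_I2 order_trans[OF le] simp: abs_ge_self)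
qed

lemma P1_integrable_lipschitz:
  fixes \<phi> :: "real^'n \<Rightarrow> real"
  assumes \<mu>: "\<mu> \<in> P1" and \<phi>: "C-lipschitz_on UNIV \<phi>"
  shows "integrable \<mu> \<phi>"
proof (rule P1_integrable_affine_bound[OF \<mu>, where a = "\<bar>\<phi> 0\<bar>" and b = C])
  show "\<phi> \<in> borel_measurable borel"
    using lipschitz_on_continuous_on[OF \<phi>] by (rule borel_measurable_continuous_onI)
  show "norm (\<phi> x) \<le> \<bar>\<phi> 0\<bar> + C * norm x" for x
    using lipschitz_onD[OF \<phi>, of x 0] by (auto simp: dist_real_def)
qed

lemma pair_measure_coupling:
  fixes \<mu> \<nu> :: "(real^'n) measure"
  assumes "\<mu> \<in> P1" "\<nu> \<in> P1"
  shows "\<mu> \<Otimes>\<^sub>M \<nu> \<in> couplings \<mu> \<nu>"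
proof -
  interpret m: prob_space \<mu> by (rule P1_D(1)) fact
  interpret n: prob_space \<nu> by (rule P1_D(1)) fact
  interpret mn: pair_prob_space \<mu> \<nu> ..
  have s: "sets (\<mu> \<Otimes>\<^sub>M \<nu>) = sets borel"
    unfolding borel_prod[symmetric] by (intro sets_pair_measure_cong P1_D(2)) fact+
  have "distr (\<mu> \<Otimes>\<^sub>M \<nu>) borel fst = distr (\<mu> \<Otimes>\<^sub>M \<nu>) \<mu> fst"
    using P1_D(2)[OF assms(1)] by (intro distr_cong) auto
  then have 1: "distr (\<mu> \<Otimes>\<^sub>M \<nu>) borel fst = \<mu>"
    by (simp add: n.distr_pair_fst)
  have "distr (\<mu> \<Otimes>\<^sub>M \<nu>) borel snd = distr (distr (\<nu> \<Otimes>\<^sub>M \<mu>) (\<mu> \<Otimes>\<^sub>M \<nu>) (\<lambda>(x, y). (y, x))) \<nu> snd"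
    using P1_D(2)[OF assms(2)] by (subst mn.distr_pair_swap) (auto intro!: distr_cong)
  also have "\<dots> = distr (\<nu> \<Otimes>\<^sub>M \<mu>) \<nu> fst"
    by (subst distr_distr) (auto intro!: distr_cong)
  also have "\<dots> = \<nu>" by (rule m.distr_pair_fst)
  finally show ?thesis using s 1 mn.prob_space_axioms by (auto simp: couplings_def)
qed

lemma d1_le_cost:
  assumes "\<gamma> \<in> couplings \<mu> \<nu>" "(\<integral>\<^sup>+ z. ennreal (dist (fst z) (snd z)) \<partial>\<gamma>) \<le> ennreal c" "0 \<le> c"
  shows "d1 \<mu> \<nu> \<le> c"
  unfolding d1_def using assms
  by (intro enn2real_leI) (auto intro: INF_lower2)

lemma d1_nonneg: "0 \<le> d1 \<mu> \<nu>"
  by (simp add: d1_def)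

text \<open>\<open>enn2real\<close> would turn an infinite infimum into 0. The product coupling has
  cost at most the sum of the two first moments, so the infimum is finite and the conversion loses
  nothing.\<close>

lemma ennreal_d1:
  fixes \<mu> \<nu> :: "(real^'n) measure"
  assumes "\<mu> \<in> P1" "\<nu> \<in> P1"
  shows "ennreal (d1 \<mu> \<nu>) = (INF \<gamma>\<in>couplings \<mu> \<nu>. \<integral>\<^sup>+ z. ennreal (dist (fst z) (snd z)) \<partial>\<gamma>)"
proof -
  interpret m: prob_space \<mu> by (rule P1_D(1)) fact
  interpret n: prob_space \<nu> by (rule P1_D(1)) fact
  have [measurable_cong]: "sets \<mu> = sets borel" "sets \<nu> = sets borel" by (rule P1_D(2), fact)+
  have fin: "(\<integral>\<^sup>+ x. ennreal (norm x) \<partial>\<mu>) < \<infinity>" "(\<integral>\<^sup>+ x. ennreal (norm x) \<partial>\<nu>) < \<infinity>"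
    using P1_D(4)[OF assms(1)] P1_D(4)[OF assms(2)] by (auto simp: integrable_iff_bounded)
  have "(INF \<gamma>\<in>couplings \<mu> \<nu>. \<integral>\<^sup>+ z. ennreal (dist (fst z) (snd z)) \<partial>\<gamma>)
      \<le> (\<integral>\<^sup>+ z. ennreal (dist (fst z) (snd z)) \<partial>(\<mu> \<Otimes>\<^sub>M \<nu>))"
    using pair_measure_coupling[OF assms] by (rule INF_lower)
  also have "\<dots> \<le> (\<integral>\<^sup>+ z. ennreal (norm (fst z)) + ennreal (norm (snd z)) \<partial>(\<mu> \<Otimes>\<^sub>M \<nu>))"
    by (intro nn_integral_mono) (auto simp: dist_norm norm_triangle_ineq4 simp flip: ennreal_plus)
  also have "\<dots> = (\<integral>\<^sup>+ x. (\<integral>\<^sup>+ y. ennreal (norm x) + ennreal (norm y) \<partial>\<nu>) \<partial>\<mu>)"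
    by (subst n.nn_integral_fst[symmetric]) auto
  also have "\<dots> = (\<integral>\<^sup>+ x. ennreal (norm x) \<partial>\<mu>) + (\<integral>\<^sup>+ x. ennreal (norm x) \<partial>\<nu>)"
    by (simp add: nn_integral_add n.emeasure_space_1 m.emeasure_space_1)
  also have "\<dots> < top" using fin by (simp add: less_top)
  finally show ?thesis unfolding d1_def by (simp add: less_top)
qed

text \<open>For any coupling the left-hand side is the integral of
  \<open>\<phi> (fst z) - \<phi> (snd z)\<close>, which the distance dominates pointwise.\<close>

lemma integral_diff_le_d1_unit:
  fixes \<mu> \<nu> :: "(real^'n) measure"
  assumes P: "\<mu> \<in> P1" "\<nu> \<in> P1" and \<phi>: "1-lipschitz_on UNIV \<phi>"
  shows "(LINT x|\<mu>. \<phi> x) - (LINT x|\<nu>. \<phi> x) \<le> d1 \<mu> \<nu>"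
proof -
  have [measurable]: "\<phi> \<in> borel_measurable borel"
    using lipschitz_on_continuous_on[OF \<phi>] by (rule borel_measurable_continuous_onI)
  have "ennreal ((LINT x|\<mu>. \<phi> x) - (LINT x|\<nu>. \<phi> x)) \<le> ennreal (d1 \<mu> \<nu>)"
    unfolding ennreal_d1[OF P]
  proof (rule INF_greatest)
    fix \<gamma> assume g: "\<gamma> \<in> couplings \<mu> \<nu>"
    then have [measurable_cong]: "sets \<gamma> = sets borel"
      and d: "distr \<gamma> borel fst = \<mu>" "distr \<gamma> borel snd = \<nu>" by (auto simp: couplings_def)
    have [measurable]: "fst \<in> borel_measurable \<gamma>" "snd \<in> borel_measurable \<gamma>"
      by (simp_all add: measurable_cong_sets[OF \<open>sets \<gamma> = sets borel\<close> refl] borel_measurable_continuous_onI continuous_intros)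
    have i: "integrable \<gamma> (\<lambda>z. \<phi> (fst z))" "integrable \<gamma> (\<lambda>z. \<phi> (snd z))"
      using P1_integrable_lipschitz[OF P(1) \<phi>] P1_integrable_lipschitz[OF P(2) \<phi>]
      unfolding d[symmetric] by (simp_all add: integrable_distr_eq)
    have "(LINT x|\<mu>. \<phi> x) - (LINT x|\<nu>. \<phi> x) = (LINT z|\<gamma>. \<phi> (fst z) - \<phi> (snd z))"
      using i unfolding d[symmetric] by (simp add: integral_distr)
    then have "ennreal ((LINT x|\<mu>. \<phi> x) - (LINT x|\<nu>. \<phi> x)) \<le> ennreal (norm (LINT z|\<gamma>. \<phi> (fst z) - \<phi> (snd z)))"
      by (intro ennreal_leI) simp
    also have "\<dots> \<le> (\<integral>\<^sup>+ z. norm (\<phi> (fst z) - \<phi> (snd z)) \<partial>\<gamma>)"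
      using i by (intro integral_norm_bound_ennreal) auto
    also have "\<dots> \<le> (\<integral>\<^sup>+ z. ennreal (dist (fst z) (snd z)) \<partial>\<gamma>)"
      using lipschitz_onD[OF \<phi>] by (intro nn_integral_mono ennreal_leI) (auto simp: dist_real_def)
    finally show "ennreal ((LINT x|\<mu>. \<phi> x) - (LINT x|\<nu>. \<phi> x)) \<le> \<dots>" .
  qed
  then show ?thesis by (simp add: d1_nonneg)
qed

lemma integral_diff_le_d1:
  fixes \<mu> \<nu> :: "(real^'n) measure"
  assumes P: "\<mu> \<in> P1" "\<nu> \<in> P1" and \<phi>: "C-lipschitz_on UNIV \<phi>"
  shows "(LINT x|\<mu>. \<phi> x) - (LINT x|\<nu>. \<phi> x) \<le> C * d1 \<mu> \<nu>"
proof (cases "C = 0")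
  case True
  interpret m: prob_space \<mu> by (rule P1_D(1)) fact
  interpret n: prob_space \<nu> by (rule P1_D(1)) fact
  have "\<phi> x = \<phi> 0" for x using lipschitz_onD[OF \<phi>, of x 0] True by simp
  then have "(LINT x|\<mu>. \<phi> x) = (LINT x|\<mu>. \<phi> 0)" "(LINT x|\<nu>. \<phi> x) = (LINT x|\<nu>. \<phi> 0)"
    by metis+
  then show ?thesis using True by (simp add: m.prob_space n.prob_space)
next
  case False
  then have C: "0 < C" using lipschitz_on_nonneg[OF \<phi>] by simp
  have "1-lipschitz_on UNIV (\<lambda>x. \<phi> x / C)"
    using lipschitz_onD[OF \<phi>] C
    by (intro lipschitz_onI) (auto simp: dist_real_def diff_divide_distrib[symmetric] field_simps)
  from integral_diff_le_d1_unit[OF P this] show ?thesis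
    using C by (simp add: field_simps)
qed

lemma abs_integral_diff_le_d1:
  fixes \<mu> \<nu> :: "(real^'n) measure"
  assumes P: "\<mu> \<in> P1" "\<nu> \<in> P1" and \<phi>: "C-lipschitz_on UNIV \<phi>"
  shows "\<bar>(LINT x|\<mu>. \<phi> x) - (LINT x|\<nu>. \<phi> x)\<bar> \<le> C * d1 \<mu> \<nu>"
proof -
  have "C-lipschitz_on UNIV (\<lambda>x. - \<phi> x)"
    using \<phi> by (auto simp: lipschitz_on_def dist_real_def abs_minus_commute)
  from integral_diff_le_d1[OF P this] integral_diff_le_d1[OF P \<phi>] show ?thesis by simp
qed

section \<open>Discretisation and the converse half of the duality\<close>

lemma nn_integral_finite_range:
  assumes [measurable]: "\<And>a. a \<in> A \<Longrightarrow> T -` {a} \<inter> space M \<in> sets M" and fin: "finite A" and T: "\<And>x. x \<in> space M \<Longrightarrow> T x \<in> A"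
  shows "(\<integral>\<^sup>+ x. g (T x) \<partial>M) = (\<Sum>a\<in>A. g a * emeasure M (T -` {a} \<inter> space M))"
proof -
  have "(\<integral>\<^sup>+ x. g (T x) \<partial>M) = (\<integral>\<^sup>+ x. (\<Sum>a\<in>A. g a * indicator (T -` {a} \<inter> space M) x) \<partial>M)"
  proof (intro nn_integral_cong)
    fix x assume x: "x \<in> space M"
    have "(\<Sum>a\<in>A. g a * indicator (T -` {a} \<inter> space M) x) = (\<Sum>a\<in>A. if a = T x then g a else 0)"
      using x by (intro sum.cong) (auto simp: indicator_def)
    also have "\<dots> = g (T x)" using fin T[OF x] by (simp add: sum.delta)
    finally show "g (T x) = (\<Sum>a\<in>A. g a * indicator (T -` {a} \<inter> space M) x)" by simp
  qed
  also have "\<dots> = (\<Sum>a\<in>A. g a * emeasure M (T -` {a} \<inter> space M))"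
    by (subst nn_integral_sum) (auto intro!: sum.cong nn_integral_cmult_indicator)
  finally show ?thesis .
qed

lemma integral_finite_range:
  fixes g :: "'b \<Rightarrow> real"
  assumes "finite_measure M" and [measurable]: "\<And>a. a \<in> A \<Longrightarrow> T -` {a} \<inter> space M \<in> sets M" and fin: "finite A" and T: "\<And>x. x \<in> space M \<Longrightarrow> T x \<in> A"
  shows "(LINT x|M. g (T x)) = (\<Sum>a\<in>A. g a * measure M (T -` {a} \<inter> space M))"
proof -
  interpret finite_measure M by fact
  have "(LINT x|M. g (T x)) = (LINT x|M. (\<Sum>a\<in>A. g a * indicator (T -` {a} \<inter> space M) x))"
  proof (intro Bochner_Integration.integral_cong refl)
    fix x assume x: "x \<in> space M"
    have "(\<Sum>a\<in>A. g a * indicator (T -` {a} \<inter> space M) x) = (\<Sum>a\<in>A. if a = T x then g a else 0)"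
      using x by (intro sum.cong) (auto simp: indicator_def)
    also have "\<dots> = g (T x)" using fin T[OF x] by (simp add: sum.delta)
    finally show "g (T x) = (\<Sum>a\<in>A. g a * indicator (T -` {a} \<inter> space M) x)" by simp
  qed
  also have "\<dots> = (\<Sum>a\<in>A. g a * measure M (T -` {a} \<inter> space M))"
    by (subst Bochner_Integration.integral_sum) (auto simp: less_top[symmetric])
  finally show ?thesis .
qed

text \<open>Both measures are discretised by a simple function \<open>T\<close> that moves them by little; an optimal
  discrete plan is spread out over the cells of \<open>T\<close> as a density with respect to \<open>\<mu> \<otimes> \<nu>\<close>.\<close>

lemma d1_le_of_lipschitz:
  fixes \<mu> \<nu> :: "(real^'n) measure"
  assumes P: "\<mu> \<in> P1" "\<nu> \<in> P1"
    and D: "\<And>\<phi>. 1-lipschitz_on UNIV \<phi> \<Longrightarrow> (LINT x|\<mu>. \<phi> x) - (LINT x|\<nu>. \<phi> x) \<le> D"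
  shows "d1 \<mu> \<nu> \<le> D"
proof (rule field_le_epsilon)
  fix e :: real assume e: "0 < e"
  interpret m: prob_space \<mu> by (rule P1_D(1)) fact
  interpret n: prob_space \<nu> by (rule P1_D(1)) fact
  have sets[measurable_cong]: "sets \<mu> = sets borel" "sets \<nu> = sets borel" by (rule P1_D(2), fact)+
  have sp: "space \<mu> = UNIV" "space \<nu> = UNIV" by (rule P1_D(3), fact)+
  have "0 \<le> D" using D[of "\<lambda>x. 0"] by (simp add: lipschitz_on_def)
  \<comment> \<open>Simple functions converging to the identity; since
    \<open>norm (F i x) \<le> 2 * norm x\<close>, the displacement has the integrable majorant
    \<open>3 * norm x\<close>.\<close>
  have "(\<lambda>x. x) \<in> borel_measurable (borel :: (real^'n) measure)" by simp
  from borel_measurable_implies_sequence_metric[OF this, of 0]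
  obtain F :: "nat \<Rightarrow> real^'n \<Rightarrow> real^'n" where F: "\<And>i. simple_function borel (F i)"
    "\<And>x. (\<lambda>i. F i x) \<longlonglongrightarrow> x" "\<And>i x. norm (F i x) \<le> 2 * norm x" by auto
  have Fm[measurable]: "F i \<in> borel_measurable borel" for i using F(1) by (rule borel_measurable_simple_function)
  have lim: "(\<lambda>i. LINT x|\<rho>. dist x (F i x)) \<longlonglongrightarrow> 0" if \<rho>: "\<rho> \<in> P1" for \<rho> :: "(real^'n) measure"
  proof -
    have [measurable_cong]: "sets \<rho> = sets borel" by (rule P1_D(2)) fact
    have "(\<lambda>i. LINT x|\<rho>. dist x (F i x)) \<longlonglongrightarrow> (LINT x|\<rho>. 0)"
    proof (rule integral_dominated_convergence[where w = "\<lambda>x. 3 * norm x"])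
      show "integrable \<rho> (\<lambda>x. 3 * norm x)" using P1_D(4)[OF \<rho>] by simp
      show "AE x in \<rho>. (\<lambda>i. dist x (F i x)) \<longlonglongrightarrow> 0"
      proof (rule AE_I2)
        show "(\<lambda>i. dist x (F i x)) \<longlonglongrightarrow> 0" for x
          using tendsto_dist[OF tendsto_const[of x] F(2)[of x]] by simp
      qed
      show "AE x in \<rho>. norm (dist x (F i x)) \<le> 3 * norm x" for i
        by (auto intro!: AE_I2 simp: dist_norm)
          (smt (verit) F(3) norm_triangle_ineq4)
    qed auto
    then show ?thesis by simp
  qed
  \<comment> \<open>The displacement is paid four times: for both marginals when passing to the
    discrete measures, and for both coordinates when passing back.\<close>
  define \<delta> where "\<delta> = e / 4"
  have \<delta>: "0 < \<delta>" using e by (simp add: \<delta>_def)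
  have "\<forall>\<^sub>F i in sequentially. (LINT x|\<mu>. dist x (F i x)) < \<delta> \<and> (LINT x|\<nu>. dist x (F i x)) < \<delta>"
    using order_tendstoD(2)[OF lim[OF P(1)] \<delta>] order_tendstoD(2)[OF lim[OF P(2)] \<delta>] by (rule eventually_conj)
  then obtain i where i: "(LINT x|\<mu>. dist x (F i x)) < \<delta>" "(LINT x|\<nu>. dist x (F i x)) < \<delta>"
    by (auto simp: eventually_sequentially)
  define T where "T = F i"
  have Tm[measurable]: "T \<in> borel_measurable borel" by (simp add: T_def)
  have intT: "integrable \<rho> (\<lambda>x. dist x (T x))" if "\<rho> \<in> P1" for \<rho>
    by (rule P1_integrable_affine_bound[OF that, where a = 0 and b = 3])
      (auto simp: dist_norm T_def, smt (verit) F(3) norm_triangle_ineq4)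
  define A where "A = range T"
  have fin: "finite A" using F(1)[of i] by (simp add: simple_function_def A_def T_def)
  have TA: "T x \<in> A" for x by (simp add: A_def)
  have Tvim: "T -` {a} \<in> sets borel" for a using measurable_sets[OF Tm, of "{a}"] by simp
  define p where "p a = measure \<mu> (T -` {a})" for a
  define q where "q a = measure \<nu> (T -` {a})" for a
  have int\<mu>: "(LINT x|\<mu>. g (T x)) = (\<Sum>a\<in>A. g a * p a)" for g :: "real^'n \<Rightarrow> real"
    using integral_finite_range[of \<mu> A T g] fin TA Tvim sets sp m.finite_measure_axioms by (simp add: p_def)
  have int\<nu>: "(LINT x|\<nu>. g (T x)) = (\<Sum>a\<in>A. g a * q a)" for g :: "real^'n \<Rightarrow> real"
    using integral_finite_range[of \<nu> A T g] fin TA Tvim sets sp n.finite_measure_axioms by (simp add: q_def)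
  have nn\<mu>: "(\<integral>\<^sup>+ x. g (T x) \<partial>\<mu>) = (\<Sum>a\<in>A. g a * ennreal (p a))" for g
    using nn_integral_finite_range[of A T \<mu> g] fin TA Tvim sets sp by (simp add: p_def m.emeasure_eq_measure)
  have nn\<nu>: "(\<integral>\<^sup>+ x. g (T x) \<partial>\<nu>) = (\<Sum>a\<in>A. g a * ennreal (q a))" for g
    using nn_integral_finite_range[of A T \<nu> g] fin TA Tvim sets sp by (simp add: q_def n.emeasure_eq_measure)
  have close: "\<bar>(LINT x|\<rho>. \<phi> (T x)) - (LINT x|\<rho>. \<phi> x)\<bar> \<le> (LINT x|\<rho>. dist x (T x))"
    if \<rho>: "\<rho> \<in> P1" and \<phi>: "1-lipschitz_on UNIV \<phi>" for \<rho> and \<phi> :: "real^'n \<Rightarrow> real"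
  proof -
    have [measurable_cong]: "sets \<rho> = sets borel" by (rule P1_D(2)) fact
    have [measurable]: "\<phi> \<in> borel_measurable borel"
      using lipschitz_on_continuous_on[OF \<phi>] by (rule borel_measurable_continuous_onI)
    have d: "\<bar>\<phi> (T x) - \<phi> x\<bar> \<le> dist x (T x)" for x
      using lipschitz_onD[OF \<phi>, of "T x" x] by (simp add: dist_real_def dist_commute)
    have i1: "integrable \<rho> \<phi>" using \<rho> \<phi> by (rule P1_integrable_lipschitz)
    have i2: "integrable \<rho> (\<lambda>x. \<phi> (T x) - \<phi> x)"
      by (rule Bochner_Integration.integrable_bound[OF intT[OF \<rho>]]) (use d in auto)
    have "integrable \<rho> (\<lambda>x. \<phi> (T x))" using Bochner_Integration.integrable_add[OF i1 i2] by simp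
    then have "(LINT x|\<rho>. \<phi> (T x)) - (LINT x|\<rho>. \<phi> x) = (LINT x|\<rho>. \<phi> (T x) - \<phi> x)" using i1 by simp
    also have "\<bar>\<dots>\<bar> \<le> (LINT x|\<rho>. \<bar>\<phi> (T x) - \<phi> x\<bar>)"
      using integral_abs_bound by blast
    also have "\<dots> \<le> (LINT x|\<rho>. dist x (T x))"
      using i2 intT[OF \<rho>] d by (intro integral_mono) auto
    finally show ?thesis .
  qed
  have p: "\<And>a. 0 \<le> p a" "sum p A = 1" using int\<mu>[of "\<lambda>_. 1"] m.prob_space by (auto simp: p_def)
  have q: "\<And>a. 0 \<le> q a" "sum q A = 1" using int\<nu>[of "\<lambda>_. 1"] n.prob_space by (auto simp: q_def)
  have "(\<Sum>a\<in>A. \<phi> a * p a) - (\<Sum>a\<in>A. \<phi> a * q a) \<le> D + 2 * \<delta>" if \<phi>: "1-lipschitz_on UNIV \<phi>" for \<phi>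
    using D[OF \<phi>] close[OF P(1) \<phi>] close[OF P(2) \<phi>] i unfolding T_def[symmetric] int\<mu> int\<nu>  by linarith
  from finite_transport_duality[OF fin p q this]
  obtain w where w: "\<And>a b. 0 \<le> w a b" "\<And>a. a \<in> A \<Longrightarrow> (\<Sum>b\<in>A. w a b) = p a" "\<And>b. b \<in> A \<Longrightarrow> (\<Sum>a\<in>A. w a b) = q b"
    and cost: "(\<Sum>a\<in>A. \<Sum>b\<in>A. w a b * dist a b) \<le> D + 2 * \<delta>" by blast
  have wp: "w a b = 0" if "p a = 0" "a \<in> A" "b \<in> A" for a b
    using w(2)[OF that(2)] that w(1) fin by (simp add: sum_nonneg_eq_0_iff)
  have wq: "w a b = 0" if "q b = 0" "a \<in> A" "b \<in> A" for a b
    using w(3)[OF that(3)] that w(1) fin by (simp add: sum_nonneg_eq_0_iff)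
  \<comment> \<open>Division by 0 gives 0, so \<open>K\<close> vanishes on null cells; this is
    harmless because \<open>w\<close> vanishes there as well (\<open>wp\<close>,
    \<open>wq\<close>).\<close>
  define K where "K a b = ennreal (w a b / (p a * q b))" for a b
  \<comment> \<open>\<open>G\<close> is arbitrary: a function of the finitely many values of
    \<open>T\<close> is a finite sum of multiples of indicators of measurable rectangles.\<close>
  have fm: "(\<lambda>z. G (T (fst z)) (T (snd z))) \<in> borel_measurable (\<mu> \<Otimes>\<^sub>M \<nu>)" for G :: "real^'n \<Rightarrow> real^'n \<Rightarrow> ennreal"
  proof -
    have "(\<lambda>z. (\<Sum>a\<in>A. \<Sum>b\<in>A. G a b * (indicator (T -` {a}) (fst z) * indicator (T -` {b}) (snd z)))) \<in> borel_measurable (\<mu> \<Otimes>\<^sub>M \<nu>)"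
      using Tvim by measurable
    also have "(\<lambda>z. (\<Sum>a\<in>A. \<Sum>b\<in>A. G a b * (indicator (T -` {a}) (fst z) * indicator (T -` {b}) (snd z))))
       = (\<lambda>z. G (T (fst z)) (T (snd z)))"
    proof
      fix z
      have "(\<Sum>a\<in>A. \<Sum>b\<in>A. G a b * (indicator (T -` {a}) (fst z) * indicator (T -` {b}) (snd z)))
        = (\<Sum>a\<in>A. \<Sum>b\<in>A. if b = T (snd z) then (if a = T (fst z) then G a b else 0) else 0)"
        by (intro sum.cong refl) (auto simp: indicator_def)
      then show "(\<Sum>a\<in>A. \<Sum>b\<in>A. G a b * (indicator (T -` {a}) (fst z) * indicator (T -` {b}) (snd z)))
        = G (T (fst z)) (T (snd z))" using fin TA by (simp add: sum.delta)
    qed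
    finally show ?thesis .
  qed
  have Km[measurable]: "(\<lambda>z. K (T (fst z)) (T (snd z))) \<in> borel_measurable (\<mu> \<Otimes>\<^sub>M \<nu>)" by (rule fm)
  have AEp: "AE x in \<mu>. p (T x) \<noteq> 0"
  proof -
    have "AE x in \<mu>. T x \<noteq> a" if "p a = 0" for a
    proof (rule AE_I[of _ _ "T -` {a}"])
      show "emeasure \<mu> (T -` {a}) = 0" using that by (simp add: m.emeasure_eq_measure p_def)
    qed (use Tvim sets in auto)
    then have "AE x in \<mu>. \<forall>a\<in>{a\<in>A. p a = 0}. T x \<noteq> a" using fin by (subst AE_finite_all) auto
    then show ?thesis by eventually_elim (use TA in auto)
  qed
  have AEq: "AE x in \<nu>. q (T x) \<noteq> 0"
  proof -
    have "AE x in \<nu>. T x \<noteq> a" if "q a = 0" for a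
    proof (rule AE_I[of _ _ "T -` {a}"])
      show "emeasure \<nu> (T -` {a}) = 0" using that by (simp add: n.emeasure_eq_measure q_def)
    qed (use Tvim sets in auto)
    then have "AE x in \<nu>. \<forall>a\<in>{a\<in>A. q a = 0}. T x \<noteq> a" using fin by (subst AE_finite_all) auto
    then show ?thesis by eventually_elim (use TA in auto)
  qed
  have Kq: "K a b * ennreal (q b) = ennreal (w a b / p a)" if "a \<in> A" "b \<in> A" for a b
    using w(1) p(1) q(1) wq[OF _ that] by (cases "q b = 0") (auto simp: K_def ennreal_mult[symmetric])
  have Kp: "K a b * ennreal (p a) = ennreal (w a b / q b)" if "a \<in> A" "b \<in> A" for a b
    using w(1) p(1) q(1) wp[OF _ that] by (cases "p a = 0") (auto simp: K_def ennreal_mult[symmetric])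
  have K1: "(\<integral>\<^sup>+ y. K (T x) (T y) \<partial>\<nu>) = 1" if "p (T x) \<noteq> 0" for x
  proof -
    have "(\<integral>\<^sup>+ y. K (T x) (T y) \<partial>\<nu>) = (\<Sum>b\<in>A. ennreal (w (T x) b / p (T x)))"
      unfolding nn\<nu> using Kq TA by (intro sum.cong) auto
    also have "\<dots> = ennreal (\<Sum>b\<in>A. w (T x) b / p (T x))" using w p by (intro sum_ennreal) auto
    also have "\<dots> = 1" using w(2)[OF TA, of x] that by (simp add: sum_divide_distrib[symmetric])
    finally show ?thesis .
  qed
  have K2: "(\<integral>\<^sup>+ x. K (T x) (T y) \<partial>\<mu>) = 1" if "q (T y) \<noteq> 0" for y
  proof -
    have "(\<integral>\<^sup>+ x. K (T x) (T y) \<partial>\<mu>) = (\<Sum>a\<in>A. ennreal (w a (T y) / q (T y)))"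
      unfolding nn\<mu>[of "\<lambda>a. K a (T y)"] using Kp TA by (intro sum.cong) auto
    also have "\<dots> = ennreal (\<Sum>a\<in>A. w a (T y) / q (T y))" using w q by (intro sum_ennreal) auto
    also have "\<dots> = 1" using w(3)[OF TA, of y] that by (simp add: sum_divide_distrib[symmetric])
    finally show ?thesis .
  qed
  interpret mn: pair_prob_space \<mu> \<nu> ..
  \<comment> \<open>On the product of the cells \<open>a\<close> and \<open>b\<close>,
    \<open>\<gamma>\<close> is a multiple of the product measure with total weight
    \<open>w a b\<close>. \<open>K1\<close> and \<open>K2\<close> express that both marginals have
    density 1.\<close>
  define \<gamma> where "\<gamma> = density (\<mu> \<Otimes>\<^sub>M \<nu>) (\<lambda>z. K (T (fst z)) (T (snd z)))"
  have sg: "sets \<gamma> = sets borel"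
    unfolding \<gamma>_def by (simp add: borel_prod[symmetric] cong: sets_pair_measure_cong[OF sets])
  have fst1: "(\<integral>\<^sup>+ z. g (fst z) \<partial>\<gamma>) = (\<integral>\<^sup>+ x. g x \<partial>\<mu>)" if [measurable]: "g \<in> borel_measurable borel" for g
  proof -
    have "(\<integral>\<^sup>+ z. g (fst z) \<partial>\<gamma>) = (\<integral>\<^sup>+ x. \<integral>\<^sup>+ y. K (T x) (T y) * g x \<partial>\<nu> \<partial>\<mu>)"
      unfolding \<gamma>_def by (subst nn_integral_density) (auto simp: n.nn_integral_fst[symmetric])
    also have "\<dots> = (\<integral>\<^sup>+ x. g x \<partial>\<mu>)"
    proof (intro nn_integral_cong_AE, use AEp in eventually_elim)
      fix x assume "p (T x) \<noteq> 0"
      have "(\<lambda>y. K (T x) (T y)) \<in> borel_measurable \<nu>"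
        using measurable_compose[OF measurable_Pair1' Km, of x] sp by simp
      then have "(\<integral>\<^sup>+ y. K (T x) (T y) * g x \<partial>\<nu>) = (\<integral>\<^sup>+ y. K (T x) (T y) \<partial>\<nu>) * g x"
        by (rule nn_integral_multc)
      then show "(\<integral>\<^sup>+ y. K (T x) (T y) * g x \<partial>\<nu>) = g x" by (simp add: K1 \<open>p (T x) \<noteq> 0\<close>)
    qed
    finally show ?thesis .
  qed
  have snd1: "(\<integral>\<^sup>+ z. g (snd z) \<partial>\<gamma>) = (\<integral>\<^sup>+ x. g x \<partial>\<nu>)" if [measurable]: "g \<in> borel_measurable borel" for g
  proof -
    have "(\<integral>\<^sup>+ z. g (snd z) \<partial>\<gamma>) = (\<integral>\<^sup>+ y. \<integral>\<^sup>+ x. K (T x) (T y) * g y \<partial>\<mu> \<partial>\<nu>)"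
      unfolding \<gamma>_def by (subst nn_integral_density) (auto simp: mn.nn_integral_snd[symmetric])
    also have "\<dots> = (\<integral>\<^sup>+ x. g x \<partial>\<nu>)"
    proof (intro nn_integral_cong_AE, use AEq in eventually_elim)
      fix y assume "q (T y) \<noteq> 0"
      have "(\<lambda>x. K (T x) (T y)) \<in> borel_measurable \<mu>"
        using measurable_compose[OF measurable_Pair2' Km, of y] sp by simp
      then have "(\<integral>\<^sup>+ x. K (T x) (T y) * g y \<partial>\<mu>) = (\<integral>\<^sup>+ x. K (T x) (T y) \<partial>\<mu>) * g y"
        by (rule nn_integral_multc)
      then show "(\<integral>\<^sup>+ x. K (T x) (T y) * g y \<partial>\<mu>) = g y" by (simp add: K2 \<open>q (T y) \<noteq> 0\<close>)
    qed
    finally show ?thesis .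
  qed
  have fs[measurable]: "fst \<in> measurable \<gamma> borel" "snd \<in> measurable \<gamma> borel"
    by (simp_all add: measurable_cong_sets[OF sg refl] borel_measurable_continuous_onI continuous_intros)
  have spg: "space \<gamma> = UNIV" using sets_eq_imp_space_eq[OF sg] by simp
  have "\<gamma> \<in> couplings \<mu> \<nu>"
    unfolding couplings_def
  proof (intro CollectI conjI)
    show "prob_space \<gamma>"
      using fst1[of "\<lambda>_. 1"] by (intro prob_spaceI) (simp add: m.emeasure_space_1)
    show "sets \<gamma> = sets borel" by (rule sg)
    show "distr \<gamma> borel fst = \<mu>"
    proof (rule measure_eqI)
      fix B assume "B \<in> sets (distr \<gamma> borel fst)"
      then have B[measurable]: "B \<in> sets borel" by simp
      have "emeasure (distr \<gamma> borel fst) B = (\<integral>\<^sup>+ z. indicator B z \<partial>distr \<gamma> borel fst)" by simp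
      also have "\<dots> = (\<integral>\<^sup>+ z. indicator B (fst z) \<partial>\<gamma>)" by (rule nn_integral_distr) auto
      also have "\<dots> = emeasure \<mu> B" by (subst fst1) (auto simp: sets)
      finally show "emeasure (distr \<gamma> borel fst) B = emeasure \<mu> B" .
    qed (simp add: sets)
    show "distr \<gamma> borel snd = \<nu>"
    proof (rule measure_eqI)
      fix B assume "B \<in> sets (distr \<gamma> borel snd)"
      then have B[measurable]: "B \<in> sets borel" by simp
      have "emeasure (distr \<gamma> borel snd) B = (\<integral>\<^sup>+ z. indicator B z \<partial>distr \<gamma> borel snd)" by simp
      also have "\<dots> = (\<integral>\<^sup>+ z. indicator B (snd z) \<partial>\<gamma>)" by (rule nn_integral_distr) auto
      also have "\<dots> = emeasure \<nu> B" by (subst snd1) (auto simp: sets)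
      finally show "emeasure (distr \<gamma> borel snd) B = emeasure \<nu> B" .
    qed (simp add: sets)
  qed
  moreover have "(\<integral>\<^sup>+ z. ennreal (dist (fst z) (snd z)) \<partial>\<gamma>) \<le> ennreal (D + e)"
  proof -
    have gm[measurable]: "(\<lambda>z. ennreal (dist (T (fst z)) (T (snd z)))) \<in> borel_measurable \<gamma>"
      using fm[of "\<lambda>a b. ennreal (dist a b)"] unfolding \<gamma>_def by simp
    have h: "(\<lambda>z. ennreal (dist (fst z) (T (fst z)))) \<in> borel_measurable \<gamma>"
      "(\<lambda>z. ennreal (dist (snd z) (T (snd z)))) \<in> borel_measurable \<gamma>"
      by (rule measurable_compose[OF fs(1), of "\<lambda>x. ennreal (dist x (T x))"] measurable_compose[OF fs(2), of "\<lambda>x. ennreal (dist x (T x))"], measurable)+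
    \<comment> \<open>The triangle inequality through \<open>T (fst z)\<close> and
      \<open>T (snd z)\<close> splits the cost into two displacements, known from the marginals, and
      the cost of the discrete plan.\<close>
    have "(\<integral>\<^sup>+ z. ennreal (dist (fst z) (snd z)) \<partial>\<gamma>) \<le>
      (\<integral>\<^sup>+ z. ennreal (dist (fst z) (T (fst z))) + (ennreal (dist (T (fst z)) (T (snd z))) + ennreal (dist (snd z) (T (snd z)))) \<partial>\<gamma>)"
    proof (intro nn_integral_mono)
      fix z :: "(real^'n) \<times> (real^'n)"
      have "dist (fst z) (snd z) \<le> dist (fst z) (T (fst z)) + (dist (T (fst z)) (T (snd z)) + dist (snd z) (T (snd z)))"
        using dist_triangle[of "fst z" "snd z" "T (fst z)"] dist_triangle[of "T (fst z)" "snd z" "T (snd z)"]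
        by (simp add: dist_commute)
      then show "ennreal (dist (fst z) (snd z)) \<le> ennreal (dist (fst z) (T (fst z))) + (ennreal (dist (T (fst z)) (T (snd z))) + ennreal (dist (snd z) (T (snd z))))"
        by (simp flip: ennreal_plus)
    qed
    also have "\<dots> = (\<integral>\<^sup>+ z. ennreal (dist (fst z) (T (fst z))) \<partial>\<gamma>) + ((\<integral>\<^sup>+ z. ennreal (dist (T (fst z)) (T (snd z))) \<partial>\<gamma>)
       + (\<integral>\<^sup>+ z. ennreal (dist (snd z) (T (snd z))) \<partial>\<gamma>))"
      by (simp add: nn_integral_add h gm)
    also have "(\<integral>\<^sup>+ z. ennreal (dist (fst z) (T (fst z))) \<partial>\<gamma>) = ennreal (LINT x|\<mu>. dist x (T x))"
      using fst1[of "\<lambda>x. ennreal (dist x (T x))"] nn_integral_eq_integral[OF intT[OF P(1)]] by simp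
    also have "(\<integral>\<^sup>+ z. ennreal (dist (snd z) (T (snd z))) \<partial>\<gamma>) = ennreal (LINT x|\<nu>. dist x (T x))"
      using snd1[of "\<lambda>x. ennreal (dist x (T x))"] nn_integral_eq_integral[OF intT[OF P(2)]] by simp
    also have "(\<integral>\<^sup>+ z. ennreal (dist (T (fst z)) (T (snd z))) \<partial>\<gamma>) =
       (\<integral>\<^sup>+ x. \<integral>\<^sup>+ y. K (T x) (T y) * ennreal (dist (T x) (T y)) \<partial>\<nu> \<partial>\<mu>)"
      using fm[of "\<lambda>a b. ennreal (dist a b)"] fm[of "\<lambda>a b. K a b * ennreal (dist a b)"]
      unfolding \<gamma>_def by (subst nn_integral_density) (auto simp: n.nn_integral_fst[symmetric])
    also have "\<dots> = (\<Sum>a\<in>A. (\<Sum>b\<in>A. (K a b * ennreal (dist a b)) * ennreal (q b)) * ennreal (p a))"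
      using nn\<nu>[of "\<lambda>b. K a b * ennreal (dist a b)" for a]
      by (simp add: nn\<mu>[of "\<lambda>a. \<Sum>b\<in>A. (K a b * ennreal (dist a b)) * ennreal (q b)"])
    also have "\<dots> = (\<Sum>a\<in>A. \<Sum>b\<in>A. ennreal (w a b * dist a b))"
    proof (intro sum.cong refl)
      fix a assume a: "a \<in> A"
      have "(K a b * ennreal (dist a b)) * ennreal (q b) * ennreal (p a) = ennreal (w a b * dist a b)" if b: "b \<in> A" for b
      proof -
        have "(K a b * ennreal (dist a b)) * ennreal (q b) * ennreal (p a) = ennreal (w a b / p a) * ennreal (p a) * ennreal (dist a b)"
          unfolding Kq[OF a b, symmetric] by (simp add: ac_simps)
        also have "\<dots> = ennreal (w a b / p a * p a * dist a b)"
          using w(1) p(1) by (simp add: ennreal_mult del: times_divide_eq_left)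
        also have "w a b / p a * p a = w a b" using wp[OF _ a b] by auto
        finally show ?thesis .
      qed
      then show "(\<Sum>b\<in>A. (K a b * ennreal (dist a b)) * ennreal (q b)) * ennreal (p a) = (\<Sum>b\<in>A. ennreal (w a b * dist a b))"
        unfolding sum_distrib_right by (intro sum.cong) auto
    qed
    also have "\<dots> = ennreal (\<Sum>a\<in>A. \<Sum>b\<in>A. w a b * dist a b)"
      using w(1) by (simp add: sum_nonneg)
    also have "ennreal (LINT x|\<mu>. dist x (T x)) + (ennreal (\<Sum>a\<in>A. \<Sum>b\<in>A. w a b * dist a b) + ennreal (LINT x|\<nu>. dist x (T x)))
       = ennreal ((LINT x|\<mu>. dist x (T x)) + ((\<Sum>a\<in>A. \<Sum>b\<in>A. w a b * dist a b) + (LINT x|\<nu>. dist x (T x))))"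
      using w(1) by (simp add: sum_nonneg)
    also have "\<dots> \<le> ennreal (D + e)"
      using cost i unfolding T_def[symmetric] by (intro ennreal_leI) (simp add: \<delta>_def)
    finally show ?thesis .
  qed
  ultimately show "d1 \<mu> \<nu> \<le> D + e" using \<open>0 \<le> D\<close> e by (intro d1_le_cost) auto
qed

text \<open>The test class for the weak formulations: mollifying its members gives smooth functions
  of bounded support, and the discrete flow maps it into itself after normalisation.\<close>

definition lipc :: "('a::euclidean_space \<Rightarrow> real) set"
  where "lipc = {\<phi>. 1-lipschitz_on UNIV \<phi> \<and> (\<exists>R. \<forall>x. R < norm x \<longrightarrow> \<phi> x = 0)}"

text \<open>Clamping \<open>\<phi> - \<phi> 0\<close> between plus and minus
  \<open>max 0 (R - norm x)\<close> keeps the Lipschitz constant 1 and makes the support bounded; at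
  a fixed \<open>x\<close> nothing changes once \<open>R \<ge> 2 * norm x\<close>. The constant
  \<open>\<phi> 0\<close> cancels between two probability measures, and \<open>norm\<close> is the
  majorant.\<close>

lemma d1_le_of_lipc:
  fixes \<mu> \<nu> :: "(real^'n) measure"
  assumes P: "\<mu> \<in> P1" "\<nu> \<in> P1"
    and D: "\<And>\<phi>. \<phi> \<in> lipc \<Longrightarrow> (LINT x|\<mu>. \<phi> x) - (LINT x|\<nu>. \<phi> x) \<le> D"
  shows "d1 \<mu> \<nu> \<le> D"
proof (rule d1_le_of_lipschitz[OF P])
  fix \<phi> :: "real^'n \<Rightarrow> real" assume \<phi>: "1-lipschitz_on UNIV \<phi>"
  define \<psi> where "\<psi> R x = max (min (\<phi> x - \<phi> 0) (max 0 (R - norm x))) (- max 0 (R - norm x))" for R x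
  have lip: "1-lipschitz_on UNIV (\<psi> R)" for R
  proof (rule lipschitz_onI)
    fix x y
    have "\<bar>\<phi> x - \<phi> y\<bar> \<le> dist x y" using lipschitz_onD[OF \<phi>, of x y] by (simp add: dist_real_def)
    moreover have "\<bar>norm x - norm y\<bar> \<le> dist x y" by (simp add: dist_norm norm_triangle_ineq3)
    ultimately have "\<bar>\<psi> R x - \<psi> R y\<bar> \<le> dist x y" unfolding \<psi>_def by linarith
    then show "dist (\<psi> R x) (\<psi> R y) \<le> 1 * dist x y" by (simp add: dist_real_def)
  qed simp
  have \<phi>b: "\<bar>\<phi> x - \<phi> 0\<bar> \<le> norm x" for x using lipschitz_onD[OF \<phi>, of x 0] by (simp add: dist_real_def)
  have "\<psi> R \<in> lipc" for R
    using lip[of R] by (auto simp: lipc_def \<psi>_def intro!: exI[of _ R])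
  then have le: "(LINT x|\<mu>. \<psi> (real n) x) - (LINT x|\<nu>. \<psi> (real n) x) \<le> D" for n by (rule D)
  have lim: "(\<lambda>n. LINT x|\<rho>. \<psi> (real n) x) \<longlonglongrightarrow> (LINT x|\<rho>. \<phi> x) - \<phi> 0" if \<rho>: "\<rho> \<in> P1" for \<rho> :: "(real^'n) measure"
  proof -
    have [measurable_cong]: "sets \<rho> = sets borel" by (rule P1_D(2)) fact
    interpret prob_space \<rho> by (rule P1_D(1)) fact
    have [measurable]: "\<phi> \<in> borel_measurable borel"
      using lipschitz_on_continuous_on[OF \<phi>] by (rule borel_measurable_continuous_onI)
    have [measurable]: "\<psi> R \<in> borel_measurable borel" for R unfolding \<psi>_def by measurable
    have "(\<lambda>n. LINT x|\<rho>. \<psi> (real n) x) \<longlonglongrightarrow> (LINT x|\<rho>. \<phi> x - \<phi> 0)"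
    proof (rule integral_dominated_convergence[where w = norm])
      show "integrable \<rho> norm" using P1_D(4)[OF \<rho>] by simp
      show "AE x in \<rho>. (\<lambda>n. \<psi> (real n) x) \<longlonglongrightarrow> \<phi> x - \<phi> 0"
      proof (rule AE_I2)
        fix x :: "real^'n"
        have "\<forall>\<^sub>F n in sequentially. 2 * norm x \<le> real n"
          using filterlim_real_sequentially by (auto simp: filterlim_at_top)
        then have "\<forall>\<^sub>F n in sequentially. \<psi> (real n) x = \<phi> x - \<phi> 0"
        proof eventually_elim
          case (elim n)
          then show ?case using \<phi>b[of x] unfolding \<psi>_def by linarith
        qed
        then show "(\<lambda>n. \<psi> (real n) x) \<longlonglongrightarrow> \<phi> x - \<phi> 0" by (rule tendsto_eventually)
      qed
      show "AE x in \<rho>. norm (\<psi> (real n) x) \<le> norm x" for n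
      proof (rule AE_I2)
        show "norm (\<psi> (real n) x) \<le> norm x" for x using \<phi>b[of x] unfolding \<psi>_def real_norm_def by linarith
      qed
    qed auto
    then show ?thesis using P1_integrable_lipschitz[OF \<rho> \<phi>] by (simp add: prob_space)
  qed
  have "(\<lambda>n. (LINT x|\<mu>. \<psi> (real n) x) - (LINT x|\<nu>. \<psi> (real n) x)) \<longlonglongrightarrow> ((LINT x|\<mu>. \<phi> x) - \<phi> 0) - ((LINT x|\<nu>. \<phi> x) - \<phi> 0)"
    using lim P by (intro tendsto_diff) auto
  then have "((LINT x|\<mu>. \<phi> x) - \<phi> 0) - ((LINT x|\<nu>. \<phi> x) - \<phi> 0) \<le> D"
    using le by (intro LIMSEQ_le_const2) auto
  then show "(LINT x|\<mu>. \<phi> x) - (LINT x|\<nu>. \<phi> x) \<le> D" by simp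
qed

text \<open>The dual description replaces the gluing of two couplings along their common
  marginal.\<close>

lemma d1_triangle:
  fixes \<mu> \<nu> \<rho> :: "(real^'n) measure"
  assumes "\<mu> \<in> P1" "\<nu> \<in> P1" "\<rho> \<in> P1"
  shows "d1 \<mu> \<rho> \<le> d1 \<mu> \<nu> + d1 \<nu> \<rho>"
proof (rule d1_le_of_lipschitz[OF assms(1,3)])
  fix \<phi> :: "real^'n \<Rightarrow> real" assume "1-lipschitz_on UNIV \<phi>"
  then show "(LINT x|\<mu>. \<phi> x) - (LINT x|\<rho>. \<phi> x) \<le> d1 \<mu> \<nu> + d1 \<nu> \<rho>"
    using integral_diff_le_d1_unit[OF assms(1,2)] integral_diff_le_d1_unit[OF assms(2,3)] by force
qed

lemma d1_commute:
  fixes \<mu> \<nu> :: "(real^'n) measure"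
  assumes "\<mu> \<in> P1" "\<nu> \<in> P1"
  shows "d1 \<mu> \<nu> = d1 \<nu> \<mu>"
proof -
  have *: "d1 \<mu> \<nu> \<le> d1 \<nu> \<mu>" if "\<mu> \<in> P1" "\<nu> \<in> P1" for \<mu> \<nu> :: "(real^'n) measure"
    using abs_integral_diff_le_d1[OF that(2,1), of 1] by (intro d1_le_of_lipschitz[OF that]) force
  show ?thesis using *[of \<mu> \<nu>] *[of \<nu> \<mu>] assms by simp
qed

lemma d1_self:
  fixes \<mu> :: "(real^'n) measure"
  assumes "\<mu> \<in> P1"
  shows "d1 \<mu> \<mu> = 0"
  using d1_le_of_lipschitz[OF assms assms, of 0] d1_nonneg[of \<mu> \<mu>] by simp

section \<open>Smooth functions and mollification\<close>

definition pd :: "'a::euclidean_space \<Rightarrow> ('a \<Rightarrow> real) \<Rightarrow> 'a \<Rightarrow> real"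
  where "pd i f = (\<lambda>x. frechet_derivative f (at x) i)"

lemma C_class_Suc_pd:
  "C_class (Suc k) f \<longleftrightarrow> (\<forall>x. f differentiable (at x)) \<and> (\<forall>i\<in>Basis. C_class k (pd i f))"
  by (simp add: pd_def)

lemma has_derivative_pd: "(f has_derivative f') (at x) \<Longrightarrow> pd i f x = f' i"
  unfolding pd_def by (metis frechet_derivative_at)

lemma has_derivative_sum_pd:
  fixes f :: "'a::euclidean_space \<Rightarrow> real"
  assumes "f differentiable (at x)"
  shows "(f has_derivative (\<lambda>h. \<Sum>i\<in>Basis. (h \<bullet> i) * pd i f x)) (at x)"
proof -
  have d: "(f has_derivative frechet_derivative f (at x)) (at x)"
    using assms by (simp add: frechet_derivative_works)
  interpret bounded_linear "frechet_derivative f (at x)" using d by (rule has_derivative_bounded_linear)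
  have "frechet_derivative f (at x) h = (\<Sum>i\<in>Basis. (h \<bullet> i) * pd i f x)" for h
  proof -
    have "frechet_derivative f (at x) h = frechet_derivative f (at x) (\<Sum>i\<in>Basis. (h \<bullet> i) *\<^sub>R i)"
      by (simp add: euclidean_representation)
    also have "\<dots> = (\<Sum>i\<in>Basis. (h \<bullet> i) * pd i f x)" by (simp add: sum scaleR pd_def)
    finally show ?thesis .
  qed
  then have "frechet_derivative f (at x) = (\<lambda>h. \<Sum>i\<in>Basis. (h \<bullet> i) * pd i f x)" by auto
  then show ?thesis using d by simp
qed

lemma C_class_Suc_D: "C_class (Suc k) f \<Longrightarrow> C_class k f"
proof (induction k arbitrary: f)
  case 0
  then show ?case
    by (auto intro!: continuous_at_imp_continuous_on differentiable_imp_continuous_within)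
next
  case (Suc k)
  then show ?case unfolding C_class_Suc_pd[of "Suc k"] C_class_Suc_pd[of k] by blast
qed

lemma C_class_mono: "C_class k f \<Longrightarrow> j \<le> k \<Longrightarrow> C_class j f"
  by (induction k) (auto simp: le_Suc_eq simp del: C_class.simps dest: C_class_Suc_D)

lemma C_class_continuous: "C_class k f \<Longrightarrow> continuous_on UNIV f"
  using C_class_mono[of k f 0] by simp

lemma C_class_const: "C_class k (\<lambda>x. c)"
proof (induction k arbitrary: c)
  case (Suc k)
  have "pd i (\<lambda>x. c) = (\<lambda>x. 0)" for i :: 'a
    by (rule ext, subst has_derivative_pd[OF has_derivative_const]) simp
  then show ?case using Suc by (simp add: C_class_Suc_pd del: C_class.simps)
qed simp

lemma pd_add:
  assumes "\<And>x. f differentiable (at x)" "\<And>x. g differentiable (at x)"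
  shows "pd i (\<lambda>x. f x + g x) = (\<lambda>x. pd i f x + pd i g x)"
proof
  fix x
  show "pd i (\<lambda>x. f x + g x) x = pd i f x + pd i g x"
    using has_derivative_pd[OF has_derivative_add[OF assms[unfolded frechet_derivative_works]], of i]
    by (simp add: pd_def)
qed

lemma pd_mult:
  assumes "\<And>x. f differentiable (at x)" "\<And>x. g differentiable (at x)"
  shows "pd i (\<lambda>x. f x * g x) = (\<lambda>x. f x * pd i g x + pd i f x * g x)"
proof
  fix x
  show "pd i (\<lambda>x. f x * g x) x = f x * pd i g x + pd i f x * g x"
    using has_derivative_pd[OF has_derivative_mult[OF assms[unfolded frechet_derivative_works]], of i]
    by (simp add: pd_def)
qed

lemma C_class_add: "C_class k f \<Longrightarrow> C_class k g \<Longrightarrow> C_class k (\<lambda>x. f x + g x)"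
proof (induction k arbitrary: f g)
  case 0 then show ?case by (auto intro: continuous_intros)
next
  case (Suc k)
  then show ?case unfolding C_class_Suc_pd by (auto simp: pd_add)
qed

lemma C_class_mult: "C_class k f \<Longrightarrow> C_class k g \<Longrightarrow> C_class k (\<lambda>x. f x * g x)"
proof (induction k arbitrary: f g)
  case 0 then show ?case by (auto intro: continuous_intros)
next
  case (Suc k)
  have "C_class k f" "C_class k g" using Suc.prems C_class_Suc_D by blast+
  moreover have "\<And>i. i \<in> Basis \<Longrightarrow> C_class k (pd i f)" "\<And>i. i \<in> Basis \<Longrightarrow> C_class k (pd i g)"
    "\<And>x. f differentiable (at x)" "\<And>x. g differentiable (at x)"
    using Suc.prems unfolding C_class_Suc_pd by auto
  ultimately show ?case unfolding C_class_Suc_pd by (simp add: pd_mult C_class_add Suc.IH)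
qed

lemma C_class_sum: "(\<And>i. i \<in> I \<Longrightarrow> C_class k (f i)) \<Longrightarrow> C_class k (\<lambda>x. \<Sum>i\<in>I. f i x)"
  by (induction I rule: infinite_finite_induct) (auto intro: C_class_add C_class_const simp del: C_class.simps)

lemma C_class_linear:
  fixes A :: "'a::euclidean_space \<Rightarrow> real"
  assumes "bounded_linear A"
  shows "C_class k A"
proof (cases k)
  case 0
  then show ?thesis using assms by (auto intro: linear_continuous_on)
next
  case (Suc j)
  have D: "(A has_derivative A) (at x)" for x using assms by (rule bounded_linear_imp_has_derivative)
  have "pd i A = (\<lambda>x. A i)" for i using has_derivative_pd[OF D] by auto
  then show ?thesis unfolding Suc C_class_Suc_pd using differentiableI[OF D] by (auto simp: C_class_const)
qed

lemma differentiable_componentwise: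
  fixes G :: "'a::euclidean_space \<Rightarrow> 'b::euclidean_space"
  assumes "\<And>j. j \<in> Basis \<Longrightarrow> (\<lambda>x. G x \<bullet> j) differentiable (at x)"
  shows "G differentiable (at x)"
  using assms by (subst differentiable_componentwise_within) auto

lemma pd_compose:
  fixes P :: "'b::euclidean_space \<Rightarrow> real" and G :: "'a::euclidean_space \<Rightarrow> 'b"
  assumes P: "\<And>y. P differentiable (at y)" and G: "\<And>x j. j \<in> Basis \<Longrightarrow> (\<lambda>x. G x \<bullet> j) differentiable (at x)"
  shows "(\<lambda>x. P (G x)) differentiable (at x)"
    "pd i (\<lambda>x. P (G x)) x = (\<Sum>j\<in>Basis. pd i (\<lambda>x. G x \<bullet> j) x * pd j P (G x))"
proof -
  have G': "(G has_derivative frechet_derivative G (at x)) (at x)"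
    using differentiable_componentwise[OF G] by (simp add: frechet_derivative_works)
  from has_derivative_compose[OF this has_derivative_sum_pd[OF P]]
  have D: "((\<lambda>x. P (G x)) has_derivative (\<lambda>h. \<Sum>j\<in>Basis. (frechet_derivative G (at x) h \<bullet> j) * pd j P (G x))) (at x)" .
  then show "(\<lambda>x. P (G x)) differentiable (at x)" by (rule differentiableI)
  have "pd i (\<lambda>x. G x \<bullet> j) x = frechet_derivative G (at x) i \<bullet> j" for j
    using has_derivative_inner_left[OF G', of j] by (rule has_derivative_pd)
  then show "pd i (\<lambda>x. P (G x)) x = (\<Sum>j\<in>Basis. pd i (\<lambda>x. G x \<bullet> j) x * pd j P (G x))"
    unfolding has_derivative_pd[OF D] by simp
qed

text \<open>The induction runs over all \<open>P\<close>: a partial derivative of the composite is a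
  sum of products of a derivative of a component of \<open>G\<close> with
  \<open>pd j P (G x)\<close>, and the latter is a composite of one order less.\<close>

lemma C_class_compose_euclidean:
  fixes P :: "'b::euclidean_space \<Rightarrow> real" and G :: "'a::euclidean_space \<Rightarrow> 'b"
  shows "C_class k P \<Longrightarrow> (\<And>j. j \<in> Basis \<Longrightarrow> C_class k (\<lambda>x. G x \<bullet> j)) \<Longrightarrow> C_class k (\<lambda>x. P (G x))"
proof (induction k arbitrary: P)
  case 0
  have "continuous_on UNIV G" using 0(2) by (subst continuous_on_componentwise) auto
  then show ?case using 0(1) by (auto intro: continuous_on_compose2)
next
  case (Suc k)
  have P: "P differentiable (at y)" for y using Suc.prems(1) by simp
  have G: "(\<lambda>x. G x \<bullet> j) differentiable (at x)" if "j \<in> Basis" for x j using Suc.prems(2)[OF that] by simp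
  have "C_class k (pd i (\<lambda>x. P (G x)))" if i: "i \<in> Basis" for i
  proof -
    have eq: "pd i (\<lambda>x. P (G x)) = (\<lambda>x. \<Sum>j\<in>Basis. pd i (\<lambda>x. G x \<bullet> j) x * pd j P (G x))"
      using pd_compose(2)[of P G, OF P G] by (rule ext)
    have G1: "C_class k (pd i (\<lambda>x. G x \<bullet> j))" and G0: "C_class k (\<lambda>x. G x \<bullet> j)" and P1: "C_class k (pd j P)" if "j \<in> Basis" for j
      using Suc.prems(1) Suc.prems(2)[OF that] i that C_class_Suc_D[OF Suc.prems(2)[OF that]]
      unfolding C_class_Suc_pd by auto
    have "C_class k (\<lambda>x. pd j P (G x))" if "j \<in> Basis" for j using P1[OF that] G0 by (rule Suc.IH)
    then show ?thesis unfolding eq by (intro C_class_sum C_class_mult G1)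
  qed
  then show ?case unfolding C_class_Suc_pd using pd_compose(1)[of P G, OF P G] by blast
qed

lemma C_class_compose:
  fixes f :: "real \<Rightarrow> real" and g :: "'a::euclidean_space \<Rightarrow> real"
  assumes "C_class k f" "C_class k g"
  shows "C_class k (\<lambda>x. f (g x))"
  using assms(1) by (rule C_class_compose_euclidean) (simp add: assms(2) del: C_class.simps)

lemma C_class_linear_compose:
  fixes g :: "'b::euclidean_space \<Rightarrow> real" and A :: "'a::euclidean_space \<Rightarrow> 'b"
  assumes A: "bounded_linear A" and g: "C_class k g"
  shows "C_class k (\<lambda>x. g (A x + c))"
  using g
proof (rule C_class_compose_euclidean)
  show "C_class k (\<lambda>x. (A x + c) \<bullet> j)" for j
    unfolding inner_add_left
    by (rule C_class_add[OF C_class_linear[OF bounded_linear_compose[OF bounded_linear_inner_left A]] C_class_const])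
qed

section \<open>A smooth bump and the mollifying kernel\<close>

text \<open>The family \<open>P(1/s) exp(-1/s)\<close>, extended by zero, is closed under differentiation.\<close>

definition flat :: "real poly \<Rightarrow> real \<Rightarrow> real"
  where "flat P s = (if 0 < s then poly P (inverse s) * exp (- inverse s) else 0)"

lemma poly_times_exp_minus_tendsto_0:
  "((\<lambda>y::real. poly P y * exp (- y)) \<longlongrightarrow> 0) at_top"
proof -
  have "((\<lambda>y::real. \<Sum>i\<le>degree P. coeff P i * (y ^ i / exp y)) \<longlongrightarrow> (\<Sum>i\<le>degree P. coeff P i * 0)) at_top"
    by (intro tendsto_sum tendsto_mult tendsto_const tendsto_power_div_exp_0)
  also have "(\<lambda>y::real. \<Sum>i\<le>degree P. coeff P i * (y ^ i / exp y)) = (\<lambda>y. poly P y * exp (- y))"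
    by (rule ext) (simp add: poly_altdef sum_distrib_right exp_minus divide_inverse mult.assoc)
  finally show ?thesis by simp
qed

text \<open>With \<open>y = 1 / s\<close>, differentiation in \<open>s\<close> is
  \<open>- y\<^sup>2\<close> times differentiation in \<open>y\<close>, and
  \<open>P(y) exp(- y)\<close> becomes \<open>y\<^sup>2 (P - P')(y) exp(- y)\<close>. At 0 the
  exponential beats every power of \<open>y\<close>.\<close>

lemma flat_has_derivative:
  "(flat P has_real_derivative flat (monom 1 2 * (P - pderiv P)) s) (at s)"
proof -
  consider "0 < s" | "s < 0" | "s = 0" by linarith
  then show ?thesis
  proof cases
    case 1
    have "((\<lambda>s. poly P (inverse s) * exp (- inverse s)) has_real_derivative flat (monom 1 2 * (P - pderiv P)) s) (at s)"
      using 1 by (auto intro!: derivative_eq_intros DERIV_chain'[OF _ poly_DERIV]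
          simp: flat_def poly_monom power2_eq_square algebra_simps)
    moreover have "\<forall>\<^sub>F t in nhds s. flat P t = poly P (inverse t) * exp (- inverse t)"
      using eventually_nhds_in_open[of "{0<..}" s] 1 by (auto simp: flat_def elim!: eventually_mono)
    ultimately show ?thesis by (subst DERIV_cong_ev[OF refl _ refl])
  next
    case 2
    have "\<forall>\<^sub>F t in nhds s. flat P t = 0"
      using eventually_nhds_in_open[of "{..<0}" s] 2 by (auto simp: flat_def elim!: eventually_mono)
    then show ?thesis using 2 by (subst DERIV_cong_ev[OF refl _ refl]) (auto simp: flat_def)
  next
    case 3
    have "((\<lambda>h. (flat P (0 + h) - flat P 0) / h) \<longlongrightarrow> 0) (at 0)"
    proof (rule filterlim_split_at)
      have "\<forall>\<^sub>F h in at_left (0::real). (flat P (0 + h) - flat P 0) / h = 0"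
        by (auto simp: flat_def eventually_at_filter)
      then show "((\<lambda>h. (flat P (0 + h) - flat P 0) / h) \<longlongrightarrow> 0) (at_left 0)"
        by (rule tendsto_eventually)
      \<comment> \<open>Dividing by \<open>h\<close> is multiplying by \<open>y = 1 / h\<close>,
        hence the polynomial \<open>pCons 0 P\<close>.\<close>
      have "((\<lambda>h. poly (pCons 0 P) (inverse h) * exp (- inverse h)) \<longlongrightarrow> 0) (at_right (0::real))"
        by (rule filterlim_compose[OF poly_times_exp_minus_tendsto_0 filterlim_inverse_at_top_right])
      moreover have "\<forall>\<^sub>F h in at_right (0::real). poly (pCons 0 P) (inverse h) * exp (- inverse h) = (flat P (0 + h) - flat P 0) / h"
        by (auto simp: flat_def eventually_at_filter field_simps)
      ultimately show "((\<lambda>h. (flat P (0 + h) - flat P 0) / h) \<longlongrightarrow> 0) (at_right 0)"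
        by (rule Lim_transform_eventually)
    qed
    then show ?thesis using 3 by (simp add: DERIV_def flat_def)
  qed
qed

lemma C_class_flat: "C_class k (flat P)"
proof (induction k arbitrary: P)
  case 0
  show ?case using flat_has_derivative[of P] by (auto intro!: continuous_at_imp_continuous_on DERIV_isCont)
next
  case (Suc k)
  have D: "(flat P has_derivative (\<lambda>h. h * flat (monom 1 2 * (P - pderiv P)) s)) (at s)" for s
    using flat_has_derivative[of P s] by (simp add: has_field_derivative_def mult.commute[of "flat _ _"] mult_commute_abs)
  have "pd 1 (flat P) = flat (monom 1 2 * (P - pderiv P))" using has_derivative_pd[OF D] by auto
  then show ?case using Suc D unfolding C_class_Suc_pd by (auto intro: differentiableI)
qed

text \<open>Inside the ball this is \<open>exp (- 1 / (\<delta>\<^sup>2 - x \<bullet> x))\<close>; a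
  polynomial argument in place of the norm makes smoothness at the centre a case of the chain
  rule.\<close>

definition bump0 :: "real \<Rightarrow> 'a::euclidean_space \<Rightarrow> real"
  where "bump0 \<delta> x = flat 1 (\<delta>\<^sup>2 - x \<bullet> x)"

lemma C_class_bump0: "C_class k (bump0 \<delta>)"
proof -
  have "C_class k (\<lambda>x::'a. \<delta>\<^sup>2 + (\<Sum>i\<in>Basis. (-1) * ((x \<bullet> i) * (x \<bullet> i))))"
    by (intro C_class_add C_class_const C_class_sum C_class_mult C_class_linear bounded_linear_inner_left)
  from C_class_compose[OF C_class_flat[of k 1] this]
  show ?thesis by (simp add: bump0_def[abs_def] euclidean_inner[of x x for x] sum_negf)
qed

lemma bump0_nonneg: "0 \<le> bump0 \<delta> x"
  by (simp add: bump0_def flat_def)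

lemma bump0_eq_0: "0 < \<delta> \<Longrightarrow> \<delta> \<le> norm x \<Longrightarrow> bump0 \<delta> x = 0"
  using power_mono[of \<delta> "norm x" 2] by (simp add: bump0_def flat_def power2_norm_eq_inner)

lemma bump0_pos: "0 < \<delta> \<Longrightarrow> norm x < \<delta> \<Longrightarrow> 0 < bump0 \<delta> x"
  using power_strict_mono[of "norm x" \<delta> 2] by (simp add: bump0_def flat_def power2_norm_eq_inner)

lemma integrable_continuous_bounded_support:
  fixes f :: "'a::euclidean_space \<Rightarrow> real"
  assumes "continuous_on UNIV f" "\<And>x. R < norm x \<Longrightarrow> f x = 0"
  shows "integrable lborel f"
proof -
  have "set_integrable lborel (cball 0 R) f"
    unfolding set_integrable_def
    using assms(1) by (intro borel_integrable_compact) (auto intro: continuous_on_subset)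
  moreover have "indicator (cball 0 R) x *\<^sub>R f x = f x" for x
    using assms(2)[of x] by (cases "norm x \<le> R") auto
  then have "(\<lambda>x. indicator (cball 0 R) x *\<^sub>R f x) = f" by (rule ext)
  ultimately show ?thesis unfolding set_integrable_def by metis
qed

definition kernel :: "real \<Rightarrow> 'a::euclidean_space \<Rightarrow> real"
  where "kernel \<delta> x = inverse (LINT y|lborel. bump0 \<delta> (y::'a)) * bump0 \<delta> x"

lemma
  fixes \<delta> :: real
  assumes d: "0 < \<delta>"
  shows C_class_kernel: "C_class k (kernel \<delta> :: 'a::euclidean_space \<Rightarrow> real)"
    and kernel_nonneg: "\<And>x::'a. 0 \<le> kernel \<delta> x"
    and kernel_eq_0: "\<And>x::'a. \<delta> \<le> norm x \<Longrightarrow> kernel \<delta> x = 0"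
    and integrable_kernel: "integrable lborel (kernel \<delta> :: 'a \<Rightarrow> real)"
    and integral_kernel: "(LINT x|lborel. kernel \<delta> (x::'a)) = 1"
proof -
  let ?I = "LINT y|lborel. bump0 \<delta> (y::'a)"
  have int: "integrable lborel (bump0 \<delta> :: 'a \<Rightarrow> real)"
    by (intro integrable_continuous_bounded_support[where R = \<delta>] C_class_continuous[OF C_class_bump0[of 0 \<delta>]])
      (simp add: bump0_eq_0[OF d])
  \<comment> \<open>A vanishing integral would make the open ball of radius \<open>\<delta>\<close>,
    on which the bump is positive, a null set.\<close>
  have "?I \<noteq> 0"
  proof
    assume "?I = 0"
    then have "AE x in lborel. bump0 \<delta> (x::'a) = 0"
      using integral_nonneg_eq_0_iff_AE[OF int] bump0_nonneg by auto
    then have "AE x in lborel. x \<notin> ball (0::'a) \<delta>"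
      by eventually_elim (use bump0_pos[OF d] in \<open>force simp: dist_norm\<close>)
    then have "emeasure lborel (ball (0::'a) \<delta>) = 0"
      by (subst (asm) AE_iff_measurable[of "ball 0 \<delta>"]) auto
    then have "unit_ball_vol (real DIM('a)) * \<delta> ^ DIM('a) \<le> 0"
      using d by (simp add: emeasure_ball ennreal_eq_0_iff)
    moreover have "0 < unit_ball_vol (real DIM('a)) * \<delta> ^ DIM('a)" using d by (simp add: unit_ball_vol_pos)
    ultimately show False by linarith
  qed
  moreover have "0 \<le> ?I" using bump0_nonneg by (intro integral_nonneg_AE) auto
  ultimately have I: "0 < ?I" by simp
  show "C_class k (kernel \<delta> :: 'a \<Rightarrow> real)"
    unfolding kernel_def[abs_def] by (intro C_class_mult C_class_const C_class_bump0)
  show "0 \<le> kernel \<delta> x" for x :: 'a using I by (simp add: kernel_def bump0_nonneg)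
  show "\<delta> \<le> norm x \<Longrightarrow> kernel \<delta> x = 0" for x :: 'a by (simp add: kernel_def bump0_eq_0[OF d])
  show "integrable lborel (kernel \<delta> :: 'a \<Rightarrow> real)" using int by (simp add: kernel_def[abs_def])
  show "(LINT x|lborel. kernel \<delta> (x::'a)) = 1" using I by (simp add: kernel_def)
qed

lemma integral_lborel_reflect:
  fixes f :: "'a::euclidean_space \<Rightarrow> real"
  assumes [measurable]: "f \<in> borel_measurable borel"
  shows "(LINT y|lborel. f y) = (LINT z|lborel. f (x - z))"
proof -
  have "(lborel :: 'a measure) = distr lborel borel (\<lambda>z. x - z)"
    using lborel_affine[of "-1" x] by (simp add: density_1)
  then have "(LINT y|lborel. f y) = (LINT y|distr lborel borel (\<lambda>z. x - z). f y)" by metis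
  then show ?thesis by (simp add: integral_distr)
qed

text \<open>Bridge from the Lebesgue integral over the whole space to the gauge integral over a box,
  the setting of the Leibniz rules applied later.\<close>

lemma integral_lborel_bounded_support:
  fixes f :: "'a::euclidean_space \<Rightarrow> real"
  assumes "continuous_on UNIV f" "\<And>x. R < norm x \<Longrightarrow> f x = 0" "cball 0 R \<subseteq> cbox a b"
  shows "(LINT x|lborel. f x) = integral (cbox a b) f"
proof -
  have h: "(f has_integral (LINT x|lborel. f x)) UNIV"
    by (rule has_integral_integral_lborel[OF integrable_continuous_bounded_support[OF assms(1,2)]])
  have eq: "f = (\<lambda>x. if x \<in> cbox a b then f x else 0)"
  proof
    fix x show "f x = (if x \<in> cbox a b then f x else 0)"
      using assms(2)[of x] assms(3) by (cases "norm x \<le> R") (auto simp: subset_iff)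
  qed
  have "((\<lambda>x. if x \<in> cbox a b then f x else 0) has_integral (LINT x|lborel. f x)) UNIV"
    by (subst eq[symmetric]) (rule h)
  then have "(f has_integral (LINT x|lborel. f x)) (cbox a b)"
    by (simp only: has_integral_restrict_UNIV)
  then show ?thesis by (simp add: integral_unique)
qed

lemma pd_eq_0_outside:
  assumes "\<And>x. R < norm x \<Longrightarrow> f x = 0" "R < norm (x::'a::euclidean_space)"
  shows "pd i f x = 0"
proof -
  have "((\<lambda>x::'a. 0::real) has_derivative (\<lambda>h. 0)) (at x)" by simp
  then have "(f has_derivative (\<lambda>h. 0)) (at x)"
    by (rule has_derivative_transform_within_open[OF _ open_Compl[OF closed_cball[of 0 R]]]) (use assms in auto)
  then show ?thesis by (rule has_derivative_pd)
qed

section \<open>Convolution with a kernel of bounded support\<close>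

definition conv :: "('a::euclidean_space \<Rightarrow> real) \<Rightarrow> ('a \<Rightarrow> real) \<Rightarrow> 'a \<Rightarrow> real"
  where "conv \<phi> \<kappa> x = (LINT y|lborel. \<phi> y * \<kappa> (x - y))"

lemma conv_altdef:
  assumes "continuous_on UNIV \<phi>" "continuous_on UNIV \<kappa>"
  shows "conv \<phi> \<kappa> x = (LINT z|lborel. \<phi> (x - z) * \<kappa> z)"
proof -
  have [measurable]: "\<phi> \<in> borel_measurable borel" "\<kappa> \<in> borel_measurable borel"
    using assms by (auto intro: borel_measurable_continuous_onI)
  show ?thesis unfolding conv_def by (subst integral_lborel_reflect[where x = x]) auto
qed

text \<open>The constant involves the \<open>L\<^sup>1\<close> norm of \<open>\<kappa>\<close>,
  because \<open>\<kappa>\<close> changes sign when it is a derivative of the mollifying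
  kernel.\<close>

lemma conv_lipschitz:
  fixes \<phi> \<kappa> :: "'a::euclidean_space \<Rightarrow> real"
  assumes \<phi>: "C-lipschitz_on UNIV \<phi>" and \<kappa>: "continuous_on UNIV \<kappa>" "\<And>x. S < norm x \<Longrightarrow> \<kappa> x = 0"
  shows "(C * (LINT z|lborel. \<bar>\<kappa> z\<bar>))-lipschitz_on UNIV (conv \<phi> \<kappa>)"
proof (rule lipschitz_onI)
  have c\<phi>: "continuous_on UNIV \<phi>" using \<phi> by (rule lipschitz_on_continuous_on)
  have C: "0 \<le> C" using \<phi> by (rule lipschitz_on_nonneg)
  have i\<kappa>: "integrable lborel \<kappa>" using \<kappa> by (rule integrable_continuous_bounded_support)
  show "0 \<le> C * (LINT z|lborel. \<bar>\<kappa> z\<bar>)" using C by simp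
  have int: "integrable lborel (\<lambda>z. \<phi> (x - z) * \<kappa> z)" for x
    using c\<phi> \<kappa> by (intro integrable_continuous_bounded_support[where R = S] continuous_intros
        continuous_on_compose2[OF c\<phi>]) auto
  fix x y
  have "\<bar>conv \<phi> \<kappa> x - conv \<phi> \<kappa> y\<bar> = \<bar>LINT z|lborel. \<phi> (x - z) * \<kappa> z - \<phi> (y - z) * \<kappa> z\<bar>"
    by (simp add: conv_altdef[OF c\<phi> \<kappa>(1)] int)
  also have "\<dots> \<le> (LINT z|lborel. \<bar>\<phi> (x - z) * \<kappa> z - \<phi> (y - z) * \<kappa> z\<bar>)"
    by (rule integral_abs_bound)
  also have "\<dots> \<le> (LINT z|lborel. (C * dist x y) * \<bar>\<kappa> z\<bar>)"
  proof (rule integral_mono)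
    show "integrable lborel (\<lambda>z. \<bar>\<phi> (x - z) * \<kappa> z - \<phi> (y - z) * \<kappa> z\<bar>)" using int by auto
    show "integrable lborel (\<lambda>z. (C * dist x y) * \<bar>\<kappa> z\<bar>)" using i\<kappa> by simp
    show "\<bar>\<phi> (x - z) * \<kappa> z - \<phi> (y - z) * \<kappa> z\<bar> \<le> (C * dist x y) * \<bar>\<kappa> z\<bar>" for z
      using lipschitz_onD[OF \<phi>, of "x - z" "y - z"]
      by (auto simp: left_diff_distrib[symmetric] abs_mult dist_real_def dist_norm intro: mult_right_mono)
  qed
  also have "\<dots> = C * (LINT z|lborel. \<bar>\<kappa> z\<bar>) * dist x y" by simp
  finally show "dist (conv \<phi> \<kappa> x) (conv \<phi> \<kappa> y) \<le> \<dots>" by (simp add: dist_real_def)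
qed

lemma conv_eq_0_outside:
  assumes "continuous_on UNIV \<phi>" "continuous_on UNIV \<kappa>"
    and "\<And>x. R < norm x \<Longrightarrow> \<phi> x = 0" "\<And>x. S < norm x \<Longrightarrow> \<kappa> x = 0" "R + S < norm x"
  shows "conv \<phi> \<kappa> x = 0"
proof -
  have "\<phi> (x - z) * \<kappa> z = 0" for z
  proof (cases "S < norm z")
    case False
    then have "R < norm (x - z)" using assms(5) norm_triangle_ineq2[of x z] by simp
    then show ?thesis using assms(3) by simp
  qed (use assms(4) in simp)
  then show ?thesis unfolding conv_altdef[OF assms(1,2)] by (simp only:) simp
qed

text \<open>The derivative falls on \<open>\<kappa>\<close>. The bounded support of
  \<open>\<phi>\<close> confines the integral to a fixed box, on which one may differentiate under
  the integral sign.\<close>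

lemma conv_pd:
  fixes \<phi> \<kappa> :: "'a::euclidean_space \<Rightarrow> real"
  assumes \<phi>: "continuous_on UNIV \<phi>" "\<And>x. R < norm x \<Longrightarrow> \<phi> x = 0" and \<kappa>: "C_class (Suc 0) \<kappa>"
  shows "conv \<phi> \<kappa> differentiable (at x)" "i \<in> Basis \<Longrightarrow> pd i (conv \<phi> \<kappa>) x = conv \<phi> (pd i \<kappa>) x"
proof -
  obtain a :: 'a where a: "cball 0 R \<subseteq> cbox (- a) a"
    using bounded_subset_cbox_symmetric[OF bounded_cball] by metis
  have d\<kappa>: "\<kappa> differentiable (at y)" for y using \<kappa> by auto
  have cp: "continuous_on UNIV (pd i \<kappa>)" if "i \<in> Basis" for i
    using \<kappa> that by (simp add: C_class_Suc_pd del: C_class.simps(2))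
  have c\<kappa>: "continuous_on UNIV \<kappa>" using \<kappa> by (rule C_class_continuous)
  have eq: "(LINT y|lborel. \<phi> y * g (x - y)) = integral (cbox (-a) a) (\<lambda>y. \<phi> y * g (x - y))"
    if g: "continuous_on UNIV g" for g and x :: 'a
    using \<phi>(2) by (intro integral_lborel_bounded_support[OF _ _ a] continuous_intros \<phi> continuous_on_compose2[OF g]) auto
  \<comment> \<open>The full derivative in \<open>x\<close> as a bounded linear function, the form
    in which the Leibniz rule takes the integrand.\<close>
  define fx where "fx x y = \<phi> y *\<^sub>R (\<Sum>i\<in>Basis. pd i \<kappa> (x - y) *\<^sub>R blinfun_inner_left i)" for x y :: 'a
  have fx: "blinfun_apply (fx x y) = (\<lambda>h. \<phi> y * (\<Sum>i\<in>Basis. (h \<bullet> i) * pd i \<kappa> (x - y)))" for x y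
    by (rule ext) (simp add: fx_def blinfun.scaleR_left blinfun.sum_left inner_commute mult.commute)
  have cfx: "continuous_on (UNIV \<times> cbox (-a) a) (\<lambda>(x, t). fx x t)"
    unfolding fx_def split_beta
    by (intro continuous_intros continuous_on_compose2[OF \<phi>(1)] continuous_on_compose2[OF cp]) auto
  have D: "(conv \<phi> \<kappa> has_derivative blinfun_apply (integral (cbox (-a) a) (fx x))) (at x)" for x
  proof -
    have "((\<lambda>x. integral (cbox (-a) a) (\<lambda>y. \<phi> y * \<kappa> (x - y))) has_derivative integral (cbox (-a) a) (fx x)) (at x within UNIV)"
    proof (rule leibniz_rule[OF _ _ cfx])
      fix x t :: 'a
      have "((\<lambda>x. x - t) has_derivative (\<lambda>h. h)) (at x)" by (auto intro!: derivative_eq_intros)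
      from has_derivative_mult_right[OF has_derivative_compose[OF this has_derivative_sum_pd[OF d\<kappa>]], of "\<phi> t"]
      show "((\<lambda>x. \<phi> t * \<kappa> (x - t)) has_derivative blinfun_apply (fx x t)) (at x within UNIV)"
        unfolding fx by simp
      show "(\<lambda>y. \<phi> y * \<kappa> (x - y)) integrable_on cbox (-a) a"
        by (intro integrable_continuous continuous_intros continuous_on_compose2[OF \<phi>(1)] continuous_on_compose2[OF c\<kappa>]) auto
    qed auto
    moreover have "(\<lambda>x. integral (cbox (-a) a) (\<lambda>y. \<phi> y * \<kappa> (x - y))) = conv \<phi> \<kappa>"
      using eq[OF c\<kappa>] by (auto simp: conv_def)
    ultimately show ?thesis by simp
  qed
  show "conv \<phi> \<kappa> differentiable (at x)" using D by (rule differentiableI)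
  assume i: "i \<in> Basis"
  have "continuous_on (cbox (-a) a) (fx x)"
    unfolding fx_def[abs_def]
    by (intro continuous_intros continuous_on_compose2[OF \<phi>(1)] continuous_on_compose2[OF cp]) auto
  then have "fx x integrable_on cbox (-a) a" by (rule integrable_continuous)
  then have "pd i (conv \<phi> \<kappa>) x = integral (cbox (-a) a) (\<lambda>y. blinfun_apply (fx x y) i)"
    unfolding has_derivative_pd[OF D] by (rule blinfun_apply_integral)
  also have "\<dots> = conv \<phi> (pd i \<kappa>) x"
    unfolding conv_def eq[OF cp[OF i]] using i
    by (intro Henstock_Kurzweil_Integration.integral_cong) (simp add: fx inner_Basis if_distrib[of "\<lambda>r. r * _"] cong: if_cong)
  finally show "pd i (conv \<phi> \<kappa>) x = conv \<phi> (pd i \<kappa>) x" .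
qed

text \<open>Induction over the kernel: each derivative replaces \<open>\<kappa>\<close> by
  \<open>pd i \<kappa>\<close>, which has one order of smoothness less and the same bounded
  support.\<close>

lemma C_class_conv:
  fixes \<phi> \<kappa> :: "'a::euclidean_space \<Rightarrow> real"
  assumes \<phi>: "C-lipschitz_on UNIV \<phi>" "\<And>x. R < norm x \<Longrightarrow> \<phi> x = 0"
  shows "C_class k \<kappa> \<Longrightarrow> (\<And>x. S < norm x \<Longrightarrow> \<kappa> x = 0) \<Longrightarrow> C_class k (conv \<phi> \<kappa>)"
proof (induction k arbitrary: \<kappa>)
  case 0
  then show ?case using lipschitz_on_continuous_on[OF conv_lipschitz[OF \<phi>(1), of \<kappa> S]] by simp
next
  case (Suc k)
  have c: "continuous_on UNIV \<phi>" using \<phi>(1) by (rule lipschitz_on_continuous_on)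
  have \<kappa>: "C_class (Suc 0) \<kappa>" using Suc.prems(1) by (rule C_class_mono) simp
  have "C_class k (pd i (conv \<phi> \<kappa>))" if "i \<in> Basis" for i
  proof -
    have "pd i (conv \<phi> \<kappa>) = conv \<phi> (pd i \<kappa>)" using conv_pd(2)[OF c \<phi>(2) \<kappa> that] by auto
    then show ?thesis using Suc.IH[of "pd i \<kappa>"] Suc.prems that pd_eq_0_outside[of S \<kappa>]
      by (simp add: C_class_Suc_pd del: C_class.simps)
  qed
  then show ?case using conv_pd(1)[OF c \<phi>(2) \<kappa>] by (simp add: C_class_Suc_pd del: C_class.simps)
qed

section \<open>Mollification of Lipschitz functions at scale \<sigma>\<close>

definition kernel_const :: "'a::euclidean_space itself \<Rightarrow> real"
  where "kernel_const _ = (\<Sum>i\<in>Basis. LINT z|lborel. \<bar>pd i (kernel 1) (z::'a)\<bar>) +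
    (\<Sum>i\<in>Basis. \<Sum>j\<in>Basis. LINT z|lborel. \<bar>pd j (pd i (kernel 1)) (z::'a)\<bar>)"

lemma kernel_const_nonneg: "0 \<le> kernel_const TYPE('a::euclidean_space)"
  unfolding kernel_const_def by (intro add_nonneg_nonneg sum_nonneg) auto

lemma kernel_const_ge:
  fixes i j :: "'a::euclidean_space"
  assumes "i \<in> Basis" "j \<in> Basis"
  shows "(LINT z|lborel. \<bar>pd i (kernel 1) (z::'a)\<bar>) \<le> kernel_const TYPE('a)"
    and "(LINT z|lborel. \<bar>pd j (pd i (kernel 1)) (z::'a)\<bar>) \<le> kernel_const TYPE('a)"
proof -
  let ?a = "\<lambda>i::'a. LINT z|lborel. \<bar>pd i (kernel 1) (z::'a)\<bar>"
  let ?b = "\<lambda>i j::'a. LINT z|lborel. \<bar>pd j (pd i (kernel 1)) (z::'a)\<bar>"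
  have a: "0 \<le> sum ?a Basis" and b: "0 \<le> (\<Sum>i\<in>Basis. sum (?b i) Basis)" by (auto intro!: sum_nonneg)
  have "?a i \<le> sum ?a Basis" using assms(1) by (intro member_le_sum) auto
  then show "?a i \<le> kernel_const TYPE('a)" using b unfolding kernel_const_def by linarith
  have "?b i j \<le> sum (?b i) Basis" using assms(2) by (intro member_le_sum) auto
  also have "\<dots> \<le> (\<Sum>i\<in>Basis. sum (?b i) Basis)"
    by (rule member_le_sum[of i Basis "\<lambda>i. sum (?b i) Basis"]) (auto intro!: sum_nonneg assms)
  finally show "?b i j \<le> kernel_const TYPE('a)" using a unfolding kernel_const_def by linarith
qed

text \<open>The average of \<open>\<phi>(x - \<sigma>z)\<close> over the kernel, written as a rescaled convolution with a fixed
  kernel so that the dependence of all bounds on \<open>\<sigma>\<close> is explicit (see \<open>molli_eq\<close>).\<close>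

definition molli :: "real \<Rightarrow> ('a::euclidean_space \<Rightarrow> real) \<Rightarrow> 'a \<Rightarrow> real"
  where "molli \<sigma> \<phi> x = \<sigma> * conv (\<lambda>y. \<phi> (\<sigma> *\<^sub>R y) / \<sigma>) (kernel 1) (x /\<^sub>R \<sigma>)"

lemma continuous_kernel: "continuous_on UNIV (kernel 1 :: 'a::euclidean_space \<Rightarrow> real)"
  using C_class_kernel[of 1 0] by simp

lemma kernel_1_eq_0: "1 < norm x \<Longrightarrow> kernel 1 x = 0"
  by (rule kernel_eq_0) auto

lemma molli_eq:
  assumes \<sigma>: "0 < \<sigma>" and \<phi>: "continuous_on UNIV \<phi>"
  shows "molli \<sigma> \<phi> x = (LINT z|lborel. \<phi> (x - \<sigma> *\<^sub>R z) * kernel 1 z)"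
proof -
  have c: "continuous_on UNIV (\<lambda>y. \<phi> (\<sigma> *\<^sub>R y) / \<sigma>)"
    using \<sigma> by (intro continuous_intros continuous_on_compose2[OF \<phi>]) auto
  show ?thesis
    unfolding molli_def conv_altdef[OF c continuous_kernel] integral_mult_right_zero[symmetric]
    using \<sigma> by (simp add: scaleR_diff_right)
qed

lemma integrable_molli:
  fixes \<phi> :: "'a::euclidean_space \<Rightarrow> real"
  assumes \<phi>: "continuous_on UNIV \<phi>"
  shows "integrable lborel (\<lambda>z. \<phi> (x - \<sigma> *\<^sub>R z) * kernel 1 z)"
  by (rule integrable_continuous_bounded_support[where R = 1])
    (auto intro!: continuous_intros continuous_on_compose2[OF \<phi>] continuous_kernel simp: kernel_eq_0)

text \<open>An average over the unit ball with weights of total mass 1 inherits any pointwise bound.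
  With \<open>\<psi>\<close> and \<open>y\<close> free it serves for the distance to
  \<open>\<phi>\<close>, for the Lipschitz constant and for the commutator with the drift.\<close>

lemma molli_compare:
  fixes \<phi> \<psi> :: "'a::euclidean_space \<Rightarrow> real"
  assumes \<sigma>: "0 < \<sigma>" and c: "continuous_on UNIV \<phi>" "continuous_on UNIV \<psi>"
    and le: "\<And>z. norm z \<le> 1 \<Longrightarrow> \<bar>\<phi> (x - \<sigma> *\<^sub>R z) - \<psi> (y - \<sigma> *\<^sub>R z)\<bar> \<le> d"
  shows "\<bar>molli \<sigma> \<phi> x - molli \<sigma> \<psi> y\<bar> \<le> d"
proof -
  have "\<bar>molli \<sigma> \<phi> x - molli \<sigma> \<psi> y\<bar>
      = \<bar>LINT z|lborel. \<phi> (x - \<sigma> *\<^sub>R z) * kernel 1 z - \<psi> (y - \<sigma> *\<^sub>R z) * kernel 1 z\<bar>"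
    by (simp add: molli_eq \<sigma> c integrable_molli)
  also have "\<dots> \<le> (LINT z|lborel. \<bar>\<phi> (x - \<sigma> *\<^sub>R z) * kernel 1 z - \<psi> (y - \<sigma> *\<^sub>R z) * kernel 1 z\<bar>)"
    by (rule integral_abs_bound)
  also have "\<dots> \<le> (LINT z|lborel. d * kernel 1 (z::'a))"
  proof (rule integral_mono)
    show "integrable lborel (\<lambda>z. \<bar>\<phi> (x - \<sigma> *\<^sub>R z) * kernel 1 z - \<psi> (y - \<sigma> *\<^sub>R z) * kernel 1 z\<bar>)"
      by (intro Bochner_Integration.integrable_abs Bochner_Integration.integrable_diff integrable_molli c)
    show "integrable lborel (\<lambda>z. d * kernel 1 (z::'a))" by (intro integrable_mult_right integrable_kernel) simp
    show "\<bar>\<phi> (x - \<sigma> *\<^sub>R z) * kernel 1 z - \<psi> (y - \<sigma> *\<^sub>R z) * kernel 1 z\<bar> \<le> d * kernel 1 z" for z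
    proof (cases "norm z \<le> 1")
      case True
      then show ?thesis using le[OF True] kernel_nonneg[of 1 z]
        by (simp add: left_diff_distrib[symmetric] abs_mult mult_right_mono)
    qed (simp add: kernel_eq_0)
  qed
  also have "\<dots> = d" by (simp add: integral_kernel)
  finally show ?thesis .
qed

lemma molli_cmult: "molli \<sigma> (\<lambda>x. c * \<phi> x) x = c * molli \<sigma> \<phi> x"
proof -
  have "conv (\<lambda>y. c * \<phi> (\<sigma> *\<^sub>R y) / \<sigma>) (kernel 1) w = c * conv (\<lambda>y. \<phi> (\<sigma> *\<^sub>R y) / \<sigma>) (kernel 1) w" for w
    unfolding conv_def by (subst integral_mult_right_zero[symmetric]) (simp add: mult.assoc)
  then show ?thesis by (simp add: molli_def)
qed

lemma lipcD:
  assumes "\<phi> \<in> lipc"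
  shows "1-lipschitz_on UNIV \<phi>" "continuous_on UNIV \<phi>" "\<bar>\<phi> x - \<phi> y\<bar> \<le> norm (x - y)"
  using assms lipschitz_onD[of 1 UNIV \<phi> x y]
  by (auto simp: lipc_def dist_real_def dist_norm intro: lipschitz_on_continuous_on)

lemma molli_close:
  assumes "0 < \<sigma>" "\<phi> \<in> lipc"
  shows "\<bar>molli \<sigma> \<phi> x - \<phi> x\<bar> \<le> \<sigma>"
proof -
  have "molli \<sigma> (\<lambda>_. \<phi> x) x = \<phi> x"
    using assms by (subst molli_eq) (auto simp: integral_kernel)
  moreover have "\<bar>molli \<sigma> \<phi> x - molli \<sigma> (\<lambda>_. \<phi> x) x\<bar> \<le> \<sigma>"
  proof (rule molli_compare[OF assms(1) lipcD(2)[OF assms(2)]])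
    fix z :: 'a assume z: "norm z \<le> 1"
    have "\<bar>\<phi> (x - \<sigma> *\<^sub>R z) - \<phi> x\<bar> \<le> norm (x - \<sigma> *\<^sub>R z - x)" by (rule lipcD(3)[OF assms(2)])
    also have "\<dots> = \<sigma> * norm z" using assms(1) by simp
    also have "\<dots> \<le> \<sigma>" using z assms(1) by (intro mult_left_le) auto
    finally show "\<bar>\<phi> (x - \<sigma> *\<^sub>R z) - \<phi> x\<bar> \<le> \<sigma>" .
  qed simp
  ultimately show ?thesis by simp
qed

lemma molli_lipschitz:
  assumes "0 < \<sigma>" "\<phi> \<in> lipc"
  shows "1-lipschitz_on UNIV (molli \<sigma> \<phi>)"
proof (rule lipschitz_onI)
  fix x y
  have "\<bar>molli \<sigma> \<phi> x - molli \<sigma> \<phi> y\<bar> \<le> dist x y"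
    using assms lipcD[OF assms(2)]
    by (intro molli_compare) (auto simp: dist_norm intro: order_trans[OF lipcD(3)[OF assms(2)]])
  then show "dist (molli \<sigma> \<phi> x) (molli \<sigma> \<phi> y) \<le> 1 * dist x y" by (simp add: dist_real_def)
qed simp

lemma scaled_lipc:
  assumes "0 < \<sigma>" "\<phi> \<in> lipc"
  shows "(\<lambda>y. \<phi> (\<sigma> *\<^sub>R y) / \<sigma>) \<in> lipc"
proof -
  have "1-lipschitz_on UNIV (\<lambda>y. \<phi> (\<sigma> *\<^sub>R y) / \<sigma>)"
  proof (rule lipschitz_onI)
    fix x y
    have "\<bar>\<phi> (\<sigma> *\<^sub>R x) - \<phi> (\<sigma> *\<^sub>R y)\<bar> \<le> \<sigma> * dist x y"
      using lipcD(3)[OF assms(2), of "\<sigma> *\<^sub>R x" "\<sigma> *\<^sub>R y"] assms(1)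
      by (simp add: dist_norm scaleR_diff_right[symmetric])
    then show "dist (\<phi> (\<sigma> *\<^sub>R x) / \<sigma>) (\<phi> (\<sigma> *\<^sub>R y) / \<sigma>) \<le> 1 * dist x y"
      using assms(1) by (simp add: dist_real_def diff_divide_distrib[symmetric] field_simps)
  qed simp
  moreover obtain R where "\<And>x. R < norm x \<Longrightarrow> \<phi> x = 0" using assms(2) by (auto simp: lipc_def)
  then have "\<phi> (\<sigma> *\<^sub>R y) / \<sigma> = 0" if "R / \<sigma> < norm y" for y
    using that assms(1) by (simp add: field_simps)
  ultimately show ?thesis by (auto simp: lipc_def)
qed

lemma molli_C_class:
  assumes "0 < \<sigma>" "\<phi> \<in> lipc"
  shows "C_class k (molli \<sigma> \<phi>)"
proof -
  define \<phi>' where "\<phi>' = (\<lambda>y. \<phi> (\<sigma> *\<^sub>R y) / \<sigma>)"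
  have "\<phi>' \<in> lipc" unfolding \<phi>'_def using assms by (rule scaled_lipc)
  then obtain R where "1-lipschitz_on UNIV \<phi>'" "\<And>x. R < norm x \<Longrightarrow> \<phi>' x = 0" by (auto simp: lipc_def)
  then have "C_class k (conv \<phi>' (kernel 1))"
    by (rule C_class_conv[OF _ _ C_class_kernel kernel_1_eq_0]) simp_all
  from C_class_mult[OF C_class_const[of k \<sigma>] C_class_linear_compose[OF bounded_linear_scaleR_right[of "inverse \<sigma>"] this, of 0]]
  show ?thesis by (simp add: molli_def[abs_def] \<phi>'_def del: C_class.simps)
qed

lemma molli_bounded_support:
  assumes "0 < \<sigma>" "\<phi> \<in> lipc"
  obtains R where "\<And>x. R < norm x \<Longrightarrow> molli \<sigma> \<phi> x = 0"
proof -
  define \<phi>' where "\<phi>' = (\<lambda>y. \<phi> (\<sigma> *\<^sub>R y) / \<sigma>)"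
  have "\<phi>' \<in> lipc" unfolding \<phi>'_def using assms by (rule scaled_lipc)
  then obtain R where R: "1-lipschitz_on UNIV \<phi>'" "\<And>x. R < norm x \<Longrightarrow> \<phi>' x = 0" by (auto simp: lipc_def)
  have "conv \<phi>' (kernel 1) x = 0" if "R + 1 < norm x" for x
    by (rule conv_eq_0_outside[OF lipschitz_on_continuous_on[OF R(1)] continuous_kernel R(2) kernel_1_eq_0 that])
  moreover have "R + 1 < norm (x /\<^sub>R \<sigma>)" if "\<sigma> * (R + 1) < norm x" for x :: 'a
    using that assms(1) by (simp add: field_simps)
  ultimately show ?thesis by (intro that[of "\<sigma> * (R + 1)"]) (simp add: molli_def \<phi>'_def)
qed

lemma pd_scale:
  fixes g :: "'a::euclidean_space \<Rightarrow> real"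
  assumes g: "\<And>y. g differentiable (at y)" and i: "i \<in> Basis"
  shows "pd i (\<lambda>x. g (x /\<^sub>R \<sigma>)) = (\<lambda>x. inverse \<sigma> * pd i g (x /\<^sub>R \<sigma>))"
proof
  fix x
  have D: "((\<lambda>x. (x /\<^sub>R \<sigma>) \<bullet> j) has_derivative (\<lambda>h. (h /\<^sub>R \<sigma>) \<bullet> j)) (at y)" for y j :: 'a
    by (auto intro!: derivative_eq_intros)
  have "pd i (\<lambda>x. g (x /\<^sub>R \<sigma>)) x = (\<Sum>j\<in>Basis. pd i (\<lambda>x. (x /\<^sub>R \<sigma>) \<bullet> j) x * pd j g (x /\<^sub>R \<sigma>))"
    by (rule pd_compose(2)[OF g differentiableI[OF D]])
  also have "\<dots> = (\<Sum>j\<in>Basis. if j = i then inverse \<sigma> * pd i g (x /\<^sub>R \<sigma>) else 0)"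
    unfolding has_derivative_pd[OF D] using i by (intro sum.cong) (auto simp: inner_Basis)
  also have "\<dots> = inverse \<sigma> * pd i g (x /\<^sub>R \<sigma>)" using i by simp
  finally show "pd i (\<lambda>x. g (x /\<^sub>R \<sigma>)) x = inverse \<sigma> * pd i g (x /\<^sub>R \<sigma>)" .
qed

lemma pd_cmult:
  assumes "\<And>x. f differentiable (at x)"
  shows "pd i (\<lambda>x. c * f x) = (\<lambda>x. c * pd i f x)"
  using pd_mult[of "\<lambda>_. c" f i] assms has_derivative_pd[OF has_derivative_const[of c], of i] by simp

text \<open>Rescaling sends \<open>\<phi>\<close> to the 1-Lipschitz function
  \<open>\<phi>'\<close>, and each derivative of the mollified function costs one factor
  \<open>1 / \<sigma>\<close> in the Lipschitz constant. The other factor is the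
  \<open>L\<^sup>1\<close> norm of a derivative of the unit kernel, so it depends on the dimension
  alone.\<close>

lemma
  fixes \<phi> :: "'a::euclidean_space \<Rightarrow> real"
  assumes \<sigma>: "0 < \<sigma>" and \<phi>: "\<phi> \<in> lipc" and i: "i \<in> Basis" and j: "j \<in> Basis"
  shows molli_pd_lipschitz: "(kernel_const TYPE('a) / \<sigma>)-lipschitz_on UNIV (pd i (molli \<sigma> \<phi>))"
    and molli_pd_pd_lipschitz: "(kernel_const TYPE('a) / \<sigma>\<^sup>2)-lipschitz_on UNIV (pd j (pd i (molli \<sigma> \<phi>)))"
proof -
  define \<phi>' where "\<phi>' = (\<lambda>y. \<phi> (\<sigma> *\<^sub>R y) / \<sigma>)"
  have l: "\<phi>' \<in> lipc" unfolding \<phi>'_def using \<sigma> \<phi> by (rule scaled_lipc)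
  then obtain R where R: "1-lipschitz_on UNIV \<phi>'" "\<And>x. R < norm x \<Longrightarrow> \<phi>' x = 0" by (auto simp: lipc_def)
  define k1 where "k1 = pd i (kernel 1 :: 'a \<Rightarrow> real)"
  define k2 where "k2 = pd j k1"
  have K: "C_class (Suc (Suc 0)) (kernel 1 :: 'a \<Rightarrow> real)" by (rule C_class_kernel) simp
  then have C1: "C_class (Suc 0) k1" unfolding k1_def using i by (subst (asm) C_class_Suc_pd) simp
  then have C2: "C_class 0 k2" unfolding k2_def using j by (subst (asm) C_class_Suc_pd) simp
  have K1: "C_class (Suc 0) (kernel 1 :: 'a \<Rightarrow> real)" by (rule C_class_kernel) simp
  have z1: "k1 x = 0" if "1 < norm x" for x unfolding k1_def
    using pd_eq_0_outside[of 1 "kernel 1" x] that by (simp add: kernel_1_eq_0)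
  have z2: "k2 x = 0" if "1 < norm x" for x unfolding k2_def
    using pd_eq_0_outside[of 1 k1 x] that z1 by simp
  have c\<phi>: "continuous_on UNIV \<phi>'" using lipcD(2)[OF l] .
  let ?g = "conv \<phi>' (kernel 1)"
  have d: "?g differentiable (at y)" for y using conv_pd(1)[OF c\<phi> R(2) K1] .
  have d': "(\<lambda>x. ?g (x /\<^sub>R \<sigma>)) differentiable (at y)" for y
  proof -
    have "C_class (Suc 0) ?g" by (rule C_class_conv[OF R K1 kernel_1_eq_0])
    from C_class_linear_compose[OF bounded_linear_scaleR_right[of "inverse \<sigma>"] this, of 0]
    show ?thesis by simp
  qed
  have m: "molli \<sigma> \<phi> = (\<lambda>x. \<sigma> * ?g (x /\<^sub>R \<sigma>))" by (auto simp: molli_def \<phi>'_def)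
  have p1: "pd i (molli \<sigma> \<phi>) = (\<lambda>x. conv \<phi>' k1 (x /\<^sub>R \<sigma>))"
    unfolding m pd_cmult[OF d'] pd_scale[OF d i] k1_def using \<sigma> conv_pd(2)[OF c\<phi> R(2) K1 i] by auto
  have d1: "conv \<phi>' k1 differentiable (at y)" for y using conv_pd(1)[OF c\<phi> R(2) C1] .
  have p2: "pd j (pd i (molli \<sigma> \<phi>)) = (\<lambda>x. inverse \<sigma> * conv \<phi>' k2 (x /\<^sub>R \<sigma>))"
    unfolding p1 pd_scale[OF d1 j] k2_def using conv_pd(2)[OF c\<phi> R(2) C1 j] by auto
  have l1: "(1 * (LINT z|lborel. \<bar>k1 z\<bar>))-lipschitz_on UNIV (conv \<phi>' k1)"
    using conv_lipschitz[OF R(1) C_class_continuous[OF C1] z1] .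
  have l2: "(1 * (LINT z|lborel. \<bar>k2 z\<bar>))-lipschitz_on UNIV (conv \<phi>' k2)"
    using conv_lipschitz[OF R(1) C_class_continuous[OF C2] z2] .
  have b1: "(LINT z|lborel. \<bar>k1 z\<bar>) \<le> kernel_const TYPE('a)"
    and b2: "(LINT z|lborel. \<bar>k2 z\<bar>) \<le> kernel_const TYPE('a)"
    using kernel_const_ge[OF i j] by (auto simp: k1_def k2_def)
  have dd: "dist (x /\<^sub>R \<sigma>) (y /\<^sub>R \<sigma>) = dist x y / \<sigma>" for x y :: 'a
    using \<sigma> by (simp add: dist_norm scaleR_diff_right[symmetric] divide_inverse mult.commute)
  show "(kernel_const TYPE('a) / \<sigma>)-lipschitz_on UNIV (pd i (molli \<sigma> \<phi>))"
  proof (rule lipschitz_onI)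
    fix x y
    have "dist (conv \<phi>' k1 (x /\<^sub>R \<sigma>)) (conv \<phi>' k1 (y /\<^sub>R \<sigma>)) \<le> (LINT z|lborel. \<bar>k1 z\<bar>) * (dist x y / \<sigma>)"
      using lipschitz_onD[OF l1, of "x /\<^sub>R \<sigma>" "y /\<^sub>R \<sigma>"] by (simp add: dd)
    also have "\<dots> \<le> kernel_const TYPE('a) * (dist x y / \<sigma>)" using b1 \<sigma> by (intro mult_right_mono) auto
    finally show "dist (pd i (molli \<sigma> \<phi>) x) (pd i (molli \<sigma> \<phi>) y) \<le> kernel_const TYPE('a) / \<sigma> * dist x y"
      by (simp add: p1)
  qed (use \<sigma> kernel_const_nonneg in \<open>simp add: kernel_const_nonneg\<close>)
  show "(kernel_const TYPE('a) / \<sigma>\<^sup>2)-lipschitz_on UNIV (pd j (pd i (molli \<sigma> \<phi>)))"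
  proof (rule lipschitz_onI)
    fix x y
    have "dist (conv \<phi>' k2 (x /\<^sub>R \<sigma>)) (conv \<phi>' k2 (y /\<^sub>R \<sigma>)) \<le> (LINT z|lborel. \<bar>k2 z\<bar>) * (dist x y / \<sigma>)"
      using lipschitz_onD[OF l2, of "x /\<^sub>R \<sigma>" "y /\<^sub>R \<sigma>"] by (simp add: dd)
    also have "\<dots> \<le> kernel_const TYPE('a) * (dist x y / \<sigma>)" using b2 \<sigma> by (intro mult_right_mono) auto
    finally have "inverse \<sigma> * dist (conv \<phi>' k2 (x /\<^sub>R \<sigma>)) (conv \<phi>' k2 (y /\<^sub>R \<sigma>)) \<le> inverse \<sigma> * (kernel_const TYPE('a) * (dist x y / \<sigma>))"
      using \<sigma> by (intro mult_left_mono) auto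
    moreover have "dist (inverse \<sigma> * a) (inverse \<sigma> * b) = inverse \<sigma> * dist a b" for a b :: real
      using \<sigma> by (simp add: dist_real_def right_diff_distrib[symmetric] abs_mult)
    ultimately show "dist (pd j (pd i (molli \<sigma> \<phi>)) x) (pd j (pd i (molli \<sigma> \<phi>)) y) \<le> kernel_const TYPE('a) / \<sigma>\<^sup>2 * dist x y"
      using \<sigma> by (simp add: p2 field_simps power2_eq_square)
  qed (use \<sigma> in \<open>simp add: kernel_const_nonneg\<close>)
qed

section \<open>Calculus in several variables\<close>

lemma grad_inner:
  assumes "f differentiable (at x)"
  shows "grad f x \<bullet> v = pd v f x"
proof -
  have "(f has_derivative (\<lambda>h. h \<bullet> grad f x)) (at x)"
    using gderiv_grad[OF assms] by (simp add: gderiv_def)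
  from has_derivative_pd[OF this] show ?thesis by (simp add: inner_commute)
qed

lemma grad_eqI:
  assumes "GDERIV f x :> D"
  shows "grad f x = D"
proof -
  have f: "(f has_derivative (\<lambda>h. h \<bullet> D)) (at x)" using assms by (simp add: gderiv_def)
  have "grad f x \<bullet> v = D \<bullet> v" for v
    unfolding grad_inner[OF differentiableI[OF f]] has_derivative_pd[OF f] by (rule inner_commute)
  then show ?thesis using vector_eq_rdot by blast
qed

lemma sum_Basis_vec: "(\<Sum>b\<in>(Basis :: (real^'n) set). f b) = (\<Sum>i\<in>UNIV. f (axis i 1))"
proof -
  have "bij_betw (\<lambda>i. axis i 1) UNIV (Basis :: (real^'n) set)"
    by (auto simp: bij_betw_def inj_on_def axis_eq_axis Basis_vec_def)
  then show ?thesis by (rule sum.reindex_bij_betw[symmetric])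
qed

lemma divergence_eq:
  assumes "V differentiable (at x)"
  shows "divergence V x = (\<Sum>i\<in>Basis. pd i (\<lambda>y. V y \<bullet> i) x)"
proof -
  have D: "(V has_derivative frechet_derivative V (at x)) (at x)"
    using assms by (simp add: frechet_derivative_works)
  have "pd v (\<lambda>y. V y \<bullet> w) x = frechet_derivative V (at x) v \<bullet> w" for v w
    using has_derivative_inner_left[OF D] by (rule has_derivative_pd)
  then show ?thesis
    by (simp add: divergence_def trace_def jacobian_def matrix_def sum_Basis_vec inner_axis)
qed

lemma laplacian_eq_divergence: "laplacian f x = divergence (grad f) x"
  by (simp add: laplacian_def divergence_def hessian_def)

lemma hessian_inner:
  assumes "grad f differentiable (at x)"
  shows "(hessian f x *v v) \<bullet> w = pd v (\<lambda>y. grad f y \<bullet> w) x"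
proof -
  have D: "(grad f has_derivative (\<lambda>h. hessian f x *v h)) (at x)"
    using assms by (simp add: hessian_def jacobian_works)
  show ?thesis using has_derivative_pd[OF has_derivative_inner_left[OF D]] by simp
qed

lemma pd_grad_inner:
  assumes "\<And>y. f differentiable (at y)"
  shows "(\<lambda>y. grad f y \<bullet> w) = pd w f"
  using grad_inner[OF assms] by auto

lemma laplacian_eq:
  fixes f :: "real^'n \<Rightarrow> real"
  assumes "\<And>y. f differentiable (at y)" "grad f differentiable (at x)"
  shows "laplacian f x = (\<Sum>i\<in>Basis. pd i (pd i f) x)"
  unfolding laplacian_eq_divergence divergence_eq[OF assms(2)] using pd_grad_inner[OF assms(1)] by simp

lemma C_class_2_grad:
  fixes f :: "real^'n \<Rightarrow> real"
  assumes "C_class (Suc (Suc 0)) f"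
  shows "f differentiable (at x)" "grad f differentiable (at x)"
    "C_class (Suc 0) (\<lambda>y. grad f y \<bullet> w)"
proof -
  show f: "f differentiable (at x)" for x using assms by simp
  have c: "C_class (Suc 0) (pd i f)" if "i \<in> Basis" for i
    using assms that unfolding C_class_Suc_pd[of "Suc 0"] by blast
  show "grad f differentiable (at x)"
  proof (rule differentiable_componentwise)
    fix j :: "real^'n" assume "j \<in> Basis"
    then show "(\<lambda>y. grad f y \<bullet> j) differentiable (at x)"
      unfolding pd_grad_inner[OF f] using c unfolding C_class_Suc_pd by blast
  qed
  have "(\<lambda>y. grad f y \<bullet> w) = (\<lambda>y. \<Sum>i\<in>Basis. (w \<bullet> i) * pd i f y)"
    unfolding grad_inner[OF f, symmetric]
    by (rule ext, subst euclidean_inner) (simp add: mult.commute)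
  then show "C_class (Suc 0) (\<lambda>y. grad f y \<bullet> w)"
    using c by (simp only:) (intro C_class_sum C_class_mult C_class_const)
qed

text \<open>Bridge from the gradient and Hessian in \<open>C21_on\<close> to the smoothness classes:
  \<open>pd j (pd i f)\<close> is an inner product with the Hessian.\<close>

lemma C_class_2I:
  fixes f :: "real^'n \<Rightarrow> real"
  assumes "\<And>x. f differentiable (at x)" "\<And>x. grad f differentiable (at x)" "continuous_on UNIV (hessian f)"
  shows "C_class (Suc (Suc 0)) f"
proof -
  have "C_class (Suc 0) (pd i f)" for i
    unfolding C_class_Suc_pd
  proof (intro conjI allI ballI)
    show "pd i f differentiable (at x)" for x
      unfolding pd_grad_inner[OF assms(1), symmetric] using assms(2)
      by (intro differentiable_inner) auto
    have "pd j (pd i f) = (\<lambda>x. (hessian f x *v j) \<bullet> i)" for j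
      unfolding hessian_inner[OF assms(2)] pd_grad_inner[OF assms(1)] ..
    then show "C_class 0 (pd j (pd i f))" for j
      using assms(3) by (auto simp: inner_vec_def matrix_vector_mult_def intro!: continuous_intros)
  qed
  then show ?thesis using assms(1) unfolding C_class_Suc_pd[of "Suc 0"] by blast
qed

lemma has_real_derivative_along_line:
  fixes f :: "'a::euclidean_space \<Rightarrow> real"
  assumes "f differentiable (at (x + s *\<^sub>R v))"
  shows "((\<lambda>s. f (x + s *\<^sub>R v)) has_real_derivative pd v f (x + s *\<^sub>R v)) (at s)"
proof -
  have d: "(f has_derivative frechet_derivative f (at (x + s *\<^sub>R v))) (at (x + s *\<^sub>R v))"
    using assms by (simp add: frechet_derivative_works)
  then interpret bounded_linear "frechet_derivative f (at (x + s *\<^sub>R v))" by (rule has_derivative_bounded_linear)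
  have "((\<lambda>s. x + s *\<^sub>R v) has_derivative (\<lambda>s. s *\<^sub>R v)) (at s)" by (auto intro!: derivative_eq_intros)
  from has_derivative_compose[OF this d] show ?thesis
    by (simp add: has_field_derivative_def scaleR pd_def mult_commute_abs mult.commute)
qed

lemma abs_pd_le_lipschitz:
  fixes f :: "'a::euclidean_space \<Rightarrow> real"
  assumes f: "C-lipschitz_on UNIV f" "f differentiable (at x)"
  shows "\<bar>pd v f x\<bar> \<le> C * norm v"
proof -
  have "((\<lambda>s. f (x + s *\<^sub>R v)) has_real_derivative pd v f x) (at 0)"
    using has_real_derivative_along_line[of f x 0 v] f(2) by simp
  then have "((\<lambda>h. (f (x + h *\<^sub>R v) - f x) / h) \<longlongrightarrow> pd v f x) (at 0)" by (simp add: DERIV_def)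
  then have "((\<lambda>h. \<bar>(f (x + h *\<^sub>R v) - f x) / h\<bar>) \<longlongrightarrow> \<bar>pd v f x\<bar>) (at 0)" by (rule tendsto_rabs)
  moreover have "\<bar>(f (x + h *\<^sub>R v) - f x) / h\<bar> \<le> C * norm v" if "h \<noteq> 0" for h
    using lipschitz_onD[OF f(1), of "x + h *\<^sub>R v" x] that
    by (simp add: dist_real_def dist_norm field_simps)
  ultimately show ?thesis
    by (intro tendsto_upperbound[of "\<lambda>h. \<bar>(f (x + h *\<^sub>R v) - f x) / h\<bar>" _ "at 0"]) (auto simp: eventually_at_filter)
qed

lemma norm_grad_le_lipschitz:
  fixes f :: "'a::euclidean_space \<Rightarrow> real"
  assumes f: "C-lipschitz_on UNIV f" "f differentiable (at x)"
  shows "norm (grad f x) \<le> C"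
proof (cases "grad f x = 0")
  case False
  have "norm (grad f x) * norm (grad f x) = grad f x \<bullet> grad f x" by (simp add: power2_norm_eq_inner[symmetric] power2_eq_square)
  also have "\<dots> \<le> C * norm (grad f x)"
    using abs_pd_le_lipschitz[OF f, of "grad f x"] unfolding grad_inner[OF f(2)] by simp
  finally show ?thesis using False by simp
qed (use lipschitz_on_nonneg[OF f(1)] in simp)

section \<open>Integration by parts\<close>

lemma integral_pd_eq_0:
  fixes g :: "'a::euclidean_space \<Rightarrow> real"
  assumes g: "C_class (Suc 0) g" "\<And>x. R < norm x \<Longrightarrow> g x = 0" and i: "i \<in> Basis"
  shows "integrable lborel (pd i g)" "(LINT x|lborel. pd i g x) = 0"
proof -
  have d: "g differentiable (at x)" for x using g(1) by simp
  have c: "continuous_on UNIV (pd i g)" using g(1) i by (simp add: C_class_Suc_pd del: C_class.simps(2))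
  have cg: "continuous_on UNIV g" using g(1) by (rule C_class_continuous)
  have p0: "pd i g x = 0" if "R < norm x" for x using pd_eq_0_outside[of R g, OF g(2) that] .
  show "integrable lborel (pd i g)" using c p0 by (rule integrable_continuous_bounded_support)
  have "compact (pd i g ` cball 0 R)" using c by (intro compact_continuous_image) (auto intro: continuous_on_subset)
  then obtain B where "\<And>y. y \<in> pd i g ` cball 0 R \<Longrightarrow> norm y \<le> B"
    using compact_imp_bounded bounded_iff by metis
  then have B: "\<bar>pd i g x\<bar> \<le> \<bar>B\<bar>" for x using p0[of x] by (cases "norm x \<le> R") force+
  \<comment> \<open>These difference quotients have integral 0 by translation invariance. They
    converge to \<open>pd i g\<close> and are dominated by a constant on a ball enlarged by 1, the
    step being at most 1.\<close>
  define s where "s n x = (g (x + inverse (real (Suc n)) *\<^sub>R i) - g x) / inverse (real (Suc n))" for n x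
  have [measurable]: "g \<in> borel_measurable borel" "pd i g \<in> borel_measurable borel"
    using c cg by (auto intro: borel_measurable_continuous_onI)
  have ig: "integrable lborel (\<lambda>x. g (x + v))" for v
  proof (rule integrable_continuous_bounded_support[where R = "R + norm v"])
    show "continuous_on UNIV (\<lambda>x. g (x + v))"
      by (rule continuous_on_compose2[OF cg]) (auto intro: continuous_intros)
    show "g (x + v) = 0" if "R + norm v < norm x" for x
      using that norm_diff_ineq[of x v] by (intro g(2)) linarith
  qed
  have tr: "(LINT x|lborel. g (x + v)) = (LINT x|lborel. g x)" for v
  proof -
    have "(LINT x|lborel. g x) = (LINT x|distr lborel borel ((+) v). g x)" by (simp add: lborel_distr_plus)
    then show ?thesis by (simp add: integral_distr add.commute)
  qed
  have s0: "(LINT x|lborel. s n x) = 0" for n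
    unfolding s_def using tr[of "inverse (real (Suc n)) *\<^sub>R i"] ig[of 0] ig[of "inverse (real (Suc n)) *\<^sub>R i"] by simp
  have "(\<lambda>n. LINT x|lborel. s n x) \<longlonglongrightarrow> (LINT x|lborel. pd i g x)"
  proof (rule integral_dominated_convergence[where w = "\<lambda>x. \<bar>B\<bar> * indicator (cball 0 (R + 1)) x"])
    show "integrable lborel (\<lambda>x::'a. \<bar>B\<bar> * indicator (cball 0 (R + 1)) x :: real)"
      using emeasure_lborel_cball_finite[of "0::'a" "R + 1"] by (intro integrable_mult_right integrable_real_indicator) auto
    show "s n \<in> borel_measurable lborel" for n unfolding s_def by measurable
    show "AE x in lborel. (\<lambda>n. s n x) \<longlonglongrightarrow> pd i g x"
    proof (rule AE_I2)
      fix x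
      have "((\<lambda>h. (g (x + h *\<^sub>R i) - g x) / h) \<longlongrightarrow> pd i g x) (at 0)"
        using has_real_derivative_along_line[of g x 0 i] d by (simp add: DERIV_def)
      moreover have "filterlim (\<lambda>n. inverse (real (Suc n))) (at 0) sequentially"
        using LIMSEQ_inverse_real_of_nat by (auto simp: filterlim_at)
      ultimately show "(\<lambda>n. s n x) \<longlonglongrightarrow> pd i g x" unfolding s_def by (rule filterlim_compose)
    qed
    show "AE x in lborel. norm (s n x) \<le> \<bar>B\<bar> * indicator (cball 0 (R + 1)) x" for n
    proof (rule AE_I2)
      fix x
      let ?h = "inverse (real (Suc n))"
      have h: "0 < ?h" "?h \<le> 1" by (auto simp: field_simps)
      obtain z where z: "g (x + ?h *\<^sub>R i) - g (x + 0 *\<^sub>R i) = (?h - 0) * pd i g (x + z *\<^sub>R i)"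
        using MVT2[OF h(1), of "\<lambda>s. g (x + s *\<^sub>R i)" "\<lambda>s. pd i g (x + s *\<^sub>R i)"]
          has_real_derivative_along_line d by blast
      have "\<bar>s n x\<bar> \<le> \<bar>B\<bar>" using z h B[of "x + z *\<^sub>R i"] by (simp add: s_def)
      moreover have "s n x = 0" if "R + 1 < norm x"
      proof -
        have "norm (?h *\<^sub>R i) \<le> 1" using h i by simp
        then have "R < norm (x + ?h *\<^sub>R i)" using that norm_triangle_ineq2[of x "- (?h *\<^sub>R i)"] by simp
        then show ?thesis using that by (simp add: s_def g(2))
      qed
      ultimately show "norm (s n x) \<le> \<bar>B\<bar> * indicator (cball 0 (R + 1)) x"
        by (auto simp: indicator_def not_le)
    qed
  qed auto
  then show "(LINT x|lborel. pd i g x) = 0" by (simp add: s0 LIMSEQ_const_iff)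
qed

text \<open>The integrand is the divergence of \<open>f W\<close>. Bounded support is asked of
  either factor, because the test function appears once as \<open>f\<close> and once, through its
  gradient, as \<open>W\<close>.\<close>

lemma integral_divergence_by_parts:
  fixes f :: "real^'n \<Rightarrow> real" and W :: "real^'n \<Rightarrow> real^'n"
  assumes f: "C_class (Suc 0) f" and W: "\<And>i. i \<in> Basis \<Longrightarrow> C_class (Suc 0) (\<lambda>x. W x \<bullet> i)"
    and R: "\<And>x. R < norm x \<Longrightarrow> f x = 0 \<or> W x = 0"
  shows "integrable lborel (\<lambda>x. f x * divergence W x + W x \<bullet> grad f x)"
    "(LINT x|lborel. f x * divergence W x + W x \<bullet> grad f x) = 0"
proof -
  have df: "f differentiable (at x)" for x using f by simp
  have dW: "(\<lambda>x. W x \<bullet> i) differentiable (at x)" if "i \<in> Basis" for x i using W[OF that] by simp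
  have eq: "f x * divergence W x + W x \<bullet> grad f x = (\<Sum>i\<in>Basis. pd i (\<lambda>x. f x * (W x \<bullet> i)) x)" for x
  proof -
    have "W differentiable (at x)" using dW by (rule differentiable_componentwise)
    then have "f x * divergence W x + W x \<bullet> grad f x = (\<Sum>i\<in>Basis. f x * pd i (\<lambda>y. W y \<bullet> i) x + (W x \<bullet> i) * (grad f x \<bullet> i))"
      by (simp only: divergence_eq sum_distrib_left sum.distrib euclidean_inner[of "W x" "grad f x"])
    also have "\<dots> = (\<Sum>i\<in>Basis. pd i (\<lambda>x. f x * (W x \<bullet> i)) x)"
      using df dW by (intro sum.cong) (auto simp: pd_mult grad_inner mult.commute)
    finally show ?thesis .
  qed
  have c: "C_class (Suc 0) (\<lambda>x. f x * (W x \<bullet> i))" if "i \<in> Basis" for i using f W[OF that] by (rule C_class_mult)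
  have z: "f x * (W x \<bullet> i) = 0" if "R < norm x" for x i using R[OF that] by auto
  note I = integral_pd_eq_0[OF c z]
  show "integrable lborel (\<lambda>x. f x * divergence W x + W x \<bullet> grad f x)"
    unfolding eq using I(1) by (intro Bochner_Integration.integrable_sum) auto
  show "(LINT x|lborel. f x * divergence W x + W x \<bullet> grad f x) = 0"
    unfolding eq using I by (subst Bochner_Integration.integral_sum) auto
qed

section \<open>Stability of weak solutions of Fokker--Planck equations\<close>

lemma abs_integral_diff_le:
  fixes f g :: "real^'n \<Rightarrow> real"
  assumes \<mu>: "\<mu> \<in> P1" and i: "integrable \<mu> f" "integrable \<mu> g" and le: "\<And>x. \<bar>f x - g x\<bar> \<le> d"
  shows "\<bar>(LINT x|\<mu>. f x) - (LINT x|\<mu>. g x)\<bar> \<le> d"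
proof -
  interpret prob_space \<mu> by (rule P1_D(1)) fact
  have "\<bar>(LINT x|\<mu>. f x) - (LINT x|\<mu>. g x)\<bar> = \<bar>LINT x|\<mu>. f x - g x\<bar>" using i by simp
  also have "\<dots> \<le> (LINT x|\<mu>. \<bar>f x - g x\<bar>)" by (rule integral_abs_bound)
  also have "\<dots> \<le> (LINT x|\<mu>. d)" using i le by (intro integral_mono) auto
  finally show ?thesis by (simp add: prob_space)
qed

lemma abs_integral_le:
  fixes f :: "real^'n \<Rightarrow> real"
  assumes \<mu>: "\<mu> \<in> P1" and i: "integrable \<mu> f" and le: "\<And>x. \<bar>f x\<bar> \<le> d"
  shows "\<bar>LINT x|\<mu>. f x\<bar> \<le> d"
  using abs_integral_diff_le[OF \<mu> i, of "\<lambda>_. 0" d] le by simp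

lemma P1_curve_integral_continuous:
  fixes \<phi> :: "real^'n \<Rightarrow> real"
  assumes m: "P1_curve \<mu>" and \<phi>: "C-lipschitz_on UNIV \<phi>"
  shows "continuous_on {0..} (\<lambda>t. LINT x|\<mu> t. \<phi> x)"
  unfolding continuous_on_def
proof
  fix t :: real assume "t \<in> {0..}"
  then have t: "0 \<le> t" by simp
  have P: "\<mu> s \<in> P1" if "0 \<le> s" for s using m that by (auto simp: P1_curve_def)
  have lim: "((\<lambda>s. d1 (\<mu> s) (\<mu> t)) \<longlongrightarrow> 0) (at t within {0..})" using m t by (auto simp: P1_curve_def)
  have "((\<lambda>s. (LINT x|\<mu> s. \<phi> x) - (LINT x|\<mu> t. \<phi> x)) \<longlongrightarrow> 0) (at t within {0..})"
  proof (rule Lim_null_comparison)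
    show "\<forall>\<^sub>F s in at t within {0..}. norm ((LINT x|\<mu> s. \<phi> x) - (LINT x|\<mu> t. \<phi> x)) \<le> C * d1 (\<mu> s) (\<mu> t)"
      using abs_integral_diff_le_d1[OF P P[OF t] \<phi>] by (auto simp: eventually_at_filter)
    show "((\<lambda>s. C * d1 (\<mu> s) (\<mu> t)) \<longlongrightarrow> 0) (at t within {0..})" using tendsto_mult_left[OF lim, of C] by simp
  qed
  then show "((\<lambda>s. LINT x|\<mu> s. \<phi> x) \<longlongrightarrow> (LINT x|\<mu> t. \<phi> x)) (at t within {0..})" by (rule LIM_zero_cancel)
qed

section \<open>The generator applied to mollified test functions\<close>

abbreviation molli_const :: "'n::finite itself \<Rightarrow> real"
  where "molli_const _ \<equiv> real CARD('n) * kernel_const TYPE(real^'n)"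

text \<open>The adjoint of the Fokker--Planck operator, applied to the mollified
  \<open>\<phi>\<close>. The drift carries a minus sign because the equation reads
  \<open>\<partial>\<^sub>t m = \<Delta> m + div (m b)\<close>.\<close>

definition generator :: "real \<Rightarrow> (real^'n \<Rightarrow> real) \<Rightarrow> (real^'n \<Rightarrow> real^'n) \<Rightarrow> real^'n \<Rightarrow> real"
  where "generator \<sigma> \<phi> b x = laplacian (molli \<sigma> \<phi>) x - b x \<bullet> grad (molli \<sigma> \<phi>) x"

context
  fixes \<sigma> :: real and \<phi> :: "real^'n \<Rightarrow> real"
  assumes \<sigma>: "0 < \<sigma>" and \<phi>: "\<phi> \<in> lipc"
begin

lemma molli_differentiable:
  "molli \<sigma> \<phi> differentiable (at x)" "grad (molli \<sigma> \<phi>) differentiable (at x)"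
  "i \<in> Basis \<Longrightarrow> pd i (molli \<sigma> \<phi>) differentiable (at x)"
  "i \<in> Basis \<Longrightarrow> j \<in> Basis \<Longrightarrow> pd j (pd i (molli \<sigma> \<phi>)) differentiable (at x)"
proof -
  have C: "C_class (Suc (Suc (Suc 0))) (molli \<sigma> \<phi>)" using \<sigma> \<phi> by (rule molli_C_class)
  have C2: "C_class (Suc (Suc 0)) (molli \<sigma> \<phi>)" using \<sigma> \<phi> by (rule molli_C_class)
  show "molli \<sigma> \<phi> differentiable (at x)" "grad (molli \<sigma> \<phi>) differentiable (at x)"
    using C_class_2_grad[OF C2] by auto
  show "pd i (molli \<sigma> \<phi>) differentiable (at x)" if "i \<in> Basis"
    using C that unfolding C_class_Suc_pd by blast
  show "pd j (pd i (molli \<sigma> \<phi>)) differentiable (at x)" if "i \<in> Basis" "j \<in> Basis"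
    using C that unfolding C_class_Suc_pd by blast
qed

lemma norm_grad_molli: "norm (grad (molli \<sigma> \<phi>) x) \<le> 1"
  using molli_lipschitz[OF \<sigma> \<phi>] molli_differentiable(1) by (rule norm_grad_le_lipschitz)

lemma grad_molli_lipschitz:
  "norm (grad (molli \<sigma> \<phi>) x - grad (molli \<sigma> \<phi>) y) \<le> molli_const TYPE('n) / \<sigma> * norm (x - y)"
proof -
  have "norm (grad (molli \<sigma> \<phi>) x - grad (molli \<sigma> \<phi>) y) \<le> (\<Sum>i\<in>Basis. \<bar>(grad (molli \<sigma> \<phi>) x - grad (molli \<sigma> \<phi>) y) \<bullet> i\<bar>)"
    by (rule norm_le_l1)
  also have "\<dots> \<le> (\<Sum>i\<in>(Basis :: (real^'n) set). kernel_const TYPE(real^'n) / \<sigma> * norm (x - y))"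
    using lipschitz_onD[OF molli_pd_lipschitz[OF \<sigma> \<phi>], of _ _ x y]
    by (intro sum_mono) (simp add: inner_diff_left grad_inner[OF molli_differentiable(1)] dist_real_def dist_norm)
  also have "\<dots> = molli_const TYPE('n) / \<sigma> * norm (x - y)" by simp
  finally show ?thesis .
qed

lemma laplacian_molli: "laplacian (molli \<sigma> \<phi>) x = (\<Sum>i\<in>Basis. pd i (pd i (molli \<sigma> \<phi>)) x)"
  using molli_differentiable(1,2) by (rule laplacian_eq)

lemma abs_laplacian_molli: "\<bar>laplacian (molli \<sigma> \<phi>) x\<bar> \<le> molli_const TYPE('n) / \<sigma>"
proof -
  have "\<bar>laplacian (molli \<sigma> \<phi>) x\<bar> \<le> (\<Sum>i\<in>Basis. \<bar>pd i (pd i (molli \<sigma> \<phi>)) x\<bar>)"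
    unfolding laplacian_molli by (rule sum_abs)
  also have "\<dots> \<le> (\<Sum>i\<in>(Basis :: (real^'n) set). kernel_const TYPE(real^'n) / \<sigma>)"
  proof (rule sum_mono)
    fix i :: "real^'n" assume i: "i \<in> Basis"
    show "\<bar>pd i (pd i (molli \<sigma> \<phi>)) x\<bar> \<le> kernel_const TYPE(real^'n) / \<sigma>"
      using abs_pd_le_lipschitz[OF molli_pd_lipschitz[OF \<sigma> \<phi> i i] molli_differentiable(3)[OF i], where v = i] i by simp
  qed
  finally show ?thesis by simp
qed

lemma laplacian_molli_lipschitz:
  "\<bar>laplacian (molli \<sigma> \<phi>) x - laplacian (molli \<sigma> \<phi>) y\<bar> \<le> molli_const TYPE('n) / \<sigma>\<^sup>2 * norm (x - y)"
proof -
  have "\<bar>laplacian (molli \<sigma> \<phi>) x - laplacian (molli \<sigma> \<phi>) y\<bar>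
     \<le> (\<Sum>i\<in>Basis. \<bar>pd i (pd i (molli \<sigma> \<phi>)) x - pd i (pd i (molli \<sigma> \<phi>)) y\<bar>)"
    unfolding laplacian_molli sum_subtractf[symmetric] by (rule sum_abs)
  also have "\<dots> \<le> (\<Sum>i\<in>(Basis :: (real^'n) set). kernel_const TYPE(real^'n) / \<sigma>\<^sup>2 * norm (x - y))"
    using lipschitz_onD[OF molli_pd_pd_lipschitz[OF \<sigma> \<phi>], of _ _ x y]
    by (intro sum_mono) (simp add: dist_real_def dist_norm)
  finally show ?thesis by simp
qed

text \<open>The bound is free of \<open>\<sigma>\<close> because mollifying does not increase the
  Lipschitz constant 1. Errors in the drift thus enter the comparison with constant 1 at every scale
  of mollification.\<close>

lemma generator_diff: "\<bar>generator \<sigma> \<phi> b x - generator \<sigma> \<phi> b' x\<bar> \<le> norm (b x - b' x)"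
proof -
  have "\<bar>generator \<sigma> \<phi> b x - generator \<sigma> \<phi> b' x\<bar> = \<bar>(b x - b' x) \<bullet> grad (molli \<sigma> \<phi>) x\<bar>"
    by (simp add: generator_def inner_diff_left)
  also have "\<dots> \<le> norm (b x - b' x) * norm (grad (molli \<sigma> \<phi>) x)" by (rule Cauchy_Schwarz_ineq2)
  also have "\<dots> \<le> norm (b x - b' x)" using norm_grad_molli[of x] by (simp add: mult_left_le)
  finally show ?thesis .
qed

lemma abs_generator: "norm (b x) \<le> B \<Longrightarrow> \<bar>generator \<sigma> \<phi> b x\<bar> \<le> molli_const TYPE('n) / \<sigma> + B"
  using generator_diff[of b x "\<lambda>_. 0"] abs_laplacian_molli[of x] by (simp add: generator_def)

lemma generator_continuous:
  assumes "continuous_on UNIV b"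
  shows "continuous_on UNIV (generator \<sigma> \<phi> b)"
proof -
  have "continuous_on UNIV (grad (molli \<sigma> \<phi>))"
    using molli_differentiable(2) by (intro continuous_at_imp_continuous_on) (auto intro: differentiable_imp_continuous_within)
  moreover have "continuous_on UNIV (laplacian (molli \<sigma> \<phi>))"
  proof (rule lipschitz_on_continuous_on[OF lipschitz_onI])
    show "dist (laplacian (molli \<sigma> \<phi>) x) (laplacian (molli \<sigma> \<phi>) y) \<le> molli_const TYPE('n) / \<sigma>\<^sup>2 * dist x y" for x y
      using laplacian_molli_lipschitz[of x y] by (simp add: dist_real_def dist_norm)
  qed (simp add: kernel_const_nonneg)
  ultimately show ?thesis unfolding generator_def[abs_def] using assms by (intro continuous_intros)
qed

text \<open>This constant blows up as \<open>\<sigma> \<rightarrow> 0\<close>. It is multiplied by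
  moduli that vanish with the time step, or used at fixed \<open>\<sigma>\<close> to get continuity
  in time.\<close>

lemma generator_lipschitz:
  assumes "\<And>x. norm (b x) \<le> B" "\<And>x y. norm (b x - b y) \<le> K * norm (x - y)"
  shows "(molli_const TYPE('n) / \<sigma>\<^sup>2 + K + B * molli_const TYPE('n) / \<sigma>)-lipschitz_on UNIV (generator \<sigma> \<phi> b)"
proof (rule lipschitz_onI)
  have B: "0 \<le> B" using assms(1)[of 0] norm_ge_zero order_trans by blast
  fix x y
  let ?g = "grad (molli \<sigma> \<phi>)"
  have "\<bar>b x \<bullet> ?g x - b y \<bullet> ?g y\<bar> = \<bar>(b x - b y) \<bullet> ?g x + b y \<bullet> (?g x - ?g y)\<bar>"
    by (simp add: inner_diff_left inner_diff_right)
  also have "\<dots> \<le> norm (b x - b y) * norm (?g x) + norm (b y) * norm (?g x - ?g y)"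
    by (rule order_trans[OF abs_triangle_ineq add_mono[OF Cauchy_Schwarz_ineq2 Cauchy_Schwarz_ineq2]])
  also have "\<dots> \<le> K * norm (x - y) * 1 + B * (molli_const TYPE('n) / \<sigma> * norm (x - y))"
    using assms norm_grad_molli grad_molli_lipschitz B
    by (intro add_mono mult_mono) (auto intro: order_trans[OF norm_ge_zero assms(2)])
  finally have "\<bar>b x \<bullet> ?g x - b y \<bullet> ?g y\<bar> \<le> K * norm (x - y) + B * (molli_const TYPE('n) / \<sigma> * norm (x - y))" by simp
  then show "dist (generator \<sigma> \<phi> b x) (generator \<sigma> \<phi> b y) \<le> (molli_const TYPE('n) / \<sigma>\<^sup>2 + K + B * molli_const TYPE('n) / \<sigma>) * dist x y"
    using laplacian_molli_lipschitz[of x y]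
    by (simp add: generator_def dist_real_def dist_norm distrib_right)
next
  have "0 \<le> B" using assms(1)[of 0] norm_ge_zero order_trans by blast
  moreover have "0 \<le> K"
  proof -
    \<comment> \<open>A unit vector extracts the sign of \<open>K\<close>.\<close>
    have "0 \<le> K * norm (axis undefined 1 - 0 :: real^'n)" using assms(2) norm_ge_zero order_trans by blast
    then show ?thesis by simp
  qed
  ultimately show "0 \<le> molli_const TYPE('n) / \<sigma>\<^sup>2 + K + B * molli_const TYPE('n) / \<sigma>"
    using \<sigma> by (intro add_nonneg_nonneg divide_nonneg_nonneg mult_nonneg_nonneg) (auto simp: kernel_const_nonneg)
qed

end

section \<open>The random walk with drift\<close>

lemma second_difference_bound:
  fixes g g' g'' :: "real \<Rightarrow> real"
  assumes g: "\<And>s. (g has_real_derivative g' s) (at s)" and g': "\<And>s. (g' has_real_derivative g'' s) (at s)"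
    and M: "\<And>s. \<bar>g'' s - g'' 0\<bar> \<le> M * \<bar>s\<bar>" and r: "0 < r"
  shows "\<bar>g r + g (- r) - 2 * g 0 - r\<^sup>2 * g'' 0\<bar> \<le> 2 * M * r ^ 3"
proof -
  define F where "F s = g s + g (- s) - 2 * g 0 - s\<^sup>2 * g'' 0" for s
  have F': "(F has_real_derivative (g' s - g' (- s) - 2 * s * g'' 0)) (at s)" for s
    unfolding F_def by (rule derivative_eq_intros g DERIV_chain'[OF _ g, of uminus] refl | simp)+
  \<comment> \<open>A first use of the mean value theorem leaves a symmetric difference of
    \<open>g'\<close>; a second one turns it into \<open>g''\<close> at a nearby point, where the
    Lipschitz bound on \<open>g''\<close> supplies the third power of \<open>r\<close>.\<close>
  obtain s where s: "0 < s" "s < r" "F r - F 0 = (r - 0) * (g' s - g' (- s) - 2 * s * g'' 0)"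
    using MVT2[OF r, of F "\<lambda>s. g' s - g' (- s) - 2 * s * g'' 0"] F' by blast
  obtain z where z: "- s < z" "z < s" "g' s - g' (- s) = (s - (- s)) * g'' z"
    using MVT2[of "- s" s g' g''] g' s(1) by auto
  have M0: "0 \<le> M" using M[of 1] abs_ge_zero order_trans by fastforce
  have "F r = r * (2 * s * (g'' z - g'' 0))" using s(3) z(3) by (simp add: F_def algebra_simps)
  then have "\<bar>F r\<bar> = r * (2 * s * \<bar>g'' z - g'' 0\<bar>)" using r s by (simp add: abs_mult)
  also have "\<dots> \<le> r * (2 * r * (M * r))"
  proof -
    have "\<bar>g'' z - g'' 0\<bar> \<le> M * r"
      using M[of z] z s M0 by (intro order_trans[OF M] mult_left_mono) auto
    then show ?thesis using r s by (intro mult_left_mono mult_mono) auto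
  qed
  finally show ?thesis by (simp add: F_def power3_eq_cube algebra_simps)
qed

lemma molli_translate: "0 < \<sigma> \<Longrightarrow> continuous_on UNIV \<phi> \<Longrightarrow> molli \<sigma> (\<lambda>y. \<phi> (y + v)) x = molli \<sigma> \<phi> (x + v)"
  by (subst (1 2) molli_eq) (auto intro!: continuous_on_compose2[of UNIV \<phi>] continuous_intros simp: algebra_simps)

definition walk :: "real \<Rightarrow> ('a::euclidean_space \<Rightarrow> real) \<Rightarrow> 'a \<Rightarrow> real"
  where "walk r \<phi> y = inverse (2 * real DIM('a)) * (\<Sum>i\<in>Basis. \<phi> (y + r *\<^sub>R i) + \<phi> (y + (- r) *\<^sub>R i))"

text \<open>Both operations are averages of translates, hence they commute.\<close>

lemma molli_walk:
  assumes \<sigma>: "0 < \<sigma>" and c: "continuous_on UNIV \<phi>"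
  shows "molli \<sigma> (walk r \<phi>) x = walk r (molli \<sigma> \<phi>) x"
proof -
  have ct: "continuous_on UNIV (\<lambda>y. \<phi> (y + v))" for v
    by (rule continuous_on_compose2[OF c]) (auto intro: continuous_intros)
  note I = integrable_molli[OF ct, of x \<sigma>]
  have cw: "continuous_on UNIV (walk r \<phi>)" unfolding walk_def[abs_def] by (intro continuous_intros ct)
  have "molli \<sigma> (walk r \<phi>) x = (LINT z|lborel. inverse (2 * real DIM('a)) *
      (\<Sum>i\<in>Basis. \<phi> (x - \<sigma> *\<^sub>R z + r *\<^sub>R i) * kernel 1 z + \<phi> (x - \<sigma> *\<^sub>R z + (- r) *\<^sub>R i) * kernel 1 z))"
    unfolding molli_eq[OF \<sigma> cw] walk_def
    by (intro Bochner_Integration.integral_cong refl) (simp only: distrib_right sum_distrib_right mult.assoc)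
  also have "\<dots> = inverse (2 * real DIM('a)) * (\<Sum>i\<in>Basis. molli \<sigma> (\<lambda>y. \<phi> (y + r *\<^sub>R i)) x + molli \<sigma> (\<lambda>y. \<phi> (y + (- r) *\<^sub>R i)) x)"
    unfolding molli_eq[OF \<sigma> ct] integral_mult_right_zero
    by (subst Bochner_Integration.integral_sum) (intro Bochner_Integration.integrable_add I refl | simp only: Bochner_Integration.integral_add[OF I I])+
  also have "\<dots> = walk r (molli \<sigma> \<phi>) x" unfolding molli_translate[OF \<sigma> c] walk_def ..
  finally show ?thesis .
qed

lemma walk_lipschitz:
  fixes \<phi> :: "'a::euclidean_space \<Rightarrow> real"
  assumes "\<And>x y. \<bar>\<phi> x - \<phi> y\<bar> \<le> norm (x - y)"
  shows "\<bar>walk r \<phi> x - walk r \<phi> y\<bar> \<le> norm (x - y)"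
proof -
  have N: "0 < real DIM('a)" by simp
  have "\<bar>walk r \<phi> x - walk r \<phi> y\<bar> = inverse (2 * real DIM('a)) *
     \<bar>\<Sum>i\<in>Basis. (\<phi> (x + r *\<^sub>R i) + \<phi> (x + (- r) *\<^sub>R i)) - (\<phi> (y + r *\<^sub>R i) + \<phi> (y + (- r) *\<^sub>R i))\<bar>"
    unfolding walk_def sum_subtractf right_diff_distrib[symmetric] abs_mult by simp
  also have "\<dots> \<le> inverse (2 * real DIM('a)) * (\<Sum>i\<in>(Basis::'a set). 2 * norm (x - y))"
  proof (intro mult_left_mono order_trans[OF sum_abs] sum_mono)
    fix i :: 'a
    show "\<bar>(\<phi> (x + r *\<^sub>R i) + \<phi> (x + (- r) *\<^sub>R i)) - (\<phi> (y + r *\<^sub>R i) + \<phi> (y + (- r) *\<^sub>R i))\<bar> \<le> 2 * norm (x - y)"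
      using assms[of "x + r *\<^sub>R i" "y + r *\<^sub>R i"] assms[of "x + (- r) *\<^sub>R i" "y + (- r) *\<^sub>R i"] by simp
  qed simp
  also have "\<dots> = norm (x - y)" using N by simp
  finally show ?thesis .
qed

text \<open>The test functions do not depend on time and the derivative is a classical one, so that
  the mean value theorem applies on each time interval.\<close>

definition weak_fp :: "(real \<Rightarrow> real^'n \<Rightarrow> real^'n) \<Rightarrow> (real \<Rightarrow> (real^'n) measure) \<Rightarrow> bool"
  where "weak_fp \<beta> \<mu> \<longleftrightarrow> (\<forall>\<sigma>>0. \<forall>\<phi>\<in>lipc. \<forall>t>0.
    ((\<lambda>t. LINT x|\<mu> t. molli \<sigma> \<phi> x) has_real_derivative (LINT x|\<mu> t. generator \<sigma> \<phi> (\<beta> t) x)) (at t))"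

text \<open>The second differences in the coordinate directions sum to \<open>r\<^sup>2\<close>
  times the Laplacian, and \<open>r\<^sup>2 / (2 * N) = h\<close>. The cubic error
  \<open>r ^ 3\<close> equals \<open>h * r\<close> up to a constant.\<close>

lemma walk_molli_taylor:
  fixes \<phi> :: "real^'n \<Rightarrow> real"
  assumes \<sigma>: "0 < \<sigma>" and \<phi>: "\<phi> \<in> lipc" and h: "0 < h"
  shows "\<bar>walk (sqrt (2 * real CARD('n) * h)) (molli \<sigma> \<phi>) y - molli \<sigma> \<phi> y - h * laplacian (molli \<sigma> \<phi>) y\<bar>
    \<le> h * (2 * molli_const TYPE('n) / \<sigma>\<^sup>2 * sqrt (2 * real CARD('n) * h))"
proof -
  define N where "N = real CARD('n)"
  have N: "0 < N" by (simp add: N_def)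
  define r where "r = sqrt (2 * N * h)"
  have r: "0 < r" "r\<^sup>2 = 2 * N * h" using N h by (auto simp: r_def)
  define \<psi> where "\<psi> = molli \<sigma> \<phi>"
  define M where "M = kernel_const TYPE(real^'n) / \<sigma>\<^sup>2"
  have axis: "\<bar>\<psi> (y + r *\<^sub>R i) + \<psi> (y + (- r) *\<^sub>R i) - 2 * \<psi> y - r\<^sup>2 * pd i (pd i \<psi>) y\<bar> \<le> 2 * M * r ^ 3"
    if i: "i \<in> Basis" for i
  proof -
    have "\<bar>pd i (pd i \<psi>) (y + s *\<^sub>R i) - pd i (pd i \<psi>) (y + 0 *\<^sub>R i)\<bar> \<le> M * \<bar>s\<bar>" for s
      using lipschitz_onD[OF molli_pd_pd_lipschitz[OF \<sigma> \<phi> i i], of "y + s *\<^sub>R i" y] i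
      by (simp add: \<psi>_def M_def dist_real_def dist_norm)
    from second_difference_bound[OF has_real_derivative_along_line has_real_derivative_along_line this r(1)]
    show ?thesis using molli_differentiable[OF \<sigma> \<phi>] i by (simp add: \<psi>_def)
  qed
  have "walk r \<psi> y - \<psi> y - h * laplacian \<psi> y
     = inverse (2 * N) * (\<Sum>i\<in>Basis. \<psi> (y + r *\<^sub>R i) + \<psi> (y + (- r) *\<^sub>R i) - 2 * \<psi> y - r\<^sup>2 * pd i (pd i \<psi>) y)"
  proof -
    have "laplacian \<psi> y = (\<Sum>i\<in>Basis. pd i (pd i \<psi>) y)" unfolding \<psi>_def by (rule laplacian_molli[OF \<sigma> \<phi>])
    moreover have "(\<Sum>i\<in>(Basis :: (real^'n) set). 2 * \<psi> y) = 2 * N * \<psi> y" by (simp add: N_def)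
    moreover have "inverse (2 * N) * (a - 2 * N * b - 2 * N * h * c) = inverse (2 * N) * a - b - h * c" for a b c
      using N by (simp add: field_simps)
    moreover have "(\<Sum>i\<in>Basis. \<psi> (y + r *\<^sub>R i) + \<psi> (y + (- r) *\<^sub>R i) - 2 * \<psi> y - r\<^sup>2 * pd i (pd i \<psi>) y)
       = (\<Sum>i\<in>Basis. \<psi> (y + r *\<^sub>R i) + \<psi> (y + (- r) *\<^sub>R i)) - (\<Sum>i\<in>(Basis :: (real^'n) set). 2 * \<psi> y)
        - 2 * N * h * (\<Sum>i\<in>Basis. pd i (pd i \<psi>) y)"
      unfolding sum_subtractf r(2) sum_distrib_left ..
    moreover have "real DIM(real^'n) = N" by (simp add: N_def)
    ultimately show ?thesis unfolding walk_def by presburger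
  qed
  also have "\<bar>\<dots>\<bar> \<le> inverse (2 * N) * (\<Sum>i\<in>(Basis :: (real^'n) set). 2 * M * r ^ 3)"
    unfolding abs_mult by (intro mult_mono order_trans[OF sum_abs] sum_mono axis) (use N in auto)
  also have "\<dots> = inverse (2 * N) * (N * (2 * M * (r\<^sup>2 * r)))"
    by (simp add: N_def power3_eq_cube power2_eq_square mult.assoc)
  also have "\<dots> = h * (2 * (N * M) * r)" unfolding r(2) using N by (simp add: field_simps)
  finally show ?thesis by (simp add: \<psi>_def r_def N_def M_def)
qed

text \<open>The step size makes the generator of the walk equal to the Laplacian.\<close>

definition scheme :: "real \<Rightarrow> (real^'n \<Rightarrow> real^'n) \<Rightarrow> (real^'n \<Rightarrow> real) \<Rightarrow> real^'n \<Rightarrow> real"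
  where "scheme h b \<phi> y = walk (sqrt (2 * real CARD('n) * h)) \<phi> (y - h *\<^sub>R b y)"

text \<open>The three terms are the Taylor error of the walk, the error of linearising the
  displacement by the drift, and the price of moving the point at which the Laplacian is taken. For
  fixed \<open>\<sigma>\<close> all vanish with \<open>h\<close>.\<close>

definition scheme_error :: "'n::finite itself \<Rightarrow> real \<Rightarrow> real \<Rightarrow> real \<Rightarrow> real"
  where "scheme_error _ \<sigma> B h = 2 * molli_const TYPE('n) / \<sigma>\<^sup>2 * sqrt (2 * real CARD('n) * h)
    + molli_const TYPE('n) / \<sigma> * (h * B\<^sup>2) + molli_const TYPE('n) / \<sigma>\<^sup>2 * (h * B)"

text \<open>Mollification commutes with the walk, but not with a drift that varies in space: the
  commutator is at most \<open>h * K * \<sigma>\<close>. Being proportional to \<open>h\<close>,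
  like the step itself, it does not improve with finer steps and is removed by
  \<open>\<sigma> \<rightarrow> 0\<close>.\<close>

lemma scheme_consistent:
  fixes b :: "real^'n \<Rightarrow> real^'n"
  assumes \<sigma>: "0 < \<sigma>" and \<phi>: "\<phi> \<in> lipc" and h: "0 < h"
    and B: "\<And>x. norm (b x) \<le> B" and K: "\<And>x y. norm (b x - b y) \<le> K * norm (x - y)"
  shows "\<bar>molli \<sigma> \<phi> x + h * generator \<sigma> \<phi> b x - molli \<sigma> (scheme h b \<phi>) x\<bar>
    \<le> h * (K * \<sigma> + scheme_error TYPE('n) \<sigma> B h)"
proof -
  define r where "r = sqrt (2 * real CARD('n) * h)"
  define \<psi> where "\<psi> = molli \<sigma> \<phi>"
  define N1 where "N1 = molli_const TYPE('n)"
  have N1: "0 \<le> N1" by (simp add: N1_def kernel_const_nonneg)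
  define y where "y = x - h *\<^sub>R b x"
  have c: "continuous_on UNIV \<phi>" using lipcD(2)[OF \<phi>] .
  have wl: "\<bar>walk r \<phi> u - walk r \<phi> v\<bar> \<le> norm (u - v)" for u v
    using lipcD(3)[OF \<phi>] by (rule walk_lipschitz)
  have cb: "continuous_on UNIV b"
  proof (rule lipschitz_on_continuous_on[OF lipschitz_onI])
    show "dist (b x) (b y) \<le> \<bar>K\<bar> * dist x y" for x y
      using K[of x y] mult_right_mono[OF abs_ge_self[of K] norm_ge_zero[of "x - y"]] by (simp add: dist_norm)
  qed simp
  have cw: "continuous_on UNIV (walk r \<phi>)"
  proof (rule lipschitz_on_continuous_on)
    show "1-lipschitz_on UNIV (walk r \<phi>)"
    proof (rule lipschitz_onI)
      show "dist (walk r \<phi> u) (walk r \<phi> v) \<le> 1 * dist u v" for u v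
        using wl[of u v] by (simp add: dist_real_def dist_norm)
    qed simp
  qed
  have cs: "continuous_on UNIV (scheme h b \<phi>)"
  proof -
    have "continuous_on UNIV (\<lambda>y. y - h *\<^sub>R b y)" by (intro continuous_intros cb)
    from continuous_on_compose2[OF cw this] show ?thesis
      by (simp add: scheme_def[abs_def] r_def[symmetric])
  qed
  \<comment> \<open>Inside the average the drift is taken at
    \<open>x - \<sigma> *\<^sub>R z\<close>, on the other side at \<open>x\<close>; the two
    displacements differ by at most \<open>h * K * \<sigma>\<close>.\<close>
  have 1: "\<bar>molli \<sigma> (scheme h b \<phi>) x - molli \<sigma> (walk r \<phi>) y\<bar> \<le> h * (K * \<sigma>)"
  proof (rule molli_compare[OF \<sigma> cs cw])
    fix z :: "real^'n" assume z: "norm z \<le> 1"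
    have "0 \<le> K * norm (axis undefined 1 - 0 :: real^'n)" by (rule order_trans[OF norm_ge_zero K])
    then have K0: "0 \<le> K" by simp
    have "\<bar>scheme h b \<phi> (x - \<sigma> *\<^sub>R z) - walk r \<phi> (y - \<sigma> *\<^sub>R z)\<bar>
       \<le> norm ((x - \<sigma> *\<^sub>R z - h *\<^sub>R b (x - \<sigma> *\<^sub>R z)) - (y - \<sigma> *\<^sub>R z))"
      unfolding scheme_def r_def[symmetric] by (rule wl)
    also have "\<dots> = norm (h *\<^sub>R (b x - b (x - \<sigma> *\<^sub>R z)))" by (simp add: y_def algebra_simps)
    also have "\<dots> \<le> h * (K * norm (\<sigma> *\<^sub>R z))" using K[of x "x - \<sigma> *\<^sub>R z"] h by simp
    also have "\<dots> \<le> h * (K * \<sigma>)" using z h K0 \<sigma> by (intro mult_left_mono) (auto intro: mult_left_le)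
    finally show "\<bar>scheme h b \<phi> (x - \<sigma> *\<^sub>R z) - walk r \<phi> (y - \<sigma> *\<^sub>R z)\<bar> \<le> h * (K * \<sigma>)" .
  qed
  have 2: "\<bar>molli \<sigma> (walk r \<phi>) y - \<psi> y - h * laplacian \<psi> y\<bar> \<le> h * (2 * N1 / \<sigma>\<^sup>2 * r)"
    unfolding molli_walk[OF \<sigma> c] r_def \<psi>_def N1_def by (rule walk_molli_taylor[OF \<sigma> \<phi> h])
  have 3: "\<bar>\<psi> y - \<psi> x + h * (b x \<bullet> grad \<psi> x)\<bar> \<le> h * (N1 / \<sigma> * (h * B\<^sup>2))"
  proof -
    define v where "v = - h *\<^sub>R b x"
    obtain s where s: "0 < s" "s < 1" "\<psi> (x + 1 *\<^sub>R v) - \<psi> (x + 0 *\<^sub>R v) = (1 - 0) * pd v \<psi> (x + s *\<^sub>R v)"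
      using MVT2[of 0 1 "\<lambda>s. \<psi> (x + s *\<^sub>R v)" "\<lambda>s. pd v \<psi> (x + s *\<^sub>R v)"]
        has_real_derivative_along_line[OF molli_differentiable(1)[OF \<sigma> \<phi>]] unfolding \<psi>_def by auto
    have "\<psi> y - \<psi> x + h * (b x \<bullet> grad \<psi> x) = (grad \<psi> (x + s *\<^sub>R v) - grad \<psi> x) \<bullet> v"
      using s(3) by (simp add: y_def v_def \<psi>_def inner_diff_left inner_diff_right right_diff_distrib inner_commute grad_inner[OF molli_differentiable(1)[OF \<sigma> \<phi>], symmetric])
    also have "\<bar>\<dots>\<bar> \<le> norm (grad \<psi> (x + s *\<^sub>R v) - grad \<psi> x) * norm v" by (rule Cauchy_Schwarz_ineq2)
    also have "\<dots> \<le> (N1 / \<sigma> * norm v) * norm v"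
    proof (rule mult_right_mono)
      have "norm (grad \<psi> (x + s *\<^sub>R v) - grad \<psi> x) \<le> N1 / \<sigma> * norm (s *\<^sub>R v)"
        using grad_molli_lipschitz[OF \<sigma> \<phi>, of "x + s *\<^sub>R v" x] by (simp add: \<psi>_def N1_def)
      also have "\<dots> \<le> N1 / \<sigma> * norm v" using s N1 \<sigma> by (intro mult_left_mono) (auto intro: mult_left_le_one_le)
      finally show "norm (grad \<psi> (x + s *\<^sub>R v) - grad \<psi> x) \<le> N1 / \<sigma> * norm v" .
    qed simp
    also have "\<dots> \<le> N1 / \<sigma> * ((h * B) * (h * B))"
    proof -
      have nv: "norm v \<le> h * B" using B[of x] h by (simp add: v_def)
      then have "norm v * norm v \<le> (h * B) * (h * B)"
        by (intro mult_mono) (auto intro: order_trans[OF norm_ge_zero nv])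
      then show ?thesis unfolding mult.assoc using N1 \<sigma> by (intro mult_left_mono) auto
    qed
    finally show ?thesis by (simp add: power2_eq_square mult.commute mult.left_commute)
  qed
  have 4: "\<bar>h * laplacian \<psi> y - h * laplacian \<psi> x\<bar> \<le> h * (N1 / \<sigma>\<^sup>2 * (h * B))"
  proof -
    have "\<bar>laplacian \<psi> y - laplacian \<psi> x\<bar> \<le> N1 / \<sigma>\<^sup>2 * norm (y - x)"
      using laplacian_molli_lipschitz[OF \<sigma> \<phi>, of y x] by (simp add: \<psi>_def N1_def)
    also have "\<dots> \<le> N1 / \<sigma>\<^sup>2 * (h * B)" using B[of x] h N1 by (intro mult_left_mono) (auto simp: y_def)
    finally have "h * \<bar>laplacian \<psi> y - laplacian \<psi> x\<bar> \<le> h * (N1 / \<sigma>\<^sup>2 * (h * B))"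
      using h by (intro mult_left_mono) auto
    moreover have "\<bar>h * laplacian \<psi> y - h * laplacian \<psi> x\<bar> = h * \<bar>laplacian \<psi> y - laplacian \<psi> x\<bar>"
      using h by (simp add: right_diff_distrib[symmetric] abs_mult)
    ultimately show ?thesis by presburger
  qed
  have g: "generator \<sigma> \<phi> b x = laplacian \<psi> x - b x \<bullet> grad \<psi> x" by (simp add: generator_def \<psi>_def)
  have e: "h * (K * \<sigma> + scheme_error TYPE('n) \<sigma> B h) = h * (K * \<sigma>) + h * (2 * N1 / \<sigma>\<^sup>2 * r) + h * (N1 / \<sigma> * (h * B\<^sup>2)) + h * (N1 / \<sigma>\<^sup>2 * (h * B))"
    by (simp add: scheme_error_def N1_def r_def algebra_simps)
  show ?thesis unfolding g e \<psi>_def[symmetric] right_diff_distrib using 1 2 3 4 by linarith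
qed

text \<open>The Euler map has Lipschitz constant \<open>1 + K * h\<close> and the walk has constant
  1, so the class is preserved after normalisation. The support grows by the largest displacement
  \<open>h * B + r\<close>, with \<open>r\<close> the step length of the walk.\<close>

lemma scheme_lipc:
  fixes b :: "real^'n \<Rightarrow> real^'n"
  assumes \<phi>: "\<phi> \<in> lipc" and h: "0 < h" and K0: "0 \<le> K"
    and B: "\<And>x. norm (b x) \<le> B" and K: "\<And>x y. norm (b x - b y) \<le> K * norm (x - y)"
  shows "(\<lambda>x. inverse (1 + K * h) * scheme h b \<phi> x) \<in> lipc"
proof -
  define r where "r = sqrt (2 * real CARD('n) * h)"
  have pos: "0 < 1 + K * h" using K0 h by (simp add: add_pos_nonneg)
  have r: "0 \<le> r" using h by (simp add: r_def)
  have lip: "\<bar>scheme h b \<phi> x - scheme h b \<phi> y\<bar> \<le> (1 + K * h) * norm (x - y)" for x y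
  proof -
    have "\<bar>scheme h b \<phi> x - scheme h b \<phi> y\<bar> \<le> norm ((x - h *\<^sub>R b x) - (y - h *\<^sub>R b y))"
      unfolding scheme_def by (rule walk_lipschitz[OF lipcD(3)[OF \<phi>]])
    also have "\<dots> = norm ((x - y) - h *\<^sub>R (b x - b y))" by (simp add: algebra_simps)
    also have "\<dots> \<le> norm (x - y) + norm (h *\<^sub>R (b x - b y))" by (rule norm_triangle_ineq4)
    also have "\<dots> \<le> norm (x - y) + h * (K * norm (x - y))" using K[of x y] h by simp
    finally show ?thesis by (simp add: algebra_simps)
  qed
  have "1-lipschitz_on UNIV (\<lambda>x. inverse (1 + K * h) * scheme h b \<phi> x)"
  proof (rule lipschitz_onI)
    fix x y
    have "inverse (1 + K * h) * \<bar>scheme h b \<phi> x - scheme h b \<phi> y\<bar> \<le> inverse (1 + K * h) * ((1 + K * h) * norm (x - y))"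
      using lip pos by (intro mult_left_mono) auto
    then show "dist (inverse (1 + K * h) * scheme h b \<phi> x) (inverse (1 + K * h) * scheme h b \<phi> y) \<le> 1 * dist x y"
      using pos by (simp add: dist_real_def dist_norm right_diff_distrib[symmetric] abs_mult mult.assoc[symmetric])
  qed simp
  moreover obtain R where R: "\<And>x. R < norm x \<Longrightarrow> \<phi> x = 0" using \<phi> by (auto simp: lipc_def)
  have "scheme h b \<phi> x = 0" if x: "R + h * B + r < norm x" for x
  proof -
    have "\<phi> (x - h *\<^sub>R b x + s *\<^sub>R i) = 0" if "i \<in> Basis" "\<bar>s\<bar> = r" for i s
    proof (rule R)
      have "norm x \<le> norm (x - h *\<^sub>R b x + s *\<^sub>R i) + norm (h *\<^sub>R b x - s *\<^sub>R i)"
        using norm_triangle_ineq[of "x - h *\<^sub>R b x + s *\<^sub>R i" "h *\<^sub>R b x - s *\<^sub>R i"] by simp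
      moreover have "norm (h *\<^sub>R b x - s *\<^sub>R i) \<le> h * norm (b x) + r"
        using norm_triangle_ineq4[of "h *\<^sub>R b x" "s *\<^sub>R i"] that h by simp
      moreover have "h * norm (b x) \<le> h * B" using B h by simp
      ultimately show "R < norm (x - h *\<^sub>R b x + s *\<^sub>R i)" using x by linarith
    qed
    then show ?thesis unfolding scheme_def walk_def r_def[symmetric] using r by (simp del: scaleR_minus_left)
  qed
  ultimately show ?thesis by (auto simp: lipc_def intro!: exI[of _ "R + h * B + r"])
qed

section \<open>Time regularity and comparison of two weak solutions\<close>

lemma weak_fp_mean_value:
  assumes w: "weak_fp \<beta> \<mu>" and m: "P1_curve \<mu>" and \<sigma>: "0 < \<sigma>" and \<phi>: "\<phi> \<in> lipc" and st: "0 \<le> s" "s < t"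
  obtains r where "s < r" "r < t"
    "(LINT x|\<mu> t. molli \<sigma> \<phi> x) - (LINT x|\<mu> s. molli \<sigma> \<phi> x) = (t - s) * (LINT x|\<mu> r. generator \<sigma> \<phi> (\<beta> r) x)"
proof -
  have c: "continuous_on {s..t} (\<lambda>t. LINT x|\<mu> t. molli \<sigma> \<phi> x)"
    by (rule continuous_on_subset[OF P1_curve_integral_continuous[OF m molli_lipschitz[OF \<sigma> \<phi>]]]) (use st in auto)
  have D: "((\<lambda>t. LINT x|\<mu> t. molli \<sigma> \<phi> x) has_real_derivative (LINT x|\<mu> r. generator \<sigma> \<phi> (\<beta> r) x)) (at r)" if "0 < r" for r
    using w \<sigma> \<phi> that by (auto simp: weak_fp_def)
  have d: "(\<lambda>t. LINT x|\<mu> t. molli \<sigma> \<phi> x) differentiable (at r)" if "s < r" for r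
    using D[of r] that st real_differentiable_def by fastforce
  obtain l z where z: "s < z" "z < t" "((\<lambda>t. LINT x|\<mu> t. molli \<sigma> \<phi> x) has_real_derivative l) (at z)"
    "(LINT x|\<mu> t. molli \<sigma> \<phi> x) - (LINT x|\<mu> s. molli \<sigma> \<phi> x) = (t - s) * l"
    using MVT[OF st(2) c d] by metis
  moreover have "l = (LINT x|\<mu> z. generator \<sigma> \<phi> (\<beta> z) x)"
    using DERIV_unique[OF z(3) D] z(1) st by simp
  ultimately show ?thesis using that by blast
qed

lemma integrable_generator:
  fixes \<phi> :: "real^'n \<Rightarrow> real"
  assumes "0 < \<sigma>" "\<phi> \<in> lipc" "\<mu> \<in> P1" "continuous_on UNIV b" "\<And>x. norm (b x) \<le> B"
  shows "integrable \<mu> (generator \<sigma> \<phi> b)"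
proof (rule P1_integrable_affine_bound[OF assms(3), where b = 0])
  show "generator \<sigma> \<phi> b \<in> borel_measurable borel"
    using generator_continuous[OF assms(1,2,4)] by (rule borel_measurable_continuous_onI)
  show "norm (generator \<sigma> \<phi> b x) \<le> (molli_const TYPE('n) / \<sigma> + B) + 0 * norm x" for x
    using abs_generator[OF assms(1,2), of b x B] assms(5) by simp
qed

definition time_modulus :: "'n::finite itself \<Rightarrow> real \<Rightarrow> real \<Rightarrow> real"
  where "time_modulus _ B h = (2 + molli_const TYPE('n)) * sqrt h + B * h"

lemma time_modulus_mono:
  "0 \<le> B \<Longrightarrow> 0 \<le> g \<Longrightarrow> g \<le> h \<Longrightarrow> time_modulus TYPE('n::finite) B g \<le> time_modulus TYPE('n) B h"
  unfolding time_modulus_def by (intro add_mono mult_left_mono) (auto simp: kernel_const_nonneg)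

text \<open>The test function is mollified at scale \<open>sqrt (t - s)\<close>. Removing the
  mollification costs \<open>2 * \<sigma>\<close>, the Laplacian contributes a multiple of
  \<open>(t - s) / \<sigma>\<close>, which is \<open>\<sigma>\<close> again, and the drift
  contributes \<open>B * (t - s)\<close>.\<close>

lemma weak_fp_time_modulus:
  fixes \<mu> :: "real \<Rightarrow> (real^'n) measure"
  assumes w: "weak_fp \<beta> \<mu>" and m: "P1_curve \<mu>" and c: "\<And>t. 0 < t \<Longrightarrow> continuous_on UNIV (\<beta> t)"
    and B: "\<And>t x. 0 < t \<Longrightarrow> norm (\<beta> t x) \<le> B" and st: "0 \<le> s" "s \<le> t"
  shows "d1 (\<mu> t) (\<mu> s) \<le> time_modulus TYPE('n) B (t - s)"
proof (cases "s = t")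
  case True
  then show ?thesis using m st by (simp add: d1_self P1_curve_def time_modulus_def)
next
  case False
  have P: "\<mu> r \<in> P1" if "0 \<le> r" for r using m that by (auto simp: P1_curve_def)
  define \<sigma> where "\<sigma> = sqrt (t - s)"
  have lt: "s < t" using False st by simp
  have \<sigma>: "0 < \<sigma>" "\<sigma>\<^sup>2 = t - s" using lt by (auto simp: \<sigma>_def)
  show ?thesis
  proof (rule d1_le_of_lipc)
    fix \<phi> :: "real^'n \<Rightarrow> real" assume \<phi>: "\<phi> \<in> lipc"
    obtain r where r: "s < r" "r < t"
      and eq: "(LINT x|\<mu> t. molli \<sigma> \<phi> x) - (LINT x|\<mu> s. molli \<sigma> \<phi> x) = (t - s) * (LINT x|\<mu> r. generator \<sigma> \<phi> (\<beta> r) x)"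
      by (rule weak_fp_mean_value[OF w m \<sigma>(1) \<phi> st(1) lt])
    have r0: "0 < r" using r st by simp
    have "\<bar>LINT x|\<mu> r. generator \<sigma> \<phi> (\<beta> r) x\<bar> \<le> molli_const TYPE('n) / \<sigma> + B"
      using r0 by (intro abs_integral_le P integrable_generator[OF \<sigma>(1) \<phi> _ c B] abs_generator[OF \<sigma>(1) \<phi>, of "\<beta> r"] B) auto
    then have "(t - s) * (LINT x|\<mu> r. generator \<sigma> \<phi> (\<beta> r) x) \<le> (t - s) * (molli_const TYPE('n) / \<sigma> + B)"
      using st by (intro mult_left_mono) auto
    also have "\<dots> = molli_const TYPE('n) * \<sigma> + B * (t - s)"
      using \<sigma> by (simp add: \<sigma>(2)[symmetric] power2_eq_square field_simps)
    finally have 1: "(LINT x|\<mu> t. molli \<sigma> \<phi> x) - (LINT x|\<mu> s. molli \<sigma> \<phi> x) \<le> molli_const TYPE('n) * \<sigma> + B * (t - s)"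
      using eq by simp
    have 2: "\<bar>(LINT x|\<mu> r. molli \<sigma> \<phi> x) - (LINT x|\<mu> r. \<phi> x)\<bar> \<le> \<sigma>" if "0 \<le> r" for r
      by (intro abs_integral_diff_le P that P1_integrable_lipschitz[OF _ molli_lipschitz[OF \<sigma>(1) \<phi>]]
          P1_integrable_lipschitz[OF _ lipcD(1)[OF \<phi>]] molli_close[OF \<sigma>(1) \<phi>])
    show "(LINT x|\<mu> t. \<phi> x) - (LINT x|\<mu> s. \<phi> x) \<le> time_modulus TYPE('n) B (t - s)"
      using 1 2[of t] 2[of s] st unfolding time_modulus_def \<sigma>_def[symmetric] by (simp add: algebra_simps)
  qed (use P st in auto)
qed

text \<open>The drift \<open>b\<close> of the reference curve \<open>\<mu>\<close> is Lipschitz in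
  space and moves in time with \<open>\<mu>\<close>; the drift \<open>\<beta>\<close> of
  \<open>\<nu>\<close> is controlled by its distance to \<open>b\<close>. The term
  \<open>K * d1\<close> in that distance is a feedback from the measures into the drift, to be
  closed by Gronwall, and \<open>\<eta>\<close> is the genuine error. In the application
  \<open>\<mu>\<close> is the limit curve.\<close>

locale fp_pair =
  fixes \<mu> \<nu> :: "real \<Rightarrow> (real^'n) measure" and b \<beta> :: "real \<Rightarrow> real^'n \<Rightarrow> real^'n" and B K \<eta> :: real
  assumes curves: "P1_curve \<mu>" "P1_curve \<nu>"
    and weak: "weak_fp b \<mu>" "weak_fp \<beta> \<nu>"
    and b_bound: "\<And>t x. 0 \<le> t \<Longrightarrow> norm (b t x) \<le> B"
    and b_lipschitz: "\<And>t x y. 0 \<le> t \<Longrightarrow> norm (b t x - b t y) \<le> K * norm (x - y)"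
    and b_time: "\<And>s t x. 0 \<le> s \<Longrightarrow> 0 \<le> t \<Longrightarrow> norm (b s x - b t x) \<le> K * d1 (\<mu> s) (\<mu> t)"
    and \<beta>_bound: "\<And>t x. 0 < t \<Longrightarrow> norm (\<beta> t x) \<le> B"
    and \<beta>_continuous: "\<And>t. 0 < t \<Longrightarrow> continuous_on UNIV (\<beta> t)"
    and \<beta>_close: "\<And>t x. 0 < t \<Longrightarrow> norm (\<beta> t x - b t x) \<le> \<eta> + K * d1 (\<mu> t) (\<nu> t)"
    and initial: "\<mu> 0 = \<nu> 0"
    and \<eta>_nonneg: "0 \<le> \<eta>"
begin

lemma mem_P1: "0 \<le> t \<Longrightarrow> \<mu> t \<in> P1" "0 \<le> t \<Longrightarrow> \<nu> t \<in> P1"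
  using curves by (auto simp: P1_curve_def)

lemma B_nonneg: "0 \<le> B"
  using b_bound[of 0 0] norm_ge_zero order_trans by blast

lemma K_nonneg: "0 \<le> K"
proof -
  have "0 \<le> K * norm (axis undefined 1 - 0 :: real^'n)" by (rule order_trans[OF norm_ge_zero b_lipschitz[of 0]]) simp
  then show ?thesis by simp
qed

lemma b_continuous: "0 \<le> t \<Longrightarrow> continuous_on UNIV (b t)"
  by (rule lipschitz_on_continuous_on[OF lipschitz_onI[of _ _ K]])
    (simp_all add: dist_norm b_lipschitz K_nonneg)

lemma modulus_\<mu>: "0 \<le> s \<Longrightarrow> s \<le> t \<Longrightarrow> d1 (\<mu> t) (\<mu> s) \<le> time_modulus TYPE('n) B (t - s)"
  by (rule weak_fp_time_modulus[OF weak(1) curves(1)]) (auto intro: b_continuous b_bound)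

lemma modulus_\<nu>: "0 \<le> s \<Longrightarrow> s \<le> t \<Longrightarrow> d1 (\<nu> t) (\<nu> s) \<le> time_modulus TYPE('n) B (t - s)"
  by (rule weak_fp_time_modulus[OF weak(2) curves(2)]) (auto intro: \<beta>_continuous \<beta>_bound)

definition lip_const :: "real \<Rightarrow> real"
  where "lip_const \<sigma> = molli_const TYPE('n) / \<sigma>\<^sup>2 + K + B * molli_const TYPE('n) / \<sigma>"

lemma lip_const_nonneg: "0 < \<sigma> \<Longrightarrow> 0 \<le> lip_const \<sigma>"
  unfolding lip_const_def
  by (intro add_nonneg_nonneg divide_nonneg_nonneg mult_nonneg_nonneg) (auto simp: kernel_const_nonneg K_nonneg B_nonneg)

context
  fixes \<sigma> :: real and \<phi> :: "real^'n \<Rightarrow> real" and t h :: real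
  assumes \<sigma>: "0 < \<sigma>" and \<phi>: "\<phi> \<in> lipc" and t: "0 \<le> t" and h: "0 < h"
begin

lemma generator_lip: "0 \<le> s \<Longrightarrow> (lip_const \<sigma>)-lipschitz_on UNIV (generator \<sigma> \<phi> (b s))"
  unfolding lip_const_def by (rule generator_lipschitz[OF \<sigma> \<phi>]) (auto intro: b_bound b_lipschitz)

lemma generator_time: "0 \<le> r \<Longrightarrow> \<bar>generator \<sigma> \<phi> (b r) x - generator \<sigma> \<phi> (b t) x\<bar> \<le> K * d1 (\<mu> r) (\<mu> t)"
  using generator_diff[OF \<sigma> \<phi>, of "b r" x "b t"] b_time[of r t x] t by linarith

lemma integrable_b: "0 \<le> r \<Longrightarrow> \<rho> \<in> P1 \<Longrightarrow> integrable \<rho> (generator \<sigma> \<phi> (b r))"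
  by (rule integrable_generator[OF \<sigma> \<phi>]) (auto intro: b_continuous b_bound)

text \<open>The mean value time \<open>r\<close> is replaced by \<open>t\<close> twice: in the
  measure, at the price of the Lipschitz constant of the generator, and in the drift, at the price
  of \<open>K\<close>.\<close>

lemma increment_\<mu>:
  "(LINT x|\<mu> (t + h). molli \<sigma> \<phi> x) - (LINT x|\<mu> t. molli \<sigma> \<phi> x)
    \<le> h * (LINT x|\<mu> t. generator \<sigma> \<phi> (b t) x) + h * ((lip_const \<sigma> + K) * time_modulus TYPE('n) B h)"
proof -
  have "t < t + h" using h by simp
  then obtain r where r: "t < r" "r < t + h"
    and eq: "(LINT x|\<mu> (t + h). molli \<sigma> \<phi> x) - (LINT x|\<mu> t. molli \<sigma> \<phi> x) = (t + h - t) * (LINT x|\<mu> r. generator \<sigma> \<phi> (b r) x)"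
    by (rule weak_fp_mean_value[OF weak(1) curves(1) \<sigma> \<phi> t])
  have r0: "0 \<le> r" using r t by simp
  let ?\<omega> = "time_modulus TYPE('n) B h"
  have d: "d1 (\<mu> r) (\<mu> t) \<le> ?\<omega>"
    using modulus_\<mu>[of t r] time_modulus_mono[OF B_nonneg, of "r - t" h, where 'n = 'n] r t by simp
  have "(LINT x|\<mu> r. generator \<sigma> \<phi> (b r) x) - (LINT x|\<mu> t. generator \<sigma> \<phi> (b r) x) \<le> lip_const \<sigma> * d1 (\<mu> r) (\<mu> t)"
    by (rule integral_diff_le_d1[OF mem_P1(1)[OF r0] mem_P1(1)[OF t] generator_lip[OF r0]])
  moreover have "\<bar>(LINT x|\<mu> t. generator \<sigma> \<phi> (b r) x) - (LINT x|\<mu> t. generator \<sigma> \<phi> (b t) x)\<bar> \<le> K * d1 (\<mu> r) (\<mu> t)"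
    by (intro abs_integral_diff_le mem_P1 t integrable_b r0 generator_time)
  moreover have "lip_const \<sigma> * d1 (\<mu> r) (\<mu> t) \<le> lip_const \<sigma> * ?\<omega>" "K * d1 (\<mu> r) (\<mu> t) \<le> K * ?\<omega>"
    using d lip_const_nonneg[OF \<sigma>] K_nonneg by (auto intro: mult_left_mono)
  ultimately have "(LINT x|\<mu> r. generator \<sigma> \<phi> (b r) x) \<le> (LINT x|\<mu> t. generator \<sigma> \<phi> (b t) x) + (lip_const \<sigma> + K) * ?\<omega>"
    unfolding distrib_right by linarith
  then have "h * (LINT x|\<mu> r. generator \<sigma> \<phi> (b r) x) \<le> h * ((LINT x|\<mu> t. generator \<sigma> \<phi> (b t) x) + (lip_const \<sigma> + K) * ?\<omega>)"
    using h by (intro mult_left_mono) auto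
  then show ?thesis using eq by (simp add: distrib_left)
qed

text \<open>Here \<open>\<beta>\<close> is also exchanged for \<open>b\<close>, so that both
  increments involve the same function \<open>generator \<sigma> \<phi> (b t)\<close>. In
  \<open>3 * K\<close>, two parts come from moving \<open>d1 (\<mu> r) (\<nu> r)\<close> back to
  time \<open>t\<close> and one from freezing the drift.\<close>

lemma increment_\<nu>:
  "(LINT x|\<nu> (t + h). molli \<sigma> \<phi> x) - (LINT x|\<nu> t. molli \<sigma> \<phi> x)
    \<ge> h * (LINT x|\<nu> t. generator \<sigma> \<phi> (b t) x) - h * (\<eta> + K * d1 (\<mu> t) (\<nu> t) + (lip_const \<sigma> + 3 * K) * time_modulus TYPE('n) B h)"
proof -
  have "t < t + h" using h by simp
  then obtain r where r: "t < r" "r < t + h"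
    and eq: "(LINT x|\<nu> (t + h). molli \<sigma> \<phi> x) - (LINT x|\<nu> t. molli \<sigma> \<phi> x) = (t + h - t) * (LINT x|\<nu> r. generator \<sigma> \<phi> (\<beta> r) x)"
    by (rule weak_fp_mean_value[OF weak(2) curves(2) \<sigma> \<phi> t])
  have r0: "0 \<le> r" and r1: "0 < r" using r t by auto
  let ?\<omega> = "time_modulus TYPE('n) B h"
  have d: "d1 (\<mu> r) (\<mu> t) \<le> ?\<omega>" "d1 (\<nu> r) (\<nu> t) \<le> ?\<omega>"
    using modulus_\<mu>[of t r] modulus_\<nu>[of t r] time_modulus_mono[OF B_nonneg, of "r - t" h, where 'n = 'n] r t
    by simp_all
  have dd: "d1 (\<mu> r) (\<nu> r) \<le> d1 (\<mu> t) (\<nu> t) + 2 * ?\<omega>"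
    using d1_triangle[OF mem_P1(1)[OF r0] mem_P1(1)[OF t] mem_P1(2)[OF r0]] d1_triangle[OF mem_P1(1)[OF t] mem_P1(2)[OF t] mem_P1(2)[OF r0]]
      d1_commute[OF mem_P1(2)[OF t] mem_P1(2)[OF r0]] d by linarith
  have "\<bar>(LINT x|\<nu> r. generator \<sigma> \<phi> (\<beta> r) x) - (LINT x|\<nu> r. generator \<sigma> \<phi> (b r) x)\<bar> \<le> \<eta> + K * d1 (\<mu> r) (\<nu> r)"
  proof (rule abs_integral_diff_le[OF mem_P1(2)[OF r0] _ integrable_b[OF r0 mem_P1(2)[OF r0]]])
    show "integrable (\<nu> r) (generator \<sigma> \<phi> (\<beta> r))"
      by (rule integrable_generator[OF \<sigma> \<phi> mem_P1(2)[OF r0] \<beta>_continuous[OF r1] \<beta>_bound[OF r1]])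
    show "\<bar>generator \<sigma> \<phi> (\<beta> r) x - generator \<sigma> \<phi> (b r) x\<bar> \<le> \<eta> + K * d1 (\<mu> r) (\<nu> r)" for x
      using generator_diff[OF \<sigma> \<phi>, of "\<beta> r" x "b r"] \<beta>_close[OF r1, of x] by linarith
  qed
  moreover have "\<bar>(LINT x|\<nu> r. generator \<sigma> \<phi> (b r) x) - (LINT x|\<nu> t. generator \<sigma> \<phi> (b r) x)\<bar> \<le> lip_const \<sigma> * d1 (\<nu> r) (\<nu> t)"
    by (rule abs_integral_diff_le_d1[OF mem_P1(2)[OF r0] mem_P1(2)[OF t] generator_lip[OF r0]])
  moreover have "\<bar>(LINT x|\<nu> t. generator \<sigma> \<phi> (b r) x) - (LINT x|\<nu> t. generator \<sigma> \<phi> (b t) x)\<bar> \<le> K * d1 (\<mu> r) (\<mu> t)"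
    by (intro abs_integral_diff_le mem_P1 t integrable_b r0 generator_time)
  moreover have "lip_const \<sigma> * d1 (\<nu> r) (\<nu> t) \<le> lip_const \<sigma> * ?\<omega>" "K * d1 (\<mu> r) (\<mu> t) \<le> K * ?\<omega>"
    "K * d1 (\<mu> r) (\<nu> r) \<le> K * (d1 (\<mu> t) (\<nu> t) + 2 * ?\<omega>)"
    using d dd lip_const_nonneg[OF \<sigma>] K_nonneg by (auto intro: mult_left_mono)
  moreover have "\<eta> + K * d1 (\<mu> t) (\<nu> t) + (lip_const \<sigma> + 3 * K) * ?\<omega> = \<eta> + K * (d1 (\<mu> t) (\<nu> t) + 2 * ?\<omega>) + lip_const \<sigma> * ?\<omega> + K * ?\<omega>"
    by (simp add: algebra_simps)
  ultimately have "(LINT x|\<nu> t. generator \<sigma> \<phi> (b t) x) - (\<eta> + K * d1 (\<mu> t) (\<nu> t) + (lip_const \<sigma> + 3 * K) * ?\<omega>)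
     \<le> (LINT x|\<nu> r. generator \<sigma> \<phi> (\<beta> r) x)"
    by linarith
  then have "h * ((LINT x|\<nu> t. generator \<sigma> \<phi> (b t) x) - (\<eta> + K * d1 (\<mu> t) (\<nu> t) + (lip_const \<sigma> + 3 * K) * ?\<omega>))
     \<le> h * (LINT x|\<nu> r. generator \<sigma> \<phi> (\<beta> r) x)"
    using h by (intro mult_left_mono) auto
  then show ?thesis using eq by (simp add: right_diff_distrib)
qed

end

definition step_error :: "real \<Rightarrow> real \<Rightarrow> real"
  where "step_error \<sigma> h = 2 * scheme_error TYPE('n) \<sigma> B h + (2 * lip_const \<sigma> + 4 * K) * time_modulus TYPE('n) B h"

lemma step_error_nonneg: "0 < \<sigma> \<Longrightarrow> 0 < h \<Longrightarrow> 0 \<le> step_error \<sigma> h"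
  unfolding step_error_def scheme_error_def time_modulus_def
  by (intro add_nonneg_nonneg divide_nonneg_nonneg mult_nonneg_nonneg)
    (auto simp: kernel_const_nonneg K_nonneg B_nonneg lip_const_nonneg)

text \<open>Up to errors, the integrals of \<open>molli \<sigma> \<phi>\<close> after the step are
  those of the mollified \<open>scheme\<close> before it. The normalised scheme lies again in
  \<open>lipc\<close>, but is a different function, so \<open>e\<close> has to bound the whole
  class. In \<open>1 + 2 * K * h\<close> one \<open>K\<close> is the expansion of the Euler map, the
  other the feedback, where \<open>d1 \<le> e + 2 * \<sigma>\<close>. Half of
  \<open>4 * K * \<sigma>\<close> is the commutator for the two measures, half is this
  \<open>2 * \<sigma>\<close>.\<close>

lemma step:
  assumes \<sigma>: "0 < \<sigma>" and t: "0 \<le> t" and h: "0 < h"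
    and e: "\<And>\<phi>. \<phi> \<in> lipc \<Longrightarrow> (LINT x|\<mu> t. molli \<sigma> \<phi> x) - (LINT x|\<nu> t. molli \<sigma> \<phi> x) \<le> e"
    and \<phi>: "\<phi> \<in> lipc"
  shows "(LINT x|\<mu> (t + h). molli \<sigma> \<phi> x) - (LINT x|\<nu> (t + h). molli \<sigma> \<phi> x)
    \<le> (1 + 2 * K * h) * e + h * (\<eta> + 4 * K * \<sigma> + step_error \<sigma> h)"
proof -
  have P: "\<mu> t \<in> P1" "\<nu> t \<in> P1" using mem_P1 t by auto
  have iM: "integrable \<rho> (molli \<sigma> \<psi>)" if "\<rho> \<in> P1" "\<psi> \<in> lipc" for \<rho> \<psi>
    using that(1) molli_lipschitz[OF \<sigma> that(2)] by (rule P1_integrable_lipschitz)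
  have close: "\<bar>(LINT x|\<rho>. molli \<sigma> \<psi> x) - (LINT x|\<rho>. \<psi> x)\<bar> \<le> \<sigma>" if "\<rho> \<in> P1" "\<psi> \<in> lipc" for \<rho> \<psi>
    by (intro abs_integral_diff_le that iM P1_integrable_lipschitz[OF that(1) lipcD(1)[OF that(2)]] molli_close[OF \<sigma> that(2)])
  have d: "d1 (\<mu> t) (\<nu> t) \<le> e + 2 * \<sigma>"
  proof (rule d1_le_of_lipc[OF P])
    show "(LINT x|\<mu> t. \<psi> x) - (LINT x|\<nu> t. \<psi> x) \<le> e + 2 * \<sigma>" if "\<psi> \<in> lipc" for \<psi>
      using close[OF P(1) that] close[OF P(2) that] e[OF that] by linarith
  qed
  define G where "G = generator \<sigma> \<phi> (b t)"
  define S where "S = scheme h (b t) \<phi>"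
  define S' where "S' = (\<lambda>x. inverse (1 + K * h) * S x)"
  define \<epsilon> where "\<epsilon> = h * (K * \<sigma> + scheme_error TYPE('n) \<sigma> B h)"
  have pos: "0 < 1 + K * h" using K_nonneg h by (simp add: add_pos_nonneg)
  have S': "S' \<in> lipc" unfolding S'_def S_def
    by (rule scheme_lipc[OF \<phi> h K_nonneg]) (auto intro: b_bound b_lipschitz t)
  have S: "molli \<sigma> S x = (1 + K * h) * molli \<sigma> S' x" for x
    using pos by (simp add: S'_def molli_cmult)
  have iS: "integrable \<rho> (molli \<sigma> S)" if "\<rho> \<in> P1" for \<rho>
    unfolding S[abs_def] by (intro integrable_mult_right iM that S')
  have iG: "integrable \<rho> G" if "\<rho> \<in> P1" for \<rho>
    unfolding G_def using integrable_b[OF \<sigma> \<phi> t h t that] .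
  have cons: "\<bar>(LINT x|\<rho>. molli \<sigma> \<phi> x + h * G x) - (LINT x|\<rho>. molli \<sigma> S x)\<bar> \<le> \<epsilon>" if "\<rho> \<in> P1" for \<rho>
    unfolding G_def S_def \<epsilon>_def
    by (intro abs_integral_diff_le that iS[unfolded S_def] Bochner_Integration.integrable_add iM \<phi>
        integrable_mult_right iG[unfolded G_def] scheme_consistent[OF \<sigma> \<phi> h] b_bound b_lipschitz t)
  have split: "(LINT x|\<rho>. molli \<sigma> \<phi> x + h * G x) = (LINT x|\<rho>. molli \<sigma> \<phi> x) + h * (LINT x|\<rho>. G x)" if "\<rho> \<in> P1" for \<rho>
    using iM[OF that \<phi>] iG[OF that] by simp
  have "(LINT x|\<mu> t. molli \<sigma> S x) - (LINT x|\<nu> t. molli \<sigma> S x)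
     = (1 + K * h) * ((LINT x|\<mu> t. molli \<sigma> S' x) - (LINT x|\<nu> t. molli \<sigma> S' x))"
    unfolding S by (simp add: right_diff_distrib)
  also have "\<dots> \<le> (1 + K * h) * e" using e[OF S'] pos by (intro mult_left_mono) auto
  finally have "(LINT x|\<mu> t. molli \<sigma> S x) - (LINT x|\<nu> t. molli \<sigma> S x) \<le> (1 + K * h) * e" .
  moreover have "h * (K * d1 (\<mu> t) (\<nu> t)) \<le> h * (K * (e + 2 * \<sigma>))"
    using d K_nonneg h by (intro mult_left_mono) auto
  moreover have "h * (\<eta> + K * d1 (\<mu> t) (\<nu> t) + (lip_const \<sigma> + 3 * K) * time_modulus TYPE('n) B h)
     = h * \<eta> + h * (K * d1 (\<mu> t) (\<nu> t)) + h * ((lip_const \<sigma> + 3 * K) * time_modulus TYPE('n) B h)"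
    by (simp add: distrib_left)
  moreover have "(1 + 2 * K * h) * e + h * (\<eta> + 4 * K * \<sigma> + step_error \<sigma> h) =
      (1 + K * h) * e + 2 * \<epsilon> + h * ((lip_const \<sigma> + K) * time_modulus TYPE('n) B h)
      + (h * \<eta> + h * (K * (e + 2 * \<sigma>)) + h * ((lip_const \<sigma> + 3 * K) * time_modulus TYPE('n) B h))"
    unfolding step_error_def \<epsilon>_def by (simp add: algebra_simps)
  ultimately show ?thesis
    using increment_\<mu>[OF \<sigma> \<phi> t h] increment_\<nu>[OF \<sigma> \<phi> t h] cons[OF P(1)] cons[OF P(2)] split[OF P(1)] split[OF P(2)]
    unfolding G_def by linarith
qed

text \<open>The induction covers all of \<open>lipc\<close> at once, since a step bounds one test
  function by another.\<close>

lemma iterate: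
  assumes \<sigma>: "0 < \<sigma>" and h: "0 < h"
  shows "\<phi> \<in> lipc \<Longrightarrow> (LINT x|\<mu> (real k * h). molli \<sigma> \<phi> x) - (LINT x|\<nu> (real k * h). molli \<sigma> \<phi> x)
    \<le> real k * h * (\<eta> + 4 * K * \<sigma> + step_error \<sigma> h) * (1 + 2 * K * h) ^ k"
proof (induction k arbitrary: \<phi>)
  case 0
  then show ?case by (simp add: initial)
next
  case (Suc k)
  let ?A = "\<eta> + 4 * K * \<sigma> + step_error \<sigma> h"
  have A: "0 \<le> ?A" using \<eta>_nonneg K_nonneg \<sigma> step_error_nonneg[OF \<sigma> h] by simp
  have Kh: "0 \<le> 2 * K * h" using K_nonneg h by simp
  have "(LINT x|\<mu> (real k * h + h). molli \<sigma> \<phi> x) - (LINT x|\<nu> (real k * h + h). molli \<sigma> \<phi> x)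
    \<le> (1 + 2 * K * h) * (real k * h * ?A * (1 + 2 * K * h) ^ k) + h * ?A"
    by (rule step[OF \<sigma> _ h Suc.IH Suc.prems]) (use h in auto)
  \<comment> \<open>Every new error is charged the full growth factor, which keeps the bound in
    closed form.\<close>
  also have "h * ?A \<le> h * ?A * (1 + 2 * K * h) ^ Suc k"
  proof -
    have "h * ?A * 1 \<le> h * ?A * (1 + 2 * K * h) ^ Suc k"
      using A h one_le_power[of "1 + 2 * K * h" "Suc k"] Kh by (intro mult_left_mono) auto
    then show ?thesis by simp
  qed
  also have "(1 + 2 * K * h) * (real k * h * ?A * (1 + 2 * K * h) ^ k) + h * ?A * (1 + 2 * K * h) ^ Suc k
     = real (Suc k) * h * ?A * (1 + 2 * K * h) ^ Suc k"
    by (simp add: algebra_simps)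
  finally show ?case by (simp add: algebra_simps)
qed

lemma stability:
  assumes T: "0 \<le> T"
  shows "d1 (\<mu> T) (\<nu> T) \<le> T * exp (2 * K * T) * \<eta>"
proof (cases "T = 0")
  case True
  then show ?thesis using initial mem_P1(2)[of 0] by (simp add: d1_self)
next
  case False
  then have T0: "0 < T" using T by simp
  define E where "E = exp (2 * K * T)"
  have P: "\<mu> T \<in> P1" "\<nu> T \<in> P1" using mem_P1 T by auto
  have \<sigma>bound: "d1 (\<mu> T) (\<nu> T) \<le> T * (\<eta> + 4 * K * \<sigma>) * E + 2 * \<sigma>" if \<sigma>: "0 < \<sigma>" for \<sigma>
  proof (rule d1_le_of_lipc[OF P])
    fix \<phi> :: "real^'n \<Rightarrow> real" assume \<phi>: "\<phi> \<in> lipc"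
    have bound: "(LINT x|\<mu> T. molli \<sigma> \<phi> x) - (LINT x|\<nu> T. molli \<sigma> \<phi> x)
        \<le> T * (\<eta> + 4 * K * \<sigma> + step_error \<sigma> (T * inverse (real (Suc n)))) * E" for n
    proof -
      \<comment> \<open>Exactly \<open>Suc n\<close> steps of this size reach \<open>T\<close>, and
        \<open>(1 + 2 * K * h) ^ Suc n\<close> stays below \<open>E\<close>.\<close>
      define h where "h = T * inverse (real (Suc n))"
      have h: "0 < h" "real (Suc n) * h = T" using T0 by (auto simp: h_def field_simps)
      have "0 \<le> 1 + 2 * K * h" using K_nonneg h by simp
      then have "(1 + 2 * K * h) ^ Suc n \<le> exp (2 * K * h) ^ Suc n"
        by (intro power_mono) auto
      also have "\<dots> = exp (real (Suc n) * (2 * K * h))" by (rule exp_of_nat_mult[symmetric])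
      also have "real (Suc n) * (2 * K * h) = 2 * K * (real (Suc n) * h)" by (simp only: mult.left_commute mult.assoc)
      also have "exp \<dots> = E" unfolding h(2) E_def ..
      finally have pw: "(1 + 2 * K * h) ^ Suc n \<le> E" .
      have "(LINT x|\<mu> T. molli \<sigma> \<phi> x) - (LINT x|\<nu> T. molli \<sigma> \<phi> x) \<le> T * (\<eta> + 4 * K * \<sigma> + step_error \<sigma> h) * (1 + 2 * K * h) ^ Suc n"
        using iterate[OF \<sigma> h(1) \<phi>, of "Suc n"] unfolding h(2) .
      also have "\<dots> \<le> T * (\<eta> + 4 * K * \<sigma> + step_error \<sigma> h) * E"
        using T0 \<eta>_nonneg K_nonneg \<sigma> step_error_nonneg[OF \<sigma> h(1)] by (intro mult_left_mono pw) auto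
      finally show ?thesis unfolding h_def .
    qed
    have "(\<lambda>n. T * inverse (real (Suc n))) \<longlonglongrightarrow> T * 0" by (intro tendsto_intros LIMSEQ_inverse_real_of_nat)
    then have hn: "(\<lambda>n. T * inverse (real (Suc n))) \<longlonglongrightarrow> 0" by simp
    \<comment> \<open>At fixed \<open>\<sigma>\<close> the step error is continuous in
      \<open>h\<close> and vanishes at 0, so the limit of fine steps retains
      \<open>\<eta> + 4 * K * \<sigma>\<close>.\<close>
    have "continuous_on UNIV (step_error \<sigma>)"
      unfolding step_error_def[abs_def] scheme_error_def time_modulus_def by (intro continuous_intros)
    then have "(\<lambda>n. step_error \<sigma> (T * inverse (real (Suc n)))) \<longlonglongrightarrow> step_error \<sigma> 0"
      using hn by (intro continuous_on_tendsto_compose[of UNIV "step_error \<sigma>"]) auto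
    then have "(\<lambda>n. step_error \<sigma> (T * inverse (real (Suc n)))) \<longlonglongrightarrow> 0"
      by (simp add: step_error_def scheme_error_def time_modulus_def)
    then have "(\<lambda>n. T * (\<eta> + 4 * K * \<sigma> + step_error \<sigma> (T * inverse (real (Suc n)))) * E) \<longlonglongrightarrow> T * (\<eta> + 4 * K * \<sigma> + 0) * E"
      by (intro tendsto_intros)
    then have "(LINT x|\<mu> T. molli \<sigma> \<phi> x) - (LINT x|\<nu> T. molli \<sigma> \<phi> x) \<le> T * (\<eta> + 4 * K * \<sigma> + 0) * E"
      by (rule LIMSEQ_le_const) (use bound in blast)
    moreover have close: "\<bar>(LINT x|\<rho>. molli \<sigma> \<phi> x) - (LINT x|\<rho>. \<phi> x)\<bar> \<le> \<sigma>" if "\<rho> \<in> P1" for \<rho>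
      by (intro abs_integral_diff_le that P1_integrable_lipschitz[OF that lipcD(1)[OF \<phi>]]
          P1_integrable_lipschitz[OF that molli_lipschitz[OF \<sigma> \<phi>]] molli_close[OF \<sigma> \<phi>])
    ultimately show "(LINT x|\<mu> T. \<phi> x) - (LINT x|\<nu> T. \<phi> x) \<le> T * (\<eta> + 4 * K * \<sigma>) * E + 2 * \<sigma>"
      using close[OF P(1)] close[OF P(2)] by simp
  qed
  \<comment> \<open>The limit \<open>\<sigma> \<rightarrow> 0\<close> removes both the commutator
    and the cost of mollifying the test function.\<close>
  have "((\<lambda>\<sigma>. T * (\<eta> + 4 * K * \<sigma>) * E + 2 * \<sigma>) \<longlongrightarrow> T * (\<eta> + 4 * K * 0) * E + 2 * 0) (at_right 0)"
    by (intro tendsto_intros)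
  then have "d1 (\<mu> T) (\<nu> T) \<le> T * (\<eta> + 4 * K * 0) * E + 2 * 0"
    by (rule tendsto_lowerbound) (auto simp: eventually_at_filter \<sigma>bound)
  then show ?thesis by (simp add: E_def algebra_simps)
qed

end

section \<open>The Hamiltonian and the maximum principle\<close>

lemma C_holder_imp_C_class:
  assumes "0 < \<alpha>"
  shows "C_holder k \<alpha> f \<Longrightarrow> C_class k f"
proof (induction k arbitrary: f)
  case 0
  have "isCont f x" for x
  proof -
    obtain K where K: "\<And>y z. y \<in> cball 0 (norm x + 1) \<Longrightarrow> z \<in> cball 0 (norm x + 1) \<Longrightarrow> \<bar>f y - f z\<bar> \<le> K * dist y z powr \<alpha>"
      using 0 by (fastforce simp: locally_holder_def)
    have "((\<lambda>y. K * dist y x powr \<alpha>) \<longlongrightarrow> 0) (at x)"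
    proof -
      have "((\<lambda>y. dist y x) \<longlongrightarrow> dist x x) (at x)" by (intro tendsto_intros)
      then have "((\<lambda>y. dist y x powr \<alpha>) \<longlongrightarrow> 0 powr \<alpha>) (at x)"
        using assms by (intro tendsto_powr') auto
      then show ?thesis using tendsto_mult_left[of _ "0 powr \<alpha>" _ K] by fastforce
    qed
    moreover have "\<forall>\<^sub>F y in at x. norm (f y - f x) \<le> K * dist y x powr \<alpha>"
    proof -
      have "\<forall>\<^sub>F y in at x. dist y x < 1" by (auto simp: eventually_at intro: exI[of _ 1])
      then show ?thesis
      proof eventually_elim
        case (elim y)
        then have "norm y \<le> norm x + 1" using norm_triangle_sub[of y x] by (simp add: dist_norm)
        then show ?case using K[of y x] by simp
      qed
    qed
    ultimately have "((\<lambda>y. f y - f x) \<longlongrightarrow> 0) (at x)" by (rule Lim_null_comparison[rotated])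
    then show ?thesis by (simp add: isCont_def LIM_zero_iff)
  qed
  then show ?case by (simp add: continuous_at_imp_continuous_on)
qed auto

lemma second_order_upper:
  fixes f :: "real^'n \<Rightarrow> real"
  assumes f: "C_class (Suc (Suc 0)) f" and C: "\<And>x v. v \<bullet> (hessian f x *v v) \<le> C * (v \<bullet> v)"
  shows "f (p + v) \<le> f p + grad f p \<bullet> v + C / 2 * (v \<bullet> v)"
proof -
  note d = C_class_2_grad[OF f]
  define g' where "g' s = pd v f (p + s *\<^sub>R v)" for s
  define g'' where "g'' s = pd v (pd v f) (p + s *\<^sub>R v)" for s
  have pdf: "pd v f differentiable (at x)" for x
    unfolding pd_grad_inner[OF d(1), symmetric] using d(2) by (intro differentiable_inner) auto
  have g: "((\<lambda>s. f (p + s *\<^sub>R v)) has_real_derivative g' s) (at s)" for s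
    unfolding g'_def by (rule has_real_derivative_along_line[OF d(1)])
  have g1: "(g' has_real_derivative g'' s) (at s)" for s
    unfolding g'_def[abs_def] g''_def by (rule has_real_derivative_along_line[OF pdf])
  have le: "g'' s \<le> C * (v \<bullet> v)" for s
    using C[of v "p + s *\<^sub>R v"]
    unfolding inner_commute[of v "_ *v v"] hessian_inner[OF d(2)] pd_grad_inner[OF d(1)] g''_def .
  define k where "k s = f (p + s *\<^sub>R v) - f p - s * g' 0 - C * (v \<bullet> v) / 2 * s\<^sup>2" for s
  have k': "(k has_real_derivative (g' s - g' 0 - C * (v \<bullet> v) * s)) (at s)" for s
    unfolding k_def[abs_def] by (auto intro!: derivative_eq_intros g)
  have "g' s - g' 0 - C * (v \<bullet> v) * s \<le> 0" if s: "0 \<le> s" for s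
  proof (cases "s = 0")
    case False
    then obtain z where z: "g' s - g' 0 = (s - 0) * g'' z"
      using MVT2[of 0 s g' g''] g1 s by fastforce
    have "s * g'' z \<le> s * (C * (v \<bullet> v))" using le s by (intro mult_left_mono) auto
    then show ?thesis using z by (simp add: mult.commute)
  qed simp
  note nonpos = this
  have "k 1 \<le> k 0"
  proof (rule DERIV_nonpos_imp_nonincreasing[of 0 1 k])
    show "\<exists>y. (k has_real_derivative y) (at s) \<and> y \<le> 0" if "0 \<le> s" "s \<le> 1" for s
      using k'[of s] nonpos[OF that(1)] by blast
  qed simp
  then show ?thesis by (simp add: k_def g'_def grad_inner[OF d(1)] algebra_simps)
qed

lemma second_order_lower:
  fixes f :: "real^'n \<Rightarrow> real"
  assumes f: "C_class (Suc (Suc 0)) f" and C: "\<And>x v. 0 \<le> v \<bullet> (hessian f x *v v)"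
  shows "f p + grad f p \<bullet> v \<le> f (p + v)"
proof -
  note d = C_class_2_grad[OF f]
  have pdf: "pd v f differentiable (at x)" for x
    unfolding pd_grad_inner[OF d(1), symmetric] using d(2) by (intro differentiable_inner) auto
  obtain s where s: "0 < s" "s < 1" "f (p + 1 *\<^sub>R v) - f (p + 0 *\<^sub>R v) = (1 - 0) * pd v f (p + s *\<^sub>R v)"
    using MVT2[of 0 1 "\<lambda>s. f (p + s *\<^sub>R v)" "\<lambda>s. pd v f (p + s *\<^sub>R v)"]
      has_real_derivative_along_line[OF d(1)] by auto
  obtain z where z: "0 < z" "z < s" "pd v f (p + s *\<^sub>R v) - pd v f (p + 0 *\<^sub>R v) = (s - 0) * pd v (pd v f) (p + z *\<^sub>R v)"
    using MVT2[of 0 s "\<lambda>s. pd v f (p + s *\<^sub>R v)" "\<lambda>s. pd v (pd v f) (p + s *\<^sub>R v)"]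
      has_real_derivative_along_line[OF pdf] s by auto
  have "0 \<le> pd v (pd v f) (p + z *\<^sub>R v)"
    using C[of v "p + z *\<^sub>R v"]
    unfolding inner_commute[of v "_ *v v"] hessian_inner[OF d(2)] pd_grad_inner[OF d(1)] .
  then have "0 \<le> s * pd v (pd v f) (p + z *\<^sub>R v)" using s by simp
  then show ?thesis using s z by (simp add: grad_inner[OF d(1)])
qed

text \<open>The Baillon--Haddad argument; it avoids the symmetry of the Hessian, whose operator norm
  is not controlled by its quadratic form otherwise.\<close>

lemma grad_lipschitz_of_hessian:
  fixes f :: "real^'n \<Rightarrow> real"
  assumes f: "C_class (Suc (Suc 0)) f" and C0: "0 < C"
    and C: "\<And>x v. 0 \<le> v \<bullet> (hessian f x *v v)" "\<And>x v. v \<bullet> (hessian f x *v v) \<le> C * (v \<bullet> v)"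
  shows "norm (grad f p - grad f q) \<le> C * norm (p - q)"
proof -
  have *: "f p - grad f p \<bullet> p \<le> f q - grad f p \<bullet> q - (norm (grad f q - grad f p))\<^sup>2 / (2 * C)" for p q
  proof -
    define d where "d = grad f q - grad f p"
    \<comment> \<open>The minimiser of the quadratic upper bound
      \<open>d \<bullet> v + C / 2 * (v \<bullet> v)\<close>.\<close>
    define v where "v = - (inverse C) *\<^sub>R d"
    have "f p + grad f p \<bullet> (q + v - p) \<le> f (q + v)"
      using second_order_lower[OF f C(1), of p "q + v - p"] by simp
    also have "\<dots> \<le> f q + grad f q \<bullet> v + C / 2 * (v \<bullet> v)" by (rule second_order_upper[OF f C(2)])
    finally have "f p - grad f p \<bullet> p \<le> f q - grad f p \<bullet> q + d \<bullet> v + C / 2 * (v \<bullet> v)"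
      by (simp add: d_def inner_add_right inner_diff_right inner_diff_left)
    moreover have "d \<bullet> v + C / 2 * (v \<bullet> v) = - ((norm d)\<^sup>2 / (2 * C))"
      using C0 by (simp add: v_def power2_norm_eq_inner field_simps)
    ultimately show ?thesis by (simp add: d_def)
  qed
  define d where "d = grad f p - grad f q"
  \<comment> \<open>Adding the two instances of the inequality, for \<open>(p, q)\<close> and
    \<open>(q, p)\<close>, gives co-coercivity of the gradient.\<close>
  have "(norm d)\<^sup>2 / C = 2 * ((norm d)\<^sup>2 / (2 * C))" by simp
  also have "\<dots> \<le> d \<bullet> (p - q)"
    using *[of p q] *[of q p] by (simp add: d_def norm_minus_commute inner_diff_left inner_diff_right inner_commute)
  also have "\<dots> \<le> norm d * norm (p - q)" by (rule norm_cauchy_schwarz)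
  finally have "norm d * norm d \<le> norm d * (C * norm (p - q))" using C0 by (simp add: power2_eq_square field_simps)
  then show ?thesis unfolding d_def[symmetric] by (cases "norm d = 0") (use C0 in \<open>auto simp: mult_le_cancel_left\<close>)
qed

lemma lipschitz_of_grad_bound:
  fixes f :: "'a::euclidean_space \<Rightarrow> real"
  assumes "\<And>x. f differentiable (at x)" "\<And>s. 0 \<le> s \<Longrightarrow> s \<le> 1 \<Longrightarrow> norm (grad f (p + s *\<^sub>R (q - p))) \<le> C"
  shows "\<bar>f q - f p\<bar> \<le> C * norm (q - p)"
proof -
  obtain s where s: "0 < s" "s < 1" "f (p + 1 *\<^sub>R (q - p)) - f (p + 0 *\<^sub>R (q - p)) = (1 - 0) * pd (q - p) f (p + s *\<^sub>R (q - p))"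
    using MVT2[of 0 1 "\<lambda>s. f (p + s *\<^sub>R (q - p))" "\<lambda>s. pd (q - p) f (p + s *\<^sub>R (q - p))"]
      has_real_derivative_along_line[OF assms(1)] by auto
  have "\<bar>f q - f p\<bar> = \<bar>grad f (p + s *\<^sub>R (q - p)) \<bullet> (q - p)\<bar>" using s by (simp add: grad_inner[OF assms(1)])
  also have "\<dots> \<le> norm (grad f (p + s *\<^sub>R (q - p))) * norm (q - p)" by (rule Cauchy_Schwarz_ineq2)
  also have "\<dots> \<le> C * norm (q - p)" using assms(2)[of s] s by (intro mult_right_mono) auto
  finally show ?thesis .
qed

context mfg_data
begin

lemma F_diff: "m \<in> P1 \<Longrightarrow> (\<lambda>z. F z m) differentiable (at x)"
  using F_regular[of m] by (simp add: numeral_2_eq_2)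

lemma F_lip: "m \<in> P1 \<Longrightarrow> L-lipschitz_on UNIV (\<lambda>z. F z m)"
  using F_lipschitz[of m m] L by (intro lipschitz_onI) (auto simp: d1_self dist_norm)

lemma norm_DF: "m \<in> P1 \<Longrightarrow> norm (grad (\<lambda>z. F z m) x) \<le> L"
  using F_lip F_diff by (rule norm_grad_le_lipschitz)

lemma H_C2: "C_class (Suc (Suc 0)) (\<lambda>(p, x). H p x)"
  using C_holder_imp_C_class[OF \<alpha>(1) H_regular] by (simp only: numeral_2_eq_2)

lemma H_compose_C2: "C_class (Suc (Suc 0)) (\<lambda>q. H q x)" "C_class (Suc (Suc 0)) (\<lambda>y. H p y)"
proof -
  have "C_class (Suc (Suc 0)) (\<lambda>q. (q, x) \<bullet> j)" for j :: "(real^'n) \<times> (real^'n)"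
    unfolding inner_prod_def fst_conv snd_conv
    by (rule C_class_add[OF C_class_linear[OF bounded_linear_inner_left] C_class_const])
  from C_class_compose_euclidean[OF H_C2 this] show "C_class (Suc (Suc 0)) (\<lambda>q. H q x)" by (simp del: C_class.simps)
  have "C_class (Suc (Suc 0)) (\<lambda>y. (p, y) \<bullet> j)" for j :: "(real^'n) \<times> (real^'n)"
    unfolding inner_prod_def fst_conv snd_conv
    by (rule C_class_add[OF C_class_const C_class_linear[OF bounded_linear_inner_left]])
  from C_class_compose_euclidean[OF H_C2 this] show "C_class (Suc (Suc 0)) (\<lambda>y. H p y)" by (simp del: C_class.simps)
qed

text \<open>Writing \<open>Dp H\<close> as a derivative of the joint function
  \<open>(p, x) \<mapsto> H p x\<close> makes the chain rule available when both arguments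
  move.\<close>

lemma Dp_inner: "Dp H p x \<bullet> v = pd (v, 0) (\<lambda>(p, x). H p x) (p, x)"
proof -
  have d: "(\<lambda>(p, x). H p x) differentiable (at z)" for z
    using H_C2 unfolding C_class_Suc_pd by blast
  have "((\<lambda>q. (q, x)) has_derivative (\<lambda>h. (h, 0))) (at p)" by (auto intro!: derivative_eq_intros)
  moreover have "((\<lambda>(p, x). H p x) has_derivative frechet_derivative (\<lambda>(p, x). H p x) (at (p, x))) (at (p, x))"
    using d by (simp add: frechet_derivative_works)
  ultimately have D: "((\<lambda>q. (\<lambda>(p, x). H p x) (q, x)) has_derivative (\<lambda>h. frechet_derivative (\<lambda>(p, x). H p x) (at (p, x)) (h, 0))) (at p)"
    by (rule has_derivative_compose)
  have "(\<lambda>q. H q x) differentiable (at p)" using H_compose_C2(1) by simp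
  from grad_inner[OF this] show ?thesis
    using has_derivative_pd[OF D, of v] by (simp add: pd_def)
qed

lemma Dp_compose_C1:
  assumes "\<And>i. i \<in> Basis \<Longrightarrow> C_class (Suc 0) (\<lambda>y. G y \<bullet> i)" "i \<in> Basis"
  shows "C_class (Suc 0) (\<lambda>y. Dp H (G y) y \<bullet> i)"
proof -
  have "(i, 0) \<in> (Basis :: ((real^'n) \<times> (real^'n)) set)" using assms(2) by (simp add: Basis_prod_def)
  then have "C_class (Suc 0) (pd (i, 0) (\<lambda>(p, x). H p x))"
    using H_C2 by (subst (asm) C_class_Suc_pd) blast
  moreover have "C_class (Suc 0) (\<lambda>y. (G y, y) \<bullet> j)" if "j \<in> Basis" for j
  proof -
    have "C_class (Suc 0) (\<lambda>y. \<Sum>i\<in>Basis. (fst j \<bullet> i) * (G y \<bullet> i))"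
      using assms(1) by (intro C_class_sum C_class_mult C_class_const)
    moreover have "(\<lambda>y. \<Sum>i\<in>Basis. (fst j \<bullet> i) * (G y \<bullet> i)) = (\<lambda>y. G y \<bullet> fst j)"
      by (rule ext, subst (3) euclidean_inner) (simp add: mult.commute)
    ultimately have "C_class (Suc 0) (\<lambda>y. G y \<bullet> fst j)" by metis
    then show ?thesis unfolding inner_prod_def fst_conv snd_conv
      by (rule C_class_add[OF _ C_class_linear[OF bounded_linear_inner_left]])
  qed
  ultimately show ?thesis unfolding Dp_inner by (rule C_class_compose_euclidean)
qed

lemma Dp_lipschitz_p: "norm (Dp H p x - Dp H q x) \<le> Co * norm (p - q)"
proof (rule grad_lipschitz_of_hessian[OF H_compose_C2(1)])
  show "0 < Co" using Co by simp
  show "v \<bullet> (Dpp H p x *v v) \<le> Co * (v \<bullet> v)" for p v by (rule H_pp(2))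
  show "0 \<le> v \<bullet> (Dpp H p x *v v)" for p v
    using Co by (intro order_trans[OF _ H_pp(1)]) auto
qed

lemma Dp_lipschitz_x: "norm (Dp H p x - Dp H p y) \<le> Co * (1 + norm p) * norm (x - y)"
proof (rule differentiable_bound[of UNIV])
  fix z :: "real^'n"
  have "(\<lambda>y. Dp H p y \<bullet> i) differentiable (at z)" if "i \<in> Basis" for i
    using Dp_compose_C1[OF C_class_const that] unfolding C_class_Suc_pd by blast
  then have "(\<lambda>y. Dp H p y) differentiable (at z)"
    by (rule differentiable_componentwise)
  then show "((\<lambda>y. Dp H p y) has_derivative (\<lambda>h. Dpx H p z *v h)) (at z within UNIV)"
    by (simp add: jacobian_works)
  have "onorm ((*v) (Dpx H p z)) \<le> Co * (1 + norm p)"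
    using H_x_px[of p z] norm_ge_zero[of "Dx H p z"] unfolding opnorm_def by linarith
  then show "onorm (\<lambda>h. Dpx H p z *v h) \<le> Co * (1 + norm p)" by simp
qed auto

text \<open>Convexity gives \<open>H p x + Dp H p x \<bullet> v \<le> H (p + v) x\<close>. With
  \<open>v\<close> along \<open>Dp H p x\<close> and of length \<open>1 + norm p\<close>, the
  quadratic bounds on \<open>H\<close> yield linear growth. The 6 is 4 from squaring
  \<open>2 * (1 + norm p)\<close> plus 2 from the additive constants.\<close>

lemma norm_Dp: "norm (Dp H p x) \<le> 6 * Co * (1 + norm p)"
proof (cases "Dp H p x = 0")
  case False
  define D where "D = Dp H p x"
  define v where "v = ((1 + norm p) / norm D) *\<^sub>R D"
  have D: "0 < norm D" using False by (simp add: D_def)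
  have nv: "norm v = 1 + norm p" using D by (simp add: v_def)
  have "norm D * (1 + norm p) = D \<bullet> v"
    using D by (simp add: v_def power2_norm_eq_inner[symmetric] power2_eq_square)
  also have "H p x + \<dots> \<le> H (p + v) x"
    unfolding D_def using Co by (intro second_order_lower[OF H_compose_C2(1)] order_trans[OF _ H_pp(1)]) auto
  also have "\<dots> \<le> Co * (1 + (norm (p + v))\<^sup>2)" by (rule H_bounds(2))
  also have "\<dots> \<le> Co * (1 + (2 * (1 + norm p))\<^sup>2)"
    using norm_triangle_ineq[of p v] nv Co by (intro mult_left_mono add_left_mono power_mono) auto
  finally have "norm D * (1 + norm p) \<le> Co * (1 + (2 * (1 + norm p))\<^sup>2) + Co" using H_bounds(1)[of p x] by simp
  also have "\<dots> \<le> 6 * Co * (1 + norm p) * (1 + norm p)"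
  proof -
    have "1 * 1 \<le> (1 + norm p) * (1 + norm p)" by (intro mult_mono) auto
    then have "Co * (2 * 1) \<le> Co * (2 * ((1 + norm p) * (1 + norm p)))" using Co by (intro mult_left_mono) auto
    then show ?thesis by (simp add: power2_eq_square algebra_simps)
  qed
  finally have "norm D \<le> 6 * Co * (1 + norm p)" by (rule mult_right_le_imp_le) (simp add: add_pos_nonneg)
  then show ?thesis by (simp add: D_def)
qed (use Co in simp)

lemma H_lipschitz_p:
  assumes "norm p \<le> K" "norm q \<le> K"
  shows "\<bar>H q x - H p x\<bar> \<le> 6 * Co * (1 + K) * norm (q - p)"
proof (rule lipschitz_of_grad_bound)
  show "(\<lambda>q. H q x) differentiable (at z)" for z using H_compose_C2(1) by simp
  fix s :: real assume s: "0 \<le> s" "s \<le> 1"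
  have "p + s *\<^sub>R (q - p) = (1 - s) *\<^sub>R p + s *\<^sub>R q" by (simp add: algebra_simps)
  also have "norm \<dots> \<le> (1 - s) * norm p + s * norm q"
    using norm_triangle_ineq[of "(1 - s) *\<^sub>R p" "s *\<^sub>R q"] s by simp
  also have "\<dots> \<le> (1 - s) * K + s * K" using s assms by (intro add_mono mult_left_mono) auto
  finally have "norm (p + s *\<^sub>R (q - p)) \<le> K" by (simp add: algebra_simps)
  then have "6 * Co * (1 + norm (p + s *\<^sub>R (q - p))) \<le> 6 * Co * (1 + K)" using Co by (intro mult_left_mono) auto
  then show "norm (Dp H (p + s *\<^sub>R (q - p)) x) \<le> 6 * Co * (1 + K)" using norm_Dp order_trans by blast
qed

lemma H_lipschitz_x: "\<bar>H p y - H p x\<bar> \<le> Co * (1 + norm p) * norm (y - x)"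
proof (rule lipschitz_of_grad_bound)
  show "(\<lambda>y. H p y) differentiable (at z)" for z using H_compose_C2(2) by simp
  fix s :: real
  have "0 \<le> opnorm (Dpx H p (x + s *\<^sub>R (y - x)))"
    unfolding opnorm_def by (rule onorm_pos_le) (simp add: matrix_vector_mul_bounded_linear)
  then show "norm (Dx H p (x + s *\<^sub>R (y - x))) \<le> Co * (1 + norm p)"
    using H_x_px[of p "x + s *\<^sub>R (y - x)"] by linarith
qed

end

section \<open>Touching from above and a smoothed cone\<close>

lemma has_real_derivative_right_le:
  fixes g :: "real \<Rightarrow> real"
  assumes g: "(g has_real_derivative D) (at t within {0..})" and t: "0 \<le> t"
    and le: "\<And>s. t \<le> s \<Longrightarrow> g s \<le> g t + b * (s - t)"
  shows "D \<le> b"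
proof -
  have "(g has_real_derivative D) (at t within {t<..})"
    using g by (rule has_field_derivative_subset) (use t in auto)
  then have "((\<lambda>s. (g s - g t) / (s - t)) \<longlongrightarrow> D) (at_right t)"
    by (simp add: has_field_derivative_iff)
  moreover have "\<forall>\<^sub>F s in at_right t. (g s - g t) / (s - t) \<le> b"
    using le by (auto simp: eventually_at_filter field_simps)
  ultimately show ?thesis by (rule tendsto_upperbound) simp
qed

text \<open>Subtracting the parabola leaves a function with a maximum at 0. If its second derivative
  were positive there, its first derivative would be positive to the right and the function would
  increase.\<close>

lemma touching_from_above:
  fixes g g' :: "real \<Rightarrow> real"
  assumes g: "\<And>s. (g has_real_derivative g' s) (at s)" and g': "(g' has_real_derivative g'') (at 0)"
    and le: "\<And>s. g s \<le> g 0 + c * s + k / 2 * s\<^sup>2"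
  shows "g' 0 = c" "g'' \<le> k"
proof -
  define f where "f s = g s - c * s - k / 2 * s\<^sup>2" for s
  define f' where "f' s = g' s - c - k * s" for s
  have f: "(f has_real_derivative f' s) (at s)" for s
    unfolding f_def[abs_def] f'_def by (auto intro!: derivative_eq_intros g)
  have f': "(f' has_real_derivative g'' - k) (at 0)"
    unfolding f'_def[abs_def] by (auto intro!: derivative_eq_intros g')
  have mx: "f s \<le> f 0" for s using le[of s] by (simp add: f_def)
  have 0: "f' 0 = 0" using DERIV_local_max[OF f, of 1 0] mx by simp
  then show "g' 0 = c" by (simp add: f'_def)
  show "g'' \<le> k"
  proof (rule ccontr)
    assume "\<not> g'' \<le> k"
    then obtain d where d: "0 < d" "\<And>h. 0 < h \<Longrightarrow> h < d \<Longrightarrow> f' 0 < f' (0 + h)"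
      using DERIV_pos_inc_right[OF f'] by auto
    obtain z where z: "0 < z" "z < d / 2" "f (d / 2) - f 0 = (d / 2 - 0) * f' z"
      using MVT2[of 0 "d / 2" f f'] f d(1) by auto
    have "0 < f' z" using d(2)[of z] z 0 by simp
    then have "0 < (d / 2 - 0) * f' z" using d by simp
    then show False using z(3) mx[of "d / 2"] by linarith
  qed
qed

text \<open>The sum under the root is \<open>q\<^sup>2 + 2 * q * e \<le> (q + e)\<^sup>2\<close>.
  This one-sided expansion, with slope of norm at most 1 and curvature \<open>1 / \<delta>\<close>,
  contains what the comparison uses of the cone near the contact point.\<close>

lemma sqrt_barrier_upper:
  fixes y v :: "'a::real_inner"
  assumes \<delta>: "0 < \<delta>"
  shows "sqrt (\<delta>\<^sup>2 + (norm (y + v))\<^sup>2) \<le> sqrt (\<delta>\<^sup>2 + (norm y)\<^sup>2) + (y /\<^sub>R sqrt (\<delta>\<^sup>2 + (norm y)\<^sup>2)) \<bullet> v + (norm v)\<^sup>2 / (2 * \<delta>)"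
proof -
  define q where "q = sqrt (\<delta>\<^sup>2 + (norm y)\<^sup>2)"
  have q: "\<delta> \<le> q" using \<delta> by (simp add: q_def real_le_rsqrt)
  have q2: "q\<^sup>2 = \<delta>\<^sup>2 + (norm y)\<^sup>2" by (simp add: q_def)
  define e where "e = (y \<bullet> v) / q + (norm v)\<^sup>2 / (2 * q)"
  have "\<delta>\<^sup>2 + (norm (y + v))\<^sup>2 = q\<^sup>2 + 2 * q * e"
    using q \<delta> by (simp add: q2 e_def power2_norm_eq_inner inner_add_left inner_add_right inner_commute field_simps)
  also have "\<dots> \<le> (q + e)\<^sup>2" by (simp add: power2_sum)
  finally have "sqrt (\<delta>\<^sup>2 + (norm (y + v))\<^sup>2) \<le> \<bar>q + e\<bar>"
    using real_sqrt_le_mono by fastforce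
  also have "\<bar>q + e\<bar> = q + e"
  proof -
    have "0 \<le> \<delta>\<^sup>2 + (norm (y + v))\<^sup>2" by simp
    then have "0 \<le> q\<^sup>2 + 2 * q * e" using \<open>\<delta>\<^sup>2 + (norm (y + v))\<^sup>2 = q\<^sup>2 + 2 * q * e\<close> by simp
    then have "0 \<le> q * (q + 2 * e)" by (simp add: power2_eq_square algebra_simps)
    then have "0 \<le> q + 2 * e" using q \<delta> by (simp add: zero_le_mult_iff)
    then show ?thesis using q \<delta> by simp
  qed
  also have "\<dots> \<le> q + (y \<bullet> v) / q + (norm v)\<^sup>2 / (2 * \<delta>)"
    unfolding e_def using q \<delta> by (simp add: frac_le)
  also have "(y \<bullet> v) / q = (y /\<^sub>R q) \<bullet> v" by (simp add: divide_inverse)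
  finally show ?thesis unfolding q_def .
qed

lemma C21_on_slice:
  fixes u :: "real^'n \<Rightarrow> real \<Rightarrow> real"
  assumes "C21_on T u"
  shows "t \<in> T \<Longrightarrow> C_class (Suc (Suc 0)) (\<lambda>y. u y t)"
    and "t \<in> T \<Longrightarrow> ((\<lambda>s. u x s) has_real_derivative dt_on T u x t) (at t within T)"
    and "continuous_on T (\<lambda>t. grad (\<lambda>y. u y t) x)"
    and "continuous_on T (\<lambda>t. laplacian (\<lambda>y. u y t) x)"
    and "continuous_on T (\<lambda>t. dt_on T u x t)"
    and "continuous_on T (\<lambda>t. u x t)"
proof -
  have slice: "continuous_on T (\<lambda>t. f x t)" if "continuous_on (UNIV \<times> T) (\<lambda>(x, t). f x t)"
    for f :: "real^'n \<Rightarrow> real \<Rightarrow> 'c::topological_space"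
  proof -
    have "continuous_on T (\<lambda>t. (x, t))" by (intro continuous_intros)
    from continuous_on_compose2[OF that this] show ?thesis by auto
  qed
  have h: "continuous_on T (\<lambda>t. hessian (\<lambda>y. u y t) x)"
    using assms by (intro slice) (simp add: C21_on_def)
  show "continuous_on T (\<lambda>t. grad (\<lambda>y. u y t) x)" "continuous_on T (\<lambda>t. dt_on T u x t)" "continuous_on T (\<lambda>t. u x t)"
    using assms by (auto intro!: slice simp: C21_on_def)
  show "continuous_on T (\<lambda>t. laplacian (\<lambda>y. u y t) x)"
    unfolding laplacian_def trace_def using h by (intro continuous_intros)
  show "C_class (Suc (Suc 0)) (\<lambda>y. u y t)" if t: "t \<in> T"
  proof (rule C_class_2I)
    show "(\<lambda>y. u y t) differentiable (at x)" "grad (\<lambda>y. u y t) differentiable (at x)" for x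
      using assms t by (auto simp: C21_on_def)
    have c: "continuous_on (UNIV \<times> T) (\<lambda>(x, t). hessian (\<lambda>y. u y t) x)" using assms by (simp add: C21_on_def)
    have "continuous_on UNIV (\<lambda>x::real^'n. (x, t))" by (intro continuous_intros)
    from continuous_on_compose2[OF c this] t show "continuous_on UNIV (hessian (\<lambda>y. u y t))" by auto
  qed
  show "((\<lambda>s. u x s) has_real_derivative dt_on T u x t) (at t within T)" if t: "t \<in> T"
  proof -
    have "(\<lambda>s. u x s) differentiable (at t within T)" using assms t by (auto simp: C21_on_def)
    then have "((\<lambda>s. u x s) has_vector_derivative dt_on T u x t) (at t within T)"
      unfolding dt_on_def by (simp add: vector_derivative_works[symmetric])
    then show ?thesis by (simp add: has_real_derivative_iff_has_vector_derivative)
  qed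
qed

section \<open>Spatial increments of the value function\<close>

context mfg_data
begin

context
  fixes lam :: real and u :: "real^'n \<Rightarrow> real \<Rightarrow> real" and m :: "real \<Rightarrow> (real^'n) measure"
  assumes lam: "0 < lam" and sol: "MFG_solution lam m0 F H u m"
begin

lemma u_C21: "C21_on {0..} u" and m_curve: "P1_curve m"
  using sol by (auto simp: MFG_solution_def)

lemma m_P1: "0 \<le> t \<Longrightarrow> m t \<in> P1"
  using m_curve by (auto simp: P1_curve_def)

lemma u_C2: "0 \<le> t \<Longrightarrow> C_class (Suc (Suc 0)) (\<lambda>y. u y t)"
  using C21_on_slice(1)[OF u_C21] by simp

lemmas u_diff = C_class_2_grad(1)[OF u_C2]
lemmas Du_diff = C_class_2_grad(2)[OF u_C2]

text \<open>The equation is given for positive times; both sides extend continuously to 0, the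
  right-hand one through the \<open>d1\<close>-continuity of the curve. The contact time in the
  comparison may be 0.\<close>

lemma HJB:
  assumes t: "0 \<le> t"
  shows "- dt_on {0..} u x t - laplacian (\<lambda>y. u y t) x + 1 / lam * H (lam *\<^sub>R grad (\<lambda>y. u y t) x) x + lam * u x t = F x (m t)"
proof (cases "t = 0")
  case False
  then show ?thesis using sol t by (auto simp: MFG_solution_def)
next
  case True
  let ?l = "\<lambda>t. - dt_on {0..} u x t - laplacian (\<lambda>y. u y t) x + 1 / lam * H (lam *\<^sub>R grad (\<lambda>y. u y t) x) x + lam * u x t"
  have cH: "continuous_on UNIV (\<lambda>p. H p x)" using H_compose_C2(1) by (rule C_class_continuous)
  have "continuous_on {0..} (\<lambda>t. H (lam *\<^sub>R grad (\<lambda>y. u y t) x) x)"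
    by (rule continuous_on_compose2[OF cH]) (auto intro!: continuous_intros C21_on_slice[OF u_C21])
  then have "continuous_on {0..} ?l"
    by (intro continuous_intros C21_on_slice[OF u_C21])
  then have "(?l \<longlongrightarrow> ?l 0) (at 0 within {0..})" by (simp add: continuous_on_def)
  then have lim: "(?l \<longlongrightarrow> ?l 0) (at_right 0)" by (rule tendsto_within_subset) auto
  have ev: "\<forall>\<^sub>F t in at_right 0. F x (m t) = ?l t"
    using sol by (auto simp: MFG_solution_def eventually_at_filter)
  have 1: "((\<lambda>t. F x (m t)) \<longlongrightarrow> ?l 0) (at_right 0)"
    using lim unfolding tendsto_cong[OF ev] .
  have "((\<lambda>t. F x (m t) - F x (m 0)) \<longlongrightarrow> 0) (at_right 0)"
  proof (rule Lim_null_comparison)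
    have "\<bar>F x (m t) - F x (m 0)\<bar> \<le> L * d1 (m t) (m 0)" if "0 < t" for t
      using F_lipschitz[OF m_P1 m_P1, of t 0 x x] that by simp
    then show "\<forall>\<^sub>F t in at_right 0. norm (F x (m t) - F x (m 0)) \<le> L * d1 (m t) (m 0)"
      by (auto simp: eventually_at_filter)
    have "((\<lambda>t. d1 (m t) (m 0)) \<longlongrightarrow> 0) (at 0 within {0..})" using m_curve by (auto simp: P1_curve_def)
    then have "((\<lambda>t. d1 (m t) (m 0)) \<longlongrightarrow> 0) (at_right 0)" by (rule tendsto_within_subset) auto
    from tendsto_mult_left[OF this, of L] show "((\<lambda>t. L * d1 (m t) (m 0)) \<longlongrightarrow> 0) (at_right 0)" by simp
  qed
  then have 2: "((\<lambda>t. F x (m t)) \<longlongrightarrow> F x (m 0)) (at_right 0)" by (rule LIM_zero_cancel)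
  show ?thesis using tendsto_unique[OF _ 1 2] unfolding True by simp
qed

text \<open>The gradient bound keeps the increment within \<open>K / lam * norm h\<close>, so far
  away the penalty wins and a maximum over a compact cylinder is global.\<close>

lemma difference_maximum:
  fixes h x0 :: "real^'n"
  assumes K: "\<And>x t. 0 \<le> t \<Longrightarrow> norm (lam *\<^sub>R grad (\<lambda>y. u y t) x) \<le> K"
    and t0: "0 \<le> t0" and pos: "0 < a" "0 < b" "0 < \<delta>"
  defines "\<psi> \<equiv> \<lambda>x. sqrt (\<delta>\<^sup>2 + (norm (x - x0))\<^sup>2)"
  obtains x1 t1 where "t0 \<le> t1"
    "\<forall>x. \<forall>t\<ge>t0. u (x + h) t - u x t - a * \<psi> x - b * (t - t0) \<le> u (x1 + h) t1 - u x1 t1 - a * \<psi> x1 - b * (t1 - t0)"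
proof -
  have W: "\<bar>u (x + h) t - u x t\<bar> \<le> K / lam * norm h" if t: "0 \<le> t" for x t
  proof -
    have "norm (grad (\<lambda>y. u y t) z) \<le> K / lam" for z
      using K[OF t, of z] lam by (simp add: field_simps)
    then show ?thesis using lipschitz_of_grad_bound[OF u_diff[OF t], of x "x + h" "K / lam"] by simp
  qed
  define z where "z = (\<lambda>(x, t). u (x + h) t - u x t - a * \<psi> x - b * (t - t0))"
  \<comment> \<open>Outside the cylinder the penalty is at least \<open>min a b * R\<close>, which
    makes up for the oscillation of the increment and for the penalty \<open>a * \<delta>\<close> at
    the reference point \<open>(x0, t0)\<close>.\<close>
  define R where "R = (2 * (K / lam * norm h) + a * \<delta>) / min a b"
  have K0: "0 \<le> K" using K[OF t0, of 0] norm_ge_zero order_trans by blast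
  have m: "0 < min a b" using pos by simp
  have R0: "0 \<le> R" unfolding R_def using K0 lam pos m by (intro divide_nonneg_nonneg) auto
  have cu: "continuous_on (UNIV \<times> {0..}) (\<lambda>(x, t). u x t)" using u_C21 by (simp add: C21_on_def)
  have "continuous_on (cball x0 R \<times> {t0..t0 + R}) z"
  proof -
    have 1: "continuous_on (cball x0 R \<times> {t0..t0 + R}) (\<lambda>p. u (fst p + h) (snd p))"
    proof -
      have "continuous_on (cball x0 R \<times> {t0..t0 + R}) (\<lambda>p. (fst p + h, snd p))" by (intro continuous_intros)
      moreover have "(\<lambda>p. (fst p + h, snd p)) ` (cball x0 R \<times> {t0..t0 + R}) \<subseteq> UNIV \<times> {0..}" using t0 by auto
      ultimately have "continuous_on (cball x0 R \<times> {t0..t0 + R}) (\<lambda>p. (\<lambda>(x, t). u x t) (fst p + h, snd p))"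
        by (rule continuous_on_compose2[OF cu])
      then show ?thesis by simp
    qed
    have 2: "continuous_on (cball x0 R \<times> {t0..t0 + R}) (\<lambda>p. u (fst p) (snd p))"
    proof -
      have "continuous_on (cball x0 R \<times> {t0..t0 + R}) (\<lambda>p. (fst p, snd p))" by (intro continuous_intros)
      moreover have "(\<lambda>p. (fst p, snd p)) ` (cball x0 R \<times> {t0..t0 + R}) \<subseteq> UNIV \<times> {0..}" using t0 by auto
      ultimately have "continuous_on (cball x0 R \<times> {t0..t0 + R}) (\<lambda>p. (\<lambda>(x, t). u x t) (fst p, snd p))"
        by (rule continuous_on_compose2[OF cu])
      then show ?thesis by (simp add: split_beta)
    qed
    show ?thesis unfolding z_def \<psi>_def split_beta by (intro continuous_intros 1 2)
  qed
  moreover have "compact (cball x0 R \<times> {t0..t0 + R})" by (intro compact_Times) auto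
  moreover have in0: "(x0, t0) \<in> cball x0 R \<times> {t0..t0 + R}" using R0 by auto
  ultimately obtain p where p: "p \<in> cball x0 R \<times> {t0..t0 + R}"
    and max: "\<And>q. q \<in> cball x0 R \<times> {t0..t0 + R} \<Longrightarrow> z q \<le> z p"
    using continuous_attains_sup[of "cball x0 R \<times> {t0..t0 + R}" z] by blast
  have "z (x, t) \<le> z p" if t: "t0 \<le> t" for x t
  proof (cases "(x, t) \<in> cball x0 R \<times> {t0..t0 + R}")
    case False
    have "R < norm (x - x0) + (t - t0)"
      using False t by (auto simp: dist_norm norm_minus_commute) (smt (verit) norm_ge_zero)+
    then have "min a b * R \<le> min a b * (norm (x - x0) + (t - t0))" using m by (intro mult_left_mono) auto
    also have "\<dots> \<le> a * norm (x - x0) + b * (t - t0)"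
      unfolding distrib_left using t by (intro add_mono mult_right_mono) auto
    also have "\<dots> \<le> a * \<psi> x + b * (t - t0)"
      using pos by (intro add_mono mult_left_mono) (auto simp: \<psi>_def real_le_rsqrt)
    finally have "2 * (K / lam * norm h) + a * \<delta> \<le> a * \<psi> x + b * (t - t0)"
      using m by (simp add: R_def)
    moreover have "u (x + h) t - u x t \<le> K / lam * norm h" using W[of t x] t t0 by simp
    moreover have "- (K / lam * norm h) - a * \<delta> \<le> z (x0, t0)"
      using W[OF t0, of x0] pos by (simp add: z_def \<psi>_def)
    ultimately have "z (x, t) \<le> z (x0, t0)" by (simp add: z_def)
    then show ?thesis using max[OF in0] by simp
  qed (use max in auto)
  then show ?thesis using that[of "snd p" "fst p"] p by (auto simp: z_def split_beta)
qed

text \<open>The equation at \<open>x1 + h\<close> minus the equation at \<open>x1\<close>, at the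
  maximum of the penalised increment. There the time derivatives differ by at most \<open>b\<close>,
  the gradients by at most \<open>a\<close>, and the Laplacians by at most
  \<open>CARD('n) * (a / \<delta>)\<close>. The penalty at the contact point stays on the left,
  where it can absorb the variation of \<open>F\<close> between that point and
  \<open>(x0, t0)\<close>.\<close>

lemma difference_estimate:
  fixes h x0 :: "real^'n"
  assumes K: "\<And>x t. 0 \<le> t \<Longrightarrow> norm (lam *\<^sub>R grad (\<lambda>y. u y t) x) \<le> K"
    and t0: "0 \<le> t0" and pos: "0 < a" "0 < b" "0 < \<delta>"
  defines "\<psi> \<equiv> \<lambda>x. sqrt (\<delta>\<^sup>2 + (norm (x - x0))\<^sup>2)"
  obtains x1 t1 where "t0 \<le> t1"
    "lam * (u (x0 + h) t0 - u x0 t0) + lam * a * \<psi> x1 + lam * b * (t1 - t0)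
      \<le> lam * a * \<delta> + (F (x1 + h) (m t1) - F x1 (m t1)) + b + real CARD('n) * (a / \<delta>)
        + 6 * Co * (1 + K) * a + Co * (1 + K) * norm h / lam"
proof -
  obtain x1 t1 where t1: "t0 \<le> t1" and max0: "\<forall>x. \<forall>t\<ge>t0.
      u (x + h) t - u x t - a * sqrt (\<delta>\<^sup>2 + (norm (x - x0))\<^sup>2) - b * (t - t0)
      \<le> u (x1 + h) t1 - u x1 t1 - a * sqrt (\<delta>\<^sup>2 + (norm (x1 - x0))\<^sup>2) - b * (t1 - t0)"
    by (rule difference_maximum[OF K t0 pos, of h x0])
  have max: "u (x + h) t - u x t - a * \<psi> x - b * (t - t0) \<le> u (x1 + h) t1 - u x1 t1 - a * \<psi> x1 - b * (t1 - t0)"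
    if "t0 \<le> t" for x t
    using max0 that unfolding \<psi>_def by blast
  have t1': "0 \<le> t1" using t0 t1 by simp
  have K0: "0 \<le> K" using K[OF t0, of 0] norm_ge_zero order_trans by blast
  define U where "U = (\<lambda>y. u y t1)"
  have U1: "U differentiable (at y)" for y unfolding U_def by (rule u_diff[OF t1'])
  have U2: "pd v U differentiable (at y)" for v y
    unfolding pd_grad_inner[OF U1, symmetric] using Du_diff[OF t1', of y] unfolding U_def by (intro differentiable_inner) auto
  \<comment> \<open>The maximum is over times from \<open>t0\<close> on, so it yields a right-hand
    inequality; an upper bound is the direction in which the time derivative enters the equation for
    \<open>lam * u\<close>.\<close>
  have time: "dt_on {0..} u (x1 + h) t1 - dt_on {0..} u x1 t1 \<le> b"
  proof (rule has_real_derivative_right_le[OF _ t1'])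
    show "((\<lambda>s. u (x1 + h) s - u x1 s) has_real_derivative dt_on {0..} u (x1 + h) t1 - dt_on {0..} u x1 t1) (at t1 within {0..})"
      using t1' by (intro DERIV_diff C21_on_slice[OF u_C21]) auto
    show "u (x1 + h) s - u x1 s \<le> u (x1 + h) t1 - u x1 t1 + b * (s - t1)" if "t1 \<le> s" for s
      using max[of s x1] that t1 by (simp add: algebra_simps)
  qed
  \<comment> \<open>The gradient of the smoothed cone at the contact point.\<close>
  define p where "p = (x1 - x0) /\<^sub>R \<psi> x1"
  have \<psi>\<delta>: "\<delta> \<le> \<psi> x" for x using pos by (simp add: \<psi>_def real_le_rsqrt)
  have \<psi>n: "norm (x - x0) \<le> \<psi> x" for x by (simp add: \<psi>_def real_le_rsqrt)
  have "0 < \<psi> x1" using \<psi>\<delta>[of x1] pos by linarith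
  then have np: "norm p \<le> 1" using \<psi>n[of x1] by (simp add: p_def divide_inverse_commute[symmetric])
  \<comment> \<open>Maximality in space with the cone replaced by its parabola: along every line
    through the contact point, the increment is touched from above.\<close>
  have touch: "U (x1 + h + s *\<^sub>R v) - U (x1 + s *\<^sub>R v) \<le> U (x1 + h) - U x1 + (a * (p \<bullet> v)) * s + (a * (norm v)\<^sup>2 / \<delta>) / 2 * s\<^sup>2" for s v
  proof -
    have "\<psi> (x1 + s *\<^sub>R v) \<le> \<psi> x1 + p \<bullet> (s *\<^sub>R v) + (norm (s *\<^sub>R v))\<^sup>2 / (2 * \<delta>)"
      using sqrt_barrier_upper[OF pos(3), of "x1 - x0" "s *\<^sub>R v"] by (simp add: \<psi>_def p_def algebra_simps)
    then have "a * \<psi> (x1 + s *\<^sub>R v) \<le> a * (\<psi> x1 + p \<bullet> (s *\<^sub>R v) + (norm (s *\<^sub>R v))\<^sup>2 / (2 * \<delta>))"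
      using pos by (intro mult_left_mono) auto
    also have "\<dots> = a * \<psi> x1 + (a * (p \<bullet> v)) * s + (a * (norm v)\<^sup>2 / \<delta>) / 2 * s\<^sup>2"
      by (simp add: power_mult_distrib algebra_simps)
    finally show ?thesis
      using max[OF t1, of "x1 + s *\<^sub>R v"] by (simp add: U_def algebra_simps)
  qed
  have line: "((\<lambda>s. U (x1 + h + s *\<^sub>R v) - U (x1 + s *\<^sub>R v)) has_real_derivative pd v U (x1 + h + s *\<^sub>R v) - pd v U (x1 + s *\<^sub>R v)) (at s)" for s v
    by (intro DERIV_diff has_real_derivative_along_line U1)
  have line2: "((\<lambda>s. pd v U (x1 + h + s *\<^sub>R v) - pd v U (x1 + s *\<^sub>R v)) has_real_derivative pd v (pd v U) (x1 + h) - pd v (pd v U) x1) (at 0)" for v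
  proof -
    have "((\<lambda>s. pd v U (x1 + h + s *\<^sub>R v) - pd v U (x1 + s *\<^sub>R v)) has_real_derivative
        pd v (pd v U) (x1 + h + 0 *\<^sub>R v) - pd v (pd v U) (x1 + 0 *\<^sub>R v)) (at 0)"
      by (intro DERIV_diff has_real_derivative_along_line U2)
    then show ?thesis by simp
  qed
  have touch0: "U (x1 + h + s *\<^sub>R v) - U (x1 + s *\<^sub>R v) \<le> U (x1 + h + 0 *\<^sub>R v) - U (x1 + 0 *\<^sub>R v) + (a * (p \<bullet> v)) * s + (a * (norm v)\<^sup>2 / \<delta>) / 2 * s\<^sup>2" for s v
    using touch[of s v] by simp
  note T = touching_from_above[OF line line2 touch0]
  have "(grad U (x1 + h) - grad U x1) \<bullet> v = (a *\<^sub>R p) \<bullet> v" for v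
    using T(1)[of v] by (simp add: inner_diff_left grad_inner[OF U1])
  then have "grad U (x1 + h) - grad U x1 = a *\<^sub>R p" using vector_eq_rdot by blast
  then have gradU: "norm (grad U (x1 + h) - grad U x1) \<le> a" using np pos by (simp add: mult_left_le)
  have lapl: "laplacian U (x1 + h) - laplacian U x1 \<le> real CARD('n) * (a / \<delta>)"
  proof -
    have lap: "laplacian U y = (\<Sum>i\<in>Basis. pd i (pd i U) y)" for y
      using U1 Du_diff[OF t1', of y] unfolding U_def by (rule laplacian_eq)
    have "laplacian U (x1 + h) - laplacian U x1 = (\<Sum>i\<in>Basis. pd i (pd i U) (x1 + h) - pd i (pd i U) x1)"
      by (simp add: lap sum_subtractf)
    also have "\<dots> \<le> (\<Sum>i\<in>(Basis :: (real^'n) set). a / \<delta>)"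
    proof (rule sum_mono)
      fix i :: "real^'n" assume "i \<in> Basis"
      then show "pd i (pd i U) (x1 + h) - pd i (pd i U) x1 \<le> a / \<delta>" using T(2)[of i] by simp
    qed
    finally show ?thesis by simp
  qed
  define P where "P = lam *\<^sub>R grad U x1"
  define Q where "Q = lam *\<^sub>R grad U (x1 + h)"
  have PQ: "norm P \<le> K" "norm Q \<le> K" using K[OF t1'] by (auto simp: P_def Q_def U_def)
  have "norm (Q - P) \<le> lam * a"
    using gradU lam by (simp add: P_def Q_def scaleR_diff_right[symmetric])
  then have "6 * Co * (1 + K) * norm (Q - P) \<le> 6 * Co * (1 + K) * (lam * a)"
    using Co K0 by (intro mult_left_mono) auto
  then have H1: "\<bar>H Q (x1 + h) - H P (x1 + h)\<bar> \<le> 6 * Co * (1 + K) * (lam * a)"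
    using H_lipschitz_p[OF PQ, of "x1 + h"] by linarith
  have "Co * (1 + norm P) * norm h \<le> Co * (1 + K) * norm h"
    using PQ(1) Co by (intro mult_right_mono mult_left_mono) auto
  then have H2: "\<bar>H P (x1 + h) - H P x1\<bar> \<le> Co * (1 + K) * norm h"
    using H_lipschitz_x[of P "x1 + h" x1] by simp
  have "- (6 * Co * (1 + K) * (lam * a) + Co * (1 + K) * norm h) \<le> H Q (x1 + h) - H P x1"
    using H1 H2 by linarith
  then have "1 / lam * (- (6 * Co * (1 + K) * (lam * a) + Co * (1 + K) * norm h)) \<le> 1 / lam * (H Q (x1 + h) - H P x1)"
    using lam by (intro mult_left_mono) auto
  then have HH: "- (6 * Co * (1 + K) * a + Co * (1 + K) * norm h / lam) \<le> 1 / lam * H Q (x1 + h) - 1 / lam * H P x1"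
    using lam by (simp add: field_simps)
  have "lam * u (x1 + h) t1 - lam * u x1 t1 \<le> (F (x1 + h) (m t1) - F x1 (m t1)) + b + real CARD('n) * (a / \<delta>)
        + 6 * Co * (1 + K) * a + Co * (1 + K) * norm h / lam"
    using HJB[OF t1', of "x1 + h"] HJB[OF t1', of x1] time lapl HH
    unfolding U_def[symmetric] P_def[symmetric] Q_def[symmetric] by linarith
  \<comment> \<open>Comparison with the value at \<open>(x0, t0)\<close>, where the cone equals
    \<open>\<delta>\<close>.\<close>
  moreover have "lam * (u (x0 + h) t0 - u x0 t0 - a * \<delta>) \<le> lam * (u (x1 + h) t1 - u x1 t1 - a * \<psi> x1 - b * (t1 - t0))"
    using max[of t0 x0] lam pos by (intro mult_left_mono) (auto simp: \<psi>_def)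
  ultimately have "lam * (u (x0 + h) t0 - u x0 t0) + lam * a * \<psi> x1 + lam * b * (t1 - t0)
      \<le> lam * a * \<delta> + (F (x1 + h) (m t1) - F x1 (m t1)) + b + real CARD('n) * (a / \<delta>)
        + 6 * Co * (1 + K) * a + Co * (1 + K) * norm h / lam"
    by (simp add: right_diff_distrib mult.assoc)
  then show ?thesis using that t1 by blast
qed

end

section \<open>A priori bound and convergence rate for the momentum\<close>

lemma F_increment_lipschitz:
  assumes m: "m \<in> P1" "m' \<in> P1"
  shows "\<bar>(F (x + h) m - F x m) - (F (y + h) m' - F y m')\<bar> \<le> L * (norm (x - y) + d1 m m') * norm h"
proof -
  \<comment> \<open>Both increments along \<open>h\<close> are differences of this single function,
    so the mean value theorem meets a difference of gradients, which \<open>DF_lipschitz\<close>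
    bounds.\<close>
  define f where "f s = F (x + s *\<^sub>R h) m - F (y + s *\<^sub>R h) m'" for s
  define f' where "f' s = (grad (\<lambda>z. F z m) (x + s *\<^sub>R h) - grad (\<lambda>z. F z m') (y + s *\<^sub>R h)) \<bullet> h" for s
  have "(f has_real_derivative f' s) (at s)" for s
    unfolding f_def[abs_def] f'_def inner_diff_left grad_inner[OF F_diff[OF m(1)]] grad_inner[OF F_diff[OF m(2)]]
    by (intro DERIV_diff has_real_derivative_along_line F_diff m)
  then obtain s where s: "f 1 - f 0 = (1 - 0) * f' s" using MVT2[of 0 1 f f'] by auto
  have "\<bar>f' s\<bar> \<le> norm (grad (\<lambda>z. F z m) (x + s *\<^sub>R h) - grad (\<lambda>z. F z m') (y + s *\<^sub>R h)) * norm h"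
    unfolding f'_def by (rule Cauchy_Schwarz_ineq2)
  also have "\<dots> \<le> (L * (norm ((x + s *\<^sub>R h) - (y + s *\<^sub>R h)) + d1 m m')) * norm h"
    by (intro mult_right_mono DF_lipschitz m) auto
  finally show ?thesis using s by (simp add: f_def algebra_simps)
qed

text \<open>With \<open>a = b = \<epsilon> \<rightarrow> 0\<close> the comparison leaves
  \<open>lam * M \<le> L + Co * (1 + lam * M) / lam\<close>, where \<open>M\<close> is the supremum
  of the norm of the gradient, finite by the notion of solution. As \<open>Co \<le> lam / 2\<close>,
  the term \<open>Co * M\<close> is absorbed, and \<open>Co / lam \<le> 1 / 2\<close> accounts for
  the 1 in \<open>2 * L + 1\<close>.\<close>

lemma gradient_bound:
  assumes lam: "2 * Co \<le> lam" and sol: "MFG_solution lam m0 F H u m" and t0: "0 \<le> t0"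
  shows "norm (lam *\<^sub>R grad (\<lambda>y. u y t0) x0) \<le> 2 * L + 1"
proof -
  have lam0: "0 < lam" using lam Co by auto
  note mP = m_P1[OF lam0 sol]
  let ?S = "(\<lambda>(x, t). norm (grad (\<lambda>y. u y t) x)) ` (UNIV \<times> {0..})"
  have bdd: "bdd_above ?S" using sol by (simp add: MFG_solution_def)
  define M where "M = Sup ?S"
  have M: "norm (grad (\<lambda>y. u y t) x) \<le> M" if "0 \<le> t" for x t
    unfolding M_def using that by (intro cSup_upper bdd) (auto intro!: image_eqI[of _ _ "(x, t)"])
  have M0: "0 \<le> M" using M[of 0 0] norm_ge_zero order_trans by (metis order_refl)
  define K where "K = lam * M"
  have K0: "0 \<le> K" using M0 lam0 by (simp add: K_def)
  have K: "norm (lam *\<^sub>R grad (\<lambda>y. u y t) x) \<le> K" if "0 \<le> t" for x t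
    using M[OF that, of x] lam0 by (simp add: K_def)
  define C where "C = L + Co * (1 + K) / lam"
  have up: "lam * (u (x + h) t - u x t) \<le> C * norm h" if t: "0 \<le> t" for x h t
  proof (rule field_le_epsilon)
    fix e :: real assume e: "0 < e"
    \<comment> \<open>The sum of the coefficients of \<open>\<epsilon>\<close>, so that the penalty
      terms add up to \<open>e\<close>.\<close>
    define N where "N = lam + 1 + real CARD('n) + 6 * Co * (1 + K)"
    have N: "0 < N" using lam0 Co K0 by (simp add: N_def add_pos_nonneg)
    define \<epsilon> where "\<epsilon> = e / N"
    have \<epsilon>: "0 < \<epsilon>" "\<epsilon> * N = e" using e N by (auto simp: \<epsilon>_def)
    obtain x1 t1 where t1: "t \<le> t1" and le: "lam * (u (x + h) t - u x t) + lam * \<epsilon> * sqrt (1\<^sup>2 + (norm (x1 - x))\<^sup>2) + lam * \<epsilon> * (t1 - t)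
      \<le> lam * \<epsilon> * 1 + (F (x1 + h) (m t1) - F x1 (m t1)) + \<epsilon> + real CARD('n) * (\<epsilon> / 1)
        + 6 * Co * (1 + K) * \<epsilon> + Co * (1 + K) * norm h / lam"
      by (rule difference_estimate[OF lam0 sol K t \<epsilon>(1) \<epsilon>(1) zero_less_one])
    have "0 \<le> lam * \<epsilon> * sqrt (1\<^sup>2 + (norm (x1 - x))\<^sup>2)" "0 \<le> lam * \<epsilon> * (t1 - t)"
      using lam0 \<epsilon> t1 by auto
    moreover have "F (x1 + h) (m t1) - F x1 (m t1) \<le> L * norm h"
      using lipschitz_onD[OF F_lip[OF mP], of t1 "x1 + h" x1] t1 t by (simp add: dist_real_def dist_norm abs_le_iff)
    moreover have "lam * \<epsilon> * 1 + \<epsilon> + real CARD('n) * (\<epsilon> / 1) + 6 * Co * (1 + K) * \<epsilon> = e"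
      unfolding \<epsilon>(2)[symmetric] by (simp add: N_def algebra_simps)
    moreover have "C * norm h = L * norm h + Co * (1 + K) * norm h / lam" by (simp add: C_def distrib_right)
    ultimately show "lam * (u (x + h) t - u x t) \<le> C * norm h + e" using le by linarith
  qed
  have C0: "0 \<le> C" using L Co K0 lam0 by (simp add: C_def)
  have "norm (grad (\<lambda>y. u y t) x) \<le> C / lam" if t: "0 \<le> t" for x t
  proof (rule norm_grad_le_lipschitz[OF lipschitz_onI u_diff[OF lam0 sol t]])
    show "dist (u x t) (u y t) \<le> C / lam * dist x y" for x y
      using up[OF t, of y "x - y"] up[OF t, of x "y - x"] lam0
      by (simp add: dist_real_def dist_norm abs_le_iff norm_minus_commute field_simps)
    show "0 \<le> C / lam" using C0 lam0 by simp
  qed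
  then have "M \<le> C / lam" unfolding M_def by (intro cSup_least) auto
  then have "lam * M \<le> C" using lam0 by (simp add: field_simps)
  also have "C = L + Co / lam + Co * M" using lam0 by (simp add: C_def K_def field_simps)
  also have "\<dots> \<le> L + 1 / 2 + lam / 2 * M"
    using lam lam0 M0 by (intro add_mono mult_right_mono) (auto simp: field_simps)
  finally have "lam * M \<le> 2 * L + 1" by simp
  then show ?thesis using K[OF t0, of x0] by (simp add: K_def)
qed

text \<open>The slopes are now fixed: \<open>lam * a = L * norm h\<close> absorbs the spatial
  variation of the increment of \<open>F\<close>, and \<open>lam * b\<close> the temporal one, after
  \<open>sqrt s \<le> \<delta> + s / \<delta>\<close>. What is left is of order
  \<open>\<delta> * norm h\<close> with \<open>\<delta> = 1 / sqrt lam\<close>. Of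
  \<open>2 * c1\<close>, one part is the remainder of that splitting and the other comes from
  \<open>b\<close> itself.\<close>

lemma gradient_estimate:
  assumes lam: "1 \<le> lam" and sol: "MFG_solution lam m0 F H u m" and t0: "0 \<le> t0"
    and K: "\<And>x t. 0 \<le> t \<Longrightarrow> norm (lam *\<^sub>R grad (\<lambda>y. u y t) x) \<le> K"
    and c: "0 < c1" "0 \<le> c2"
    and modulus: "\<And>t. t0 \<le> t \<Longrightarrow> d1 (m t) (m t0) \<le> c1 * sqrt (t - t0) + c2 * (t - t0)"
  shows "norm (lam *\<^sub>R grad (\<lambda>y. u y t0) x0 - grad (\<lambda>y. F y (m t0)) x0)
    \<le> (L * (1 + 2 * c1 + c2 + real CARD('n) + 6 * Co * (1 + K)) + Co * (1 + K)) / sqrt lam"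
proof -
  define C where "C = (L * (1 + 2 * c1 + c2 + real CARD('n) + 6 * Co * (1 + K)) + Co * (1 + K)) / sqrt lam"
  have lam0: "0 < lam" using lam by simp
  note mP = m_P1[OF lam0 sol]
  have K0: "0 \<le> K" using K[OF t0, of 0] norm_ge_zero order_trans by blast
  define \<delta> where "\<delta> = 1 / sqrt lam"
  have \<delta>: "0 < \<delta>" using lam0 by (simp add: \<delta>_def)
  have l\<delta>: "1 / (lam * \<delta>) = \<delta>" using lam0 by (simp add: \<delta>_def real_div_sqrt)
  have "1 \<le> sqrt lam" using lam by simp
  then have "sqrt lam * 1 \<le> sqrt lam * sqrt lam" using lam0 by (intro mult_left_mono) auto
  then have "sqrt lam \<le> lam" using lam0 by simp
  then have l1: "1 / lam \<le> \<delta>" using lam0 unfolding \<delta>_def by (intro divide_left_mono) auto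
  have up: "lam * (u (x0 + h) t0 - u x0 t0) - (F (x0 + h) (m t0) - F x0 (m t0)) \<le> C * norm h" for h
  proof (cases "h = 0")
    case False
    then have h: "0 < norm h" by simp
    \<comment> \<open>Both slopes are proportional to \<open>norm h\<close> and must be positive,
      which is why \<open>h = 0\<close> is treated apart.\<close>
    define a where "a = L * norm h / lam"
    define b where "b = L * norm h * (c1 / \<delta> + c2) / lam"
    have a: "0 < a" and b: "0 < b" using L h lam0 c \<delta> by (auto simp: a_def b_def add_pos_nonneg)
    obtain x1 t1 where t1: "t0 \<le> t1" and le: "lam * (u (x0 + h) t0 - u x0 t0) + lam * a * sqrt (\<delta>\<^sup>2 + (norm (x1 - x0))\<^sup>2) + lam * b * (t1 - t0)
      \<le> lam * a * \<delta> + (F (x1 + h) (m t1) - F x1 (m t1)) + b + real CARD('n) * (a / \<delta>)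
        + 6 * Co * (1 + K) * a + Co * (1 + K) * norm h / lam"
      by (rule difference_estimate[OF lam0 sol K t0 a b \<delta>])
    define s where "s = t1 - t0"
    have s: "0 \<le> s" using t1 by (simp add: s_def)
    have "sqrt s \<le> \<delta> + s / \<delta>"
    proof (rule real_le_lsqrt)
      have "s = \<delta> * (s / \<delta>)" using \<delta> by simp
      also have "\<dots> \<le> (\<delta> + s / \<delta>)\<^sup>2" using s \<delta> by (simp add: power2_sum)
      finally show "s \<le> (\<delta> + s / \<delta>)\<^sup>2" .
    qed (use s \<delta> in auto)
    then have "c1 * sqrt s \<le> c1 * (\<delta> + s / \<delta>)" using c by (intro mult_left_mono) auto
    then have "d1 (m t1) (m t0) \<le> c1 * (\<delta> + s / \<delta>) + c2 * s" using modulus[OF t1] by (simp add: s_def)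
    moreover have "norm (x1 - x0) \<le> sqrt (\<delta>\<^sup>2 + (norm (x1 - x0))\<^sup>2)" by (simp add: real_le_rsqrt)
    ultimately have "L * (norm (x1 - x0) + d1 (m t1) (m t0)) * norm h \<le>
        L * (sqrt (\<delta>\<^sup>2 + (norm (x1 - x0))\<^sup>2) + (c1 * (\<delta> + s / \<delta>) + c2 * s)) * norm h"
      using L by (intro mult_right_mono mult_left_mono add_mono) auto
    also have "\<dots> = lam * a * sqrt (\<delta>\<^sup>2 + (norm (x1 - x0))\<^sup>2) + lam * b * s + L * norm h * c1 * \<delta>"
      using lam0 \<delta> by (simp add: a_def b_def field_simps)
    finally have Fd: "(F (x1 + h) (m t1) - F x1 (m t1)) - (F (x0 + h) (m t0) - F x0 (m t0))
       \<le> lam * a * sqrt (\<delta>\<^sup>2 + (norm (x1 - x0))\<^sup>2) + lam * b * s + L * norm h * c1 * \<delta>"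
      using F_increment_lipschitz[OF mP mP, of t1 t0 x1 h x0] t1 t0 by linarith
    have e1: "lam * a * \<delta> = L * norm h * \<delta>" using lam0 by (simp add: a_def)
    have e2: "b \<le> L * norm h * (c1 + c2) * \<delta>"
    proof -
      have "b = L * norm h * (c1 * (1 / (lam * \<delta>)) + c2 * (1 / lam))"
        by (simp add: b_def divide_inverse distrib_left distrib_right mult_ac)
      also have "\<dots> \<le> L * norm h * (c1 * \<delta> + c2 * \<delta>)"
        unfolding l\<delta> using L c l1 by (intro mult_left_mono add_mono) auto
      finally show ?thesis by (simp add: algebra_simps)
    qed
    have e3: "real CARD('n) * (a / \<delta>) = L * norm h * real CARD('n) * \<delta>"
    proof -
      have "real CARD('n) * (a / \<delta>) = L * norm h * real CARD('n) * (1 / (lam * \<delta>))" by (simp add: a_def field_simps)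
      then show ?thesis unfolding l\<delta> .
    qed
    have e4: "6 * Co * (1 + K) * a \<le> L * norm h * (6 * Co * (1 + K)) * \<delta>"
    proof -
      have "6 * Co * (1 + K) * a = L * norm h * (6 * Co * (1 + K)) * (1 / lam)" by (simp add: a_def field_simps)
      also have "\<dots> \<le> L * norm h * (6 * Co * (1 + K)) * \<delta>" using l1 L Co K0 by (intro mult_left_mono) auto
      finally show ?thesis .
    qed
    have e5: "Co * (1 + K) * norm h / lam \<le> Co * (1 + K) * norm h * \<delta>"
    proof -
      have "Co * (1 + K) * norm h * (1 / lam) \<le> Co * (1 + K) * norm h * \<delta>" using l1 Co K0 by (intro mult_left_mono) auto
      then show ?thesis by simp
    qed
    have "C * norm h = L * norm h * \<delta> + L * norm h * c1 * \<delta> + L * norm h * (c1 + c2) * \<delta> + L * norm h * real CARD('n) * \<delta>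
        + L * norm h * (6 * Co * (1 + K)) * \<delta> + Co * (1 + K) * norm h * \<delta>"
      unfolding C_def divide_inverse \<delta>_def by (simp add: algebra_simps)
    then show ?thesis using le Fd e1 e2 e3 e4 e5 unfolding s_def by linarith
  qed simp
  let ?D = "lam *\<^sub>R grad (\<lambda>y. u y t0) x0 - grad (\<lambda>y. F y (m t0)) x0"
  \<comment> \<open>The increment bound is divided by \<open>s\<close> along
    \<open>h = s *\<^sub>R v\<close>, with \<open>s\<close> decreasing to 0; the direction
    \<open>v = ?D\<close> then yields the norm.\<close>
  have "?D \<bullet> v \<le> C * norm v" for v
  proof -
    define g where "g s = lam * u (x0 + s *\<^sub>R v) t0 - F (x0 + s *\<^sub>R v) (m t0)" for s
    have du: "(\<lambda>y. u y t0) differentiable (at x)" for x by (rule u_diff[OF lam0 sol t0])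
    have dF: "(\<lambda>y. F y (m t0)) differentiable (at x)" for x by (rule F_diff[OF mP[OF t0]])
    have "(g has_real_derivative (lam * pd v (\<lambda>y. u y t0) (x0 + 0 *\<^sub>R v) - pd v (\<lambda>y. F y (m t0)) (x0 + 0 *\<^sub>R v))) (at 0)"
      unfolding g_def[abs_def]
      by (intro DERIV_diff DERIV_cmult has_real_derivative_along_line[of "\<lambda>y. u y t0"] has_real_derivative_along_line[of "\<lambda>y. F y (m t0)"] du dF)
    then have "(g has_real_derivative ?D \<bullet> v) (at 0)" by (simp add: inner_diff_left grad_inner[OF du] grad_inner[OF dF])
    then have "((\<lambda>s. (g (0 + s) - g 0) / s) \<longlongrightarrow> ?D \<bullet> v) (at 0)" by (simp only: DERIV_def)
    then have "((\<lambda>s. (g (0 + s) - g 0) / s) \<longlongrightarrow> ?D \<bullet> v) (at_right 0)" by (rule tendsto_within_subset) auto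
    moreover have "\<forall>\<^sub>F s in at_right 0. (g (0 + s) - g 0) / s \<le> C * norm v"
    proof -
      have "(g (0 + s) - g 0) / s \<le> C * norm v" if "0 < s" for s
        using up[of "s *\<^sub>R v"] that by (simp add: g_def field_simps)
      then show ?thesis by (auto simp: eventually_at_filter)
    qed
    ultimately show ?thesis by (rule tendsto_upperbound) simp
  qed
  from this[of ?D] have "norm ?D * norm ?D \<le> C * norm ?D" by (simp add: power2_norm_eq_inner[symmetric] power2_eq_square)
  moreover have "0 \<le> C" using L c Co K0 lam0 unfolding C_def by (intro divide_nonneg_nonneg add_nonneg_nonneg mult_nonneg_nonneg) auto
  ultimately have "norm ?D \<le> C" by (cases "norm ?D = 0") (auto simp: mult_le_cancel_right)
  then show ?thesis by (simp add: C_def)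
qed

end

section \<open>Weak formulations of the two systems\<close>

lemma has_derivative_integral_bounded_support:
  fixes \<rho> :: "real^'n \<Rightarrow> real \<Rightarrow> real"
  assumes \<rho>: "C21_on {0<..} \<rho>" and \<psi>: "continuous_on UNIV \<psi>" "\<And>x. R < norm x \<Longrightarrow> \<psi> x = 0" and t: "0 < t"
  shows "((\<lambda>t. LINT x|lborel. \<rho> x t * \<psi> x) has_real_derivative (LINT x|lborel. dt_on {0<..} \<rho> x t * \<psi> x)) (at t)"
proof -
  obtain a :: "real^'n" where a: "cball 0 R \<subseteq> cbox (- a) a"
    using bounded_subset_cbox_symmetric[OF bounded_cball] by metis
  have "continuous_on (UNIV \<times> {0<..}) (\<lambda>(x, t). \<rho> x t)" "continuous_on (UNIV \<times> {0<..}) (\<lambda>(x, t). dt_on {0<..} \<rho> x t)"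
    using \<rho> by (auto simp: C21_on_def)
  note c\<rho> = this
  have slice: "continuous_on UNIV (\<lambda>x. f x s)" if f: "continuous_on (UNIV \<times> {0<..}) (\<lambda>(x, t). f x t)" and "0 < s"
    for f :: "real^'n \<Rightarrow> real \<Rightarrow> real" and s
  proof -
    have "continuous_on UNIV (\<lambda>x::real^'n. (x, s))" by (intro continuous_intros)
    moreover have "range (\<lambda>x::real^'n. (x, s)) \<subseteq> UNIV \<times> {0<..}" using that by auto
    ultimately have "continuous_on UNIV (\<lambda>x. (\<lambda>(x, t). f x t) (x, s))" by (rule continuous_on_compose2[OF f])
    then show ?thesis by simp
  qed
  have eq: "(LINT x|lborel. f x s * \<psi> x) = integral (cbox (-a) a) (\<lambda>x. f x s * \<psi> x)"
    if "continuous_on (UNIV \<times> {0<..}) (\<lambda>(x, t). f x t)" "0 < s" for f :: "real^'n \<Rightarrow> real \<Rightarrow> real" and s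
    using slice[OF that] \<psi> by (intro integral_lborel_bounded_support[OF _ _ a] continuous_intros) auto
  have "((\<lambda>s. integral (cbox (-a) a) (\<lambda>x. \<rho> x s * \<psi> x)) has_real_derivative integral (cbox (-a) a) (\<lambda>x. dt_on {0<..} \<rho> x t * \<psi> x)) (at t within {0<..})"
  proof (rule leibniz_rule_field_derivative)
    show "((\<lambda>s. \<rho> x s * \<psi> x) has_real_derivative dt_on {0<..} \<rho> x s * \<psi> x) (at s within {0<..})" if "s \<in> {0<..}" for s x
      using C21_on_slice(2)[OF \<rho> that] by (rule DERIV_cmult_right)
    show "(\<lambda>x. \<rho> x s * \<psi> x) integrable_on cbox (-a) a" if "s \<in> {0<..}" for s
      using slice[OF c\<rho>(1), of s] \<psi>(1) that
      by (intro integrable_continuous continuous_intros) (auto intro: continuous_on_subset)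
    have "continuous_on ({0<..} \<times> cbox (-a) a) (\<lambda>p. (snd p, fst p))" by (intro continuous_intros)
    moreover have "(\<lambda>p. (snd p, fst p)) ` ({0<..} \<times> cbox (-a) a) \<subseteq> UNIV \<times> {0<..}" by auto
    ultimately have "continuous_on ({0<..} \<times> cbox (-a) a) (\<lambda>p. (\<lambda>(x, t). dt_on {0<..} \<rho> x t) (snd p, fst p))"
      by (rule continuous_on_compose2[OF c\<rho>(2)])
    moreover have "continuous_on ({0<..} \<times> cbox (-a) a) (\<lambda>p. \<psi> (snd p))"
      by (rule continuous_on_compose2[OF \<psi>(1)]) (auto intro: continuous_intros)
    ultimately have "continuous_on ({0<..} \<times> cbox (-a) a) (\<lambda>p. dt_on {0<..} \<rho> (snd p) (fst p) * \<psi> (snd p))"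
      by (intro continuous_intros) auto
    then show "continuous_on ({0<..} \<times> cbox (-a) a) (\<lambda>(s, x). dt_on {0<..} \<rho> x s * \<psi> x)"
      by (simp add: split_beta)
  qed (use t in auto)
  then have "((\<lambda>s. integral (cbox (-a) a) (\<lambda>x. \<rho> x s * \<psi> x)) has_real_derivative (LINT x|lborel. dt_on {0<..} \<rho> x t * \<psi> x)) (at t)"
    unfolding eq[OF c\<rho>(2) t] using t by (simp add: at_within_open[of t "{0<..}"])
  then show ?thesis
    by (rule has_field_derivative_transform_within_open[of _ _ _ "{0<..}"]) (use t eq[OF c\<rho>(1)] in auto)
qed

context mfg_data
begin

text \<open>One derivative of the drift is what the integration by parts of the divergence term
  requires; it comes from the second derivatives of \<open>H\<close> and of
  \<open>u\<close>.\<close>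

lemma MFG_drift_C1:
  assumes "0 < lam" "MFG_solution lam m0 F H u m" "0 \<le> t" "i \<in> Basis"
  shows "C_class (Suc 0) (\<lambda>y. Dp H (lam *\<^sub>R grad (\<lambda>z. u z t) y) y \<bullet> i)"
proof (rule Dp_compose_C1[OF _ assms(4)])
  show "C_class (Suc 0) (\<lambda>y. (lam *\<^sub>R grad (\<lambda>z. u z t) y) \<bullet> j)" for j
    unfolding inner_scaleR_left by (rule C_class_mult[OF C_class_const C_class_2_grad(3)[OF u_C2[OF assms(1-3)]]])
qed

lemma MFG_drift_continuous:
  assumes "0 < lam" "MFG_solution lam m0 F H u m" "0 \<le> t"
  shows "continuous_on UNIV (\<lambda>y. Dp H (lam *\<^sub>R grad (\<lambda>z. u z t) y) y)"
  using C_class_continuous[OF MFG_drift_C1[OF assms]] by (subst continuous_on_componentwise) auto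

text \<open>Three integrations by parts with bounded support: \<open>A1\<close> and
  \<open>A2\<close> move the Laplacian from the density to the test function, and \<open>A3\<close>
  moves the divergence. Their integrals vanish, which leaves the density times the
  generator.\<close>

lemma MFG_weak_fp:
  assumes lam: "0 < lam" and sol: "MFG_solution lam m0 F H u m"
  shows "weak_fp (\<lambda>t y. Dp H (lam *\<^sub>R grad (\<lambda>z. u z t) y) y) m"
  unfolding weak_fp_def
proof (intro allI impI ballI)
  fix \<sigma> t :: real and \<phi> :: "real^'n \<Rightarrow> real" assume \<sigma>: "0 < \<sigma>" and \<phi>: "\<phi> \<in> lipc" and t: "0 < t"
  obtain \<rho> where \<rho>: "C21_on {0<..} \<rho>"
    and dens: "\<And>t x. 0 < t \<Longrightarrow> 0 \<le> \<rho> x t" "\<And>t. 0 < t \<Longrightarrow> m t = density lborel (\<lambda>x. ennreal (\<rho> x t))"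
    and eqn: "\<And>x t. 0 < t \<Longrightarrow> dt_on {0<..} \<rho> x t - laplacian (\<lambda>y. \<rho> y t) x
        - divergence (\<lambda>y. \<rho> y t *\<^sub>R Dp H (lam *\<^sub>R grad (\<lambda>z. u z t) y) y) x = 0"
    using sol unfolding MFG_solution_def by blast
  define \<psi> where "\<psi> = molli \<sigma> \<phi>"
  define V where "V = (\<lambda>y. Dp H (lam *\<^sub>R grad (\<lambda>z. u z t) y) y)"
  define r where "r = (\<lambda>y. \<rho> y t)"
  obtain R where R: "\<And>x. R < norm x \<Longrightarrow> \<psi> x = 0" unfolding \<psi>_def by (rule molli_bounded_support[OF \<sigma> \<phi>]) blast
  have C\<psi>: "C_class k \<psi>" for k unfolding \<psi>_def by (rule molli_C_class[OF \<sigma> \<phi>])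
  have c\<psi>: "continuous_on UNIV \<psi>" using C\<psi>[of 0] by simp
  have d\<psi>: "\<psi> differentiable (at x)" for x using C_class_2_grad(1)[OF C\<psi>] .
  have g0: "grad \<psi> x = 0" if "R < norm x" for x
  proof -
    have "grad \<psi> x \<bullet> v = 0 \<bullet> v" for v
      unfolding grad_inner[OF d\<psi>] using pd_eq_0_outside[OF R that] by simp
    then show ?thesis using vector_eq_rdot by blast
  qed
  have r2: "C_class (Suc (Suc 0)) r" unfolding r_def using C21_on_slice(1)[OF \<rho>] t by simp
  then have r1: "C_class (Suc 0) r" by (rule C_class_Suc_D)
  have V1: "C_class (Suc 0) (\<lambda>y. V y \<bullet> i)" if "i \<in> Basis" for i
    unfolding V_def by (rule MFG_drift_C1[OF lam sol _ that]) (use t in simp)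
  have W1: "C_class (Suc 0) (\<lambda>y. (r y *\<^sub>R V y) \<bullet> i)" if "i \<in> Basis" for i
    unfolding inner_scaleR_left by (rule C_class_mult[OF r1 V1[OF that]])
  note I1 = integral_divergence_by_parts[OF C\<psi> C_class_2_grad(3)[OF r2], of R]
  note I2 = integral_divergence_by_parts[OF r1 C_class_2_grad(3)[OF C\<psi>], of R]
  note I3 = integral_divergence_by_parts[OF C\<psi> W1, of R]
  define A1 where "A1 x = \<psi> x * divergence (grad r) x + grad r x \<bullet> grad \<psi> x" for x
  define A2 where "A2 x = r x * divergence (grad \<psi>) x + grad \<psi> x \<bullet> grad r x" for x
  define A3 where "A3 x = \<psi> x * divergence (\<lambda>y. r y *\<^sub>R V y) x + (r x *\<^sub>R V x) \<bullet> grad \<psi> x" for x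
  have A: "integrable lborel A1" "integrable lborel A2" "integrable lborel A3"
    "(LINT x|lborel. A1 x) = 0" "(LINT x|lborel. A2 x) = 0" "(LINT x|lborel. A3 x) = 0"
    using I1 I2 I3 R g0 unfolding A1_def A2_def A3_def by auto
  have point: "dt_on {0<..} \<rho> x t * \<psi> x = (A1 x - A2 x + A3 x) + r x * generator \<sigma> \<phi> V x" for x
  proof -
    have e: "dt_on {0<..} \<rho> x t = divergence (grad r) x + divergence (\<lambda>y. r y *\<^sub>R V y) x"
      using eqn[OF t, of x] by (simp add: r_def V_def laplacian_eq_divergence)
    show ?thesis
      unfolding e A1_def A2_def A3_def generator_def \<psi>_def[symmetric] laplacian_eq_divergence
      by (simp add: algebra_simps inner_commute)
  qed
  have cV: "continuous_on UNIV V"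
    unfolding V_def by (rule MFG_drift_continuous[OF lam sol]) (use t in simp)
  have cr: "continuous_on UNIV r" using r1 by (rule C_class_continuous)
  have cG: "continuous_on UNIV (generator \<sigma> \<phi> V)" by (rule generator_continuous[OF \<sigma> \<phi> cV])
  have intG: "integrable lborel (\<lambda>x. r x * generator \<sigma> \<phi> V x)"
  proof (rule integrable_continuous_bounded_support[where R = R])
    show "continuous_on UNIV (\<lambda>x. r x * generator \<sigma> \<phi> V x)" by (intro continuous_intros cr cG)
    show "r x * generator \<sigma> \<phi> V x = 0" if x: "R < norm x" for x
    proof -
      have "pd i (pd i \<psi>) x = 0" for i
        by (rule pd_eq_0_outside[OF _ x]) (rule pd_eq_0_outside[OF R])
      then show ?thesis using g0[OF x] by (simp add: generator_def laplacian_molli[OF \<sigma> \<phi>] \<psi>_def)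
    qed
  qed
  have dens_int: "(LINT x|m s. f x) = (LINT x|lborel. \<rho> x s * f x)" if s: "0 < s" and f: "continuous_on UNIV f" for s f
  proof -
    have "continuous_on UNIV (\<lambda>x. \<rho> x s)" using C_class_continuous[OF C21_on_slice(1)[OF \<rho>]] s by simp
    then have "(\<lambda>x. \<rho> x s) \<in> borel_measurable lborel" "f \<in> borel_measurable lborel"
      using f by (auto intro: borel_measurable_continuous_onI)
    then show ?thesis unfolding dens(2)[OF s] using dens(1)[OF s]
      by (subst integral_density) auto
  qed
  have "(LINT x|lborel. dt_on {0<..} \<rho> x t * \<psi> x) = (LINT x|lborel. r x * generator \<sigma> \<phi> V x)"
    unfolding point using A intG by simp
  also have "\<dots> = (LINT x|m t. generator \<sigma> \<phi> V x)"
    unfolding dens_int[OF t cG] r_def ..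
  finally have "((\<lambda>t. LINT x|lborel. \<rho> x t * \<psi> x) has_real_derivative (LINT x|m t. generator \<sigma> \<phi> V x)) (at t)"
    using has_derivative_integral_bounded_support[OF \<rho> c\<psi> R t] by simp
  then have "((\<lambda>t. LINT x|m t. \<psi> x) has_real_derivative (LINT x|m t. generator \<sigma> \<phi> V x)) (at t)"
    by (rule has_field_derivative_transform_within_open[of _ _ _ "{0<..}"]) (use t dens_int[OF _ c\<psi>] in auto)
  then show "((\<lambda>t. LINT x|m t. molli \<sigma> \<phi> x) has_real_derivative
      (LINT x|m t. generator \<sigma> \<phi> (\<lambda>y. Dp H (lam *\<^sub>R grad (\<lambda>z. u z t) y) y) x)) (at t)"
    by (simp add: \<psi>_def V_def)
qed

end

section \<open>From distributional to classical derivatives in time\<close>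

lemma kernel_translate_integral:
  fixes D :: "real \<Rightarrow> real"
  assumes d: "0 < \<delta>" and D: "continuous_on UNIV D" and e: "\<And>s. \<bar>s - r\<bar> \<le> \<delta> \<Longrightarrow> \<bar>D s - D r\<bar> \<le> e"
  shows "integrable lborel (\<lambda>s. kernel \<delta> (s - r) * D s)" "\<bar>(LINT s|lborel. kernel \<delta> (s - r) * D s) - D r\<bar> \<le> e"
proof -
  have ck: "continuous_on UNIV (kernel \<delta> :: real \<Rightarrow> real)" using C_class_kernel[OF d, of 0] by simp
  have c: "continuous_on UNIV (\<lambda>s. kernel \<delta> (s - r))"
    by (rule continuous_on_compose2[OF ck]) (auto intro: continuous_intros)
  have z: "kernel \<delta> (s - r) = 0" if "\<bar>r\<bar> + \<delta> < norm s" for s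
    by (rule kernel_eq_0[OF d]) (use that in auto)
  have int: "integrable lborel (\<lambda>s. kernel \<delta> (s - r) * E s)" if "continuous_on UNIV E" for E
    by (rule integrable_continuous_bounded_support[where R = "\<bar>r\<bar> + \<delta>"]) (use z in \<open>auto intro!: continuous_intros c that\<close>)
  show "integrable lborel (\<lambda>s. kernel \<delta> (s - r) * D s)" using D by (rule int)
  have k1: "(LINT s|lborel. kernel \<delta> (s - r)) = 1"
  proof -
    have "(LINT s|lborel. kernel \<delta> (s::real)) = (LINT s|distr lborel borel ((+) (- r)). kernel \<delta> (s::real))"
      by (simp add: lborel_distr_plus)
    also have "\<dots> = (LINT s|lborel. kernel \<delta> (- r + s))"
      using ck by (intro integral_distr) (auto intro: borel_measurable_continuous_onI)
    finally show ?thesis by (simp add: integral_kernel[OF d])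
  qed
  have ik: "integrable lborel (\<lambda>s. kernel \<delta> (s - r) * c)" for c using int[of "\<lambda>_. c"] by simp
  have ik1: "integrable lborel (\<lambda>s. kernel \<delta> (s - r))" using ik[of 1] by simp
  have "(LINT s|lborel. kernel \<delta> (s - r) * D s) - D r = (LINT s|lborel. kernel \<delta> (s - r) * D s - kernel \<delta> (s - r) * D r)"
    using int[OF D] ik[of "D r"] ik1 by (simp add: k1)
  also have "\<bar>\<dots>\<bar> \<le> (LINT s|lborel. \<bar>kernel \<delta> (s - r) * D s - kernel \<delta> (s - r) * D r\<bar>)" by (rule integral_abs_bound)
  also have "\<dots> \<le> (LINT s|lborel. kernel \<delta> (s - r) * e)"
  proof (rule integral_mono)
    show "integrable lborel (\<lambda>s. \<bar>kernel \<delta> (s - r) * D s - kernel \<delta> (s - r) * D r\<bar>)"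
      by (intro Bochner_Integration.integrable_abs Bochner_Integration.integrable_diff int[OF D] ik)
    show "integrable lborel (\<lambda>s. kernel \<delta> (s - r) * e)" by (rule ik)
    show "\<bar>kernel \<delta> (s - r) * D s - kernel \<delta> (s - r) * D r\<bar> \<le> kernel \<delta> (s - r) * e" for s
    proof (cases "\<bar>s - r\<bar> \<le> \<delta>")
      case True
      then show ?thesis using e[OF True] kernel_nonneg[OF d, of "s - r"]
        by (simp add: right_diff_distrib[symmetric] abs_mult mult_left_mono)
    next
      case False
      then have "kernel \<delta> (s - r) = 0" by (intro kernel_eq_0[OF d]) auto
      then show ?thesis by simp
    qed
  qed
  also have "\<dots> = e" using ik1 by (simp add: k1)
  finally show "\<bar>(LINT s|lborel. kernel \<delta> (s - r) * D s) - D r\<bar> \<le> e" .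
qed

lemma continuous_antiderivative:
  fixes g :: "real \<Rightarrow> real"
  assumes "continuous_on UNIV g"
  obtains G where "\<And>s. (G has_real_derivative g s) (at s)"
proof -
  define c :: real where "c = 0"
  have "((\<lambda>u. LBINT y=c..u. g y) has_real_derivative g s) (at s)" for s
  proof -
    have "((\<lambda>u. LBINT y=c..u. g y) has_vector_derivative g s) (at s within {- \<bar>s\<bar> - 1..\<bar>s\<bar> + 1})"
      by (rule interval_integral_FTC2) (use assms in \<open>auto simp: c_def intro: continuous_on_subset\<close>)
    moreover have "at s within {- \<bar>s\<bar> - 1..\<bar>s\<bar> + 1} = at s" by (rule at_within_interior) auto
    ultimately show ?thesis by (simp add: has_real_derivative_iff_has_vector_derivative)
  qed
  then show ?thesis by (rule that)
qed

lemma pd_1_eq_derivative: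
  fixes G g :: "real \<Rightarrow> real"
  assumes G: "\<And>s. (G has_real_derivative g s) (at s)"
  shows "pd 1 G = g"
proof
  fix s
  have "(G has_derivative (\<lambda>h. h * g s)) (at s)"
    using G[of s] by (simp add: has_field_derivative_def mult_commute_abs)
  from has_derivative_pd[OF this] show "pd 1 G s = g s" by simp
qed

lemma C_class_of_derivative:
  fixes G g :: "real \<Rightarrow> real"
  assumes G: "\<And>s. (G has_real_derivative g s) (at s)" and g: "C_class k g"
  shows "C_class (Suc k) G"
  unfolding C_class_Suc_pd
  using g G by (auto simp: pd_1_eq_derivative[OF G] has_field_derivative_def intro: differentiableI)

text \<open>A smoothed indicator of the interval from \<open>r1\<close> to \<open>r2\<close>: the
  antiderivative \<open>J\<close> of the kernel is constant on either side of the kernel's support,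
  so \<open>J (s - r1) - J (s - r2)\<close> vanishes far from the interval.\<close>

lemma bump_plateau:
  assumes d: "0 < \<delta>" and r: "r1 < r2"
  obtains \<theta> :: "real \<Rightarrow> real" where "\<And>k. C_class k \<theta>" "\<And>s. (\<theta> has_real_derivative (kernel \<delta> (s - r1) - kernel \<delta> (s - r2))) (at s)"
    "\<And>s. s \<notin> {r1 - \<delta>..r2 + \<delta>} \<Longrightarrow> \<theta> s = 0"
proof -
  have "continuous_on UNIV (kernel \<delta> :: real \<Rightarrow> real)" using C_class_kernel[OF d, of 0] by simp
  then obtain J :: "real \<Rightarrow> real" where J: "\<And>s. (J has_real_derivative kernel \<delta> s) (at s)"
    using continuous_antiderivative by blast
  define \<theta> where "\<theta> s = J (s - r1) - J (s - r2)" for s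
  have \<theta>: "(\<theta> has_real_derivative (kernel \<delta> (s - r1) - kernel \<delta> (s - r2))) (at s)" for s
    unfolding \<theta>_def by (auto intro!: derivative_eq_intros DERIV_chain'[OF _ J])
  have flat: "J x = J y" if lt: "x < y" and out: "\<And>s. x < s \<Longrightarrow> s < y \<Longrightarrow> \<delta> \<le> \<bar>s\<bar>" for x y
  proof -
    obtain s where "x < s" "s < y" "J y - J x = (y - x) * kernel \<delta> s"
      using MVT2[OF lt, of J "kernel \<delta>"] J by blast
    then show ?thesis using kernel_eq_0[OF d, of s] out[of s] by simp
  qed
  have ks: "C_class k (\<lambda>s. kernel \<delta> (s - r))" for k and r :: real
    using C_class_linear_compose[OF bounded_linear_ident C_class_kernel[OF d], of k "- r"] by simp
  have "C_class k (\<lambda>s. kernel \<delta> (s - r1) + (- 1) * kernel \<delta> (s - r2))" for k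
    by (intro C_class_add C_class_mult C_class_const ks)
  then have "C_class k (\<lambda>s. kernel \<delta> (s - r1) - kernel \<delta> (s - r2))" for k by simp
  from C_class_Suc_D[OF C_class_of_derivative[OF \<theta> this]] have "C_class k \<theta>" for k .
  moreover have "\<theta> s = 0" if "s \<notin> {r1 - \<delta>..r2 + \<delta>}" for s
  proof -
    from that consider "s < r1 - \<delta>" | "r2 + \<delta> < s" by fastforce
    then show ?thesis
    proof cases
      case 1
      then show ?thesis using flat[of "s - r2" "s - r1"] r by (simp add: \<theta>_def)
    next
      case 2
      then show ?thesis using flat[of "s - r2" "s - r1"] r by (simp add: \<theta>_def)
    qed
  qed
  ultimately show ?thesis using that \<theta> by blast
qed

text \<open>With an antiderivative \<open>G\<close> of \<open>g\<close> and a plateau as test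
  function, the weak equation says that the averages of \<open>D = f - G\<close> near
  \<open>r1\<close> and near \<open>r2\<close> agree. As the kernel shrinks, \<open>D\<close> turns
  out to be constant on positive times.\<close>

lemma du_Bois_Reymond:
  fixes f g :: "real \<Rightarrow> real"
  assumes f: "continuous_on {0..} f" and g: "continuous_on {0..} g" and t: "0 < t"
    and weak: "\<And>\<theta> \<theta>' a b. 0 < a \<Longrightarrow> (\<And>k. C_class k \<theta>) \<Longrightarrow> (\<And>s. (\<theta> has_real_derivative \<theta>' s) (at s)) \<Longrightarrow>
      (\<And>s. s \<notin> {a..b} \<Longrightarrow> \<theta> s = 0) \<Longrightarrow> (LINT s:{0<..}|lborel. \<theta>' s * f s + \<theta> s * g s) = 0"
  shows "(f has_real_derivative g t) (at t)"
proof -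
  \<comment> \<open>Constant extension to negative times gives continuity on the whole line; the
    integrals do not see it, since \<open>\<theta>\<close> lives on positive times.\<close>
  define f0 where "f0 s = f (max s 0)" for s
  define g0 where "g0 s = g (max s 0)" for s
  have cf: "continuous_on UNIV f0" unfolding f0_def
    by (rule continuous_on_compose2[OF f]) (auto intro!: continuous_intros)
  have cg: "continuous_on UNIV g0" unfolding g0_def
    by (rule continuous_on_compose2[OF g]) (auto intro!: continuous_intros)
  obtain G where G: "\<And>s. (G has_real_derivative g0 s) (at s)" using continuous_antiderivative[OF cg] by blast
  have G1: "C_class (Suc 0) G" "pd 1 G = g0" using C_class_of_derivative[OF G, of 0] pd_1_eq_derivative[OF G] cg by auto
  have cG: "continuous_on UNIV G" using G1(1) by (rule C_class_continuous)
  define D where "D s = f0 s - G s" for s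
  have cD: "continuous_on UNIV D" unfolding D_def by (intro continuous_intros cf cG)
  have const: "D r1 = D r2" if r: "0 < r1" "r1 < r2" for r1 r2
  proof -
    have "\<bar>D r1 - D r2\<bar> \<le> e" if e: "0 < e" for e
    proof -
      have "isCont D r" for r using cD by (simp add: continuous_on_eq_continuous_at)
      then have "\<exists>d>0. \<forall>s. \<bar>s - r\<bar> < d \<longrightarrow> \<bar>D s - D r\<bar> < e / 2" for r
        using e unfolding continuous_at_eps_delta dist_real_def by (metis half_gt_zero)
      then obtain d1 d2 where d: "0 < d1" "0 < d2" "\<And>s. \<bar>s - r1\<bar> < d1 \<Longrightarrow> \<bar>D s - D r1\<bar> < e / 2" "\<And>s. \<bar>s - r2\<bar> < d2 \<Longrightarrow> \<bar>D s - D r2\<bar> < e / 2"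
        by metis
      \<comment> \<open>\<open>\<delta> < r1\<close> keeps the support of \<open>\<theta>\<close> in
        positive times; the other two bounds keep the averages of \<open>D\<close> within
        \<open>e / 2\<close> of its values.\<close>
      define \<delta> where "\<delta> = min (r1 / 2) (min (d1 / 2) (d2 / 2))"
      have \<delta>: "0 < \<delta>" "0 < r1 - \<delta>" "\<delta> < d1" "\<delta> < d2" using r d by (auto simp: \<delta>_def)
      obtain \<theta> :: "real \<Rightarrow> real" where \<theta>: "\<And>k. C_class k \<theta>" "\<And>s. (\<theta> has_real_derivative (kernel \<delta> (s - r1) - kernel \<delta> (s - r2))) (at s)"
        "\<And>s. s \<notin> {r1 - \<delta>..r2 + \<delta>} \<Longrightarrow> \<theta> s = 0"
        using bump_plateau[OF \<delta>(1) r(2)] by metis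
      define \<theta>' where "\<theta>' s = kernel \<delta> (s - r1) - kernel \<delta> (s - r2)" for s
      have \<theta>'0: "\<theta>' s = 0" if "s \<le> 0" for s
        unfolding \<theta>'_def using kernel_eq_0[OF \<delta>(1), of "s - r1"] kernel_eq_0[OF \<delta>(1), of "s - r2"] that \<delta> r by simp
      have W: "(LINT s:{0<..}|lborel. \<theta>' s * f s + \<theta> s * g s) = 0"
        by (rule weak[OF \<delta>(2) \<theta>(1) _ \<theta>(3)]) (use \<theta>(2) in \<open>simp add: \<theta>'_def\<close>)
      have "(LINT s|lborel. \<theta>' s * f0 s + \<theta> s * g0 s) = 0"
      proof -
        have "\<theta>' s * f0 s + \<theta> s * g0 s = indicator {0<..} s *\<^sub>R (\<theta>' s * f s + \<theta> s * g s)" for s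
          using \<theta>'0[of s] \<theta>(3)[of s] \<delta> by (cases "0 < s") (auto simp: f0_def g0_def)
        then show ?thesis using W by (simp add: set_lebesgue_integral_def)
      qed
      moreover have "(LINT s|lborel. \<theta>' s * G s + \<theta> s * g0 s) = 0" "integrable lborel (\<lambda>s. \<theta>' s * G s + \<theta> s * g0 s)"
      proof -
        have C: "C_class (Suc 0) (\<lambda>s. \<theta> s * G s)" by (rule C_class_mult[OF \<theta>(1) G1(1)])
        have z: "\<theta> s * G s = 0" if "\<bar>r2\<bar> + \<bar>r1\<bar> + \<delta> < norm s" for s using \<theta>(3)[of s] that by fastforce
        have "pd 1 \<theta> = \<theta>'" unfolding \<theta>'_def by (rule pd_1_eq_derivative[OF \<theta>(2)])
        then have p: "pd 1 (\<lambda>s. \<theta> s * G s) = (\<lambda>s. \<theta>' s * G s + \<theta> s * g0 s)"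
          using \<theta>(1)[of "Suc 0"] G1 by (subst pd_mult) (auto simp: add.commute)
        show "(LINT s|lborel. \<theta>' s * G s + \<theta> s * g0 s) = 0" "integrable lborel (\<lambda>s. \<theta>' s * G s + \<theta> s * g0 s)"
          using integral_pd_eq_0[OF C z, where i = 1] unfolding p by auto
      qed
      moreover have K: "integrable lborel (\<lambda>s. kernel \<delta> (s - r1) * D s)" "integrable lborel (\<lambda>s. kernel \<delta> (s - r2) * D s)"
        "\<bar>(LINT s|lborel. kernel \<delta> (s - r1) * D s) - D r1\<bar> \<le> e / 2" "\<bar>(LINT s|lborel. kernel \<delta> (s - r2) * D s) - D r2\<bar> \<le> e / 2"
        using kernel_translate_integral[OF \<delta>(1) cD, of r1 "e / 2"] kernel_translate_integral[OF \<delta>(1) cD, of r2 "e / 2"] d \<delta>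
        by (auto simp: less_imp_le)
      moreover have "(LINT s|lborel. \<theta>' s * f0 s + \<theta> s * g0 s) =
         (LINT s|lborel. (\<theta>' s * G s + \<theta> s * g0 s) + (kernel \<delta> (s - r1) * D s - kernel \<delta> (s - r2) * D s))"
        by (intro Bochner_Integration.integral_cong refl) (simp add: \<theta>'_def D_def algebra_simps)
      ultimately have "(LINT s|lborel. kernel \<delta> (s - r1) * D s) = (LINT s|lborel. kernel \<delta> (s - r2) * D s)" by simp
      then show ?thesis using K(3,4) by linarith
    qed
    then have "\<bar>D r1 - D r2\<bar> \<le> 0" by (rule field_le_epsilon[of _ 0, simplified])
    then show ?thesis by simp
  qed
  have "f s = G s + D t" if "s \<in> {0<..}" for s
  proof -
    have s: "0 < s" using that by simp
    consider "s < t" | "s = t" | "t < s" by linarith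
    then have "D s = D t"
    proof cases
      case 1
      then show ?thesis by (rule const[OF s])
    next
      case 3
      then show ?thesis using const[OF t] by metis
    qed simp
    then show ?thesis using that by (simp add: D_def f0_def max_def)
  qed
  moreover have "((\<lambda>s. G s + D t) has_real_derivative g t) (at t)"
    using G[of t] t by (auto intro!: derivative_eq_intros simp: g0_def max_def)
  ultimately show ?thesis
    using has_field_derivative_transform_within_open[of "\<lambda>s. G s + D t" "g t" t "{0<..}" f] t by auto
qed

section \<open>The limit equation in weak form\<close>

context mfg_data
begin

lemma norm_limit_drift: "m \<in> P1 \<Longrightarrow> norm (Dp H (grad (\<lambda>y. F y m) x) x) \<le> 6 * Co * (1 + L)"
  using norm_DF[of m x] Co by (intro order_trans[OF norm_Dp] mult_left_mono) auto

text \<open>The momentum slot contributes \<open>Co * L\<close>, and the explicit dependence on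
  \<open>x\<close> contributes \<open>Co * (1 + L)\<close> because the gradient of \<open>F\<close>
  has norm at most \<open>L\<close>.\<close>

lemma limit_drift_diff:
  assumes m: "m \<in> P1" "m' \<in> P1"
  shows "norm (Dp H (grad (\<lambda>y. F y m) x) x - Dp H (grad (\<lambda>z. F z m') y) y) \<le> Co * (1 + 2 * L) * (norm (x - y) + d1 m m')"
proof -
  let ?p = "grad (\<lambda>y. F y m) x" and ?q = "grad (\<lambda>z. F z m') y"
  have "norm (Dp H ?p x - Dp H ?q y) \<le> norm (Dp H ?p x - Dp H ?q x) + norm (Dp H ?q x - Dp H ?q y)"
    using norm_triangle_ineq[of "Dp H ?p x - Dp H ?q x" "Dp H ?q x - Dp H ?q y"] by simp
  also have "\<dots> \<le> Co * norm (?p - ?q) + Co * (1 + norm ?q) * norm (x - y)"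
    by (intro add_mono Dp_lipschitz_p Dp_lipschitz_x)
  also have "\<dots> \<le> Co * (L * (norm (x - y) + d1 m m')) + Co * (1 + L) * (norm (x - y) + d1 m m')"
    using Co L norm_DF[OF m(2), of y] d1_nonneg[of m m']
    by (intro add_mono mult_left_mono mult_mono DF_lipschitz m) auto
  finally show ?thesis by (simp add: algebra_simps)
qed

text \<open>Test functions of product form reduce the distributional equation to one in time alone,
  for \<open>f\<close> and \<open>g\<close>. For fixed \<open>\<sigma>\<close> the generator is
  Lipschitz in space and its drift is Lipschitz in the measure, so \<open>g\<close> is continuous
  and the derivative is classical.\<close>

lemma MF_limit_weak_fp:
  assumes sol: "MF_limit_solution m0 F H m"
  shows "weak_fp (\<lambda>t x. Dp H (grad (\<lambda>y. F y (m t)) x) x) m"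
  unfolding weak_fp_def
proof (intro allI impI ballI)
  fix \<sigma> t :: real and \<phi> :: "real^'n \<Rightarrow> real" assume \<sigma>: "0 < \<sigma>" and \<phi>: "\<phi> \<in> lipc" and t: "0 < t"
  have curve: "P1_curve m" using sol by (simp add: MF_limit_solution_def)
  have P: "m s \<in> P1" if "0 \<le> s" for s using curve that by (auto simp: P1_curve_def)
  define b where "b s x = Dp H (grad (\<lambda>y. F y (m s)) x) x" for s x
  define \<psi> where "\<psi> = molli \<sigma> \<phi>"
  define B where "B = 6 * Co * (1 + L)"
  define K where "K = Co * (1 + 2 * L)"
  have K0: "0 \<le> K" using Co L by (simp add: K_def)
  have bB: "norm (b s x) \<le> B" if "0 \<le> s" for s x unfolding b_def B_def by (rule norm_limit_drift[OF P[OF that]])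
  have bd: "norm (b s x - b r y) \<le> K * (norm (x - y) + d1 (m s) (m r))" if "0 \<le> s" "0 \<le> r" for s r x y
    unfolding b_def K_def using that by (intro limit_drift_diff P)
  have bK: "norm (b s x - b s y) \<le> K * norm (x - y)" if "0 \<le> s" for s x y
    using bd[OF that that, of x y] d1_self[OF P[OF that]] by simp
  have bc: "continuous_on UNIV (b s)" if "0 \<le> s" for s
    by (rule lipschitz_on_continuous_on[OF lipschitz_onI[of _ _ K]]) (simp_all add: dist_norm bK that K0)
  define f where "f s = (LINT x|m s. \<psi> x)" for s
  define g where "g s = (LINT x|m s. generator \<sigma> \<phi> (b s) x)" for s
  have iG: "integrable \<rho> (generator \<sigma> \<phi> (b s))" if "0 \<le> s" "\<rho> \<in> P1" for s \<rho>
    by (rule integrable_generator[OF \<sigma> \<phi> that(2) bc[OF that(1)] bB[OF that(1)]])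
  have i\<psi>: "integrable (m s) \<psi>" if "0 \<le> s" for s
    unfolding \<psi>_def by (rule P1_integrable_lipschitz[OF P[OF that] molli_lipschitz[OF \<sigma> \<phi>]])
  have cf: "continuous_on {0..} f" unfolding f_def \<psi>_def
    by (rule P1_curve_integral_continuous[OF curve molli_lipschitz[OF \<sigma> \<phi>]])
  define \<Lambda> where "\<Lambda> = molli_const TYPE('n) / \<sigma>\<^sup>2 + K + B * molli_const TYPE('n) / \<sigma>"
  have gd: "\<bar>g s - g r\<bar> \<le> (\<Lambda> + K) * d1 (m s) (m r)" if s: "0 \<le> s" and r: "0 \<le> r" for s r
  proof -
    have "\<Lambda>-lipschitz_on UNIV (generator \<sigma> \<phi> (b s))"
      unfolding \<Lambda>_def by (rule generator_lipschitz[OF \<sigma> \<phi> bB[OF s] bK[OF s]])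
    from abs_integral_diff_le_d1[OF P[OF s] P[OF r] this]
    have 1: "\<bar>(LINT x|m s. generator \<sigma> \<phi> (b s) x) - (LINT x|m r. generator \<sigma> \<phi> (b s) x)\<bar> \<le> \<Lambda> * d1 (m s) (m r)" .
    have 2: "\<bar>(LINT x|m r. generator \<sigma> \<phi> (b s) x) - (LINT x|m r. generator \<sigma> \<phi> (b r) x)\<bar> \<le> K * d1 (m s) (m r)"
    proof (rule abs_integral_diff_le[OF P[OF r] iG[OF s P[OF r]] iG[OF r P[OF r]]])
      show "\<bar>generator \<sigma> \<phi> (b s) x - generator \<sigma> \<phi> (b r) x\<bar> \<le> K * d1 (m s) (m r)" for x
        using generator_diff[OF \<sigma> \<phi>, of "b s" x "b r"] bd[OF s r, of x x] by simp
    qed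
    show ?thesis using 1 2 unfolding g_def distrib_right by linarith
  qed
  have cg: "continuous_on {0..} g"
    unfolding continuous_on_def
  proof
    fix r :: real assume "r \<in> {0..}"
    then have r: "0 \<le> r" by simp
    have "((\<lambda>s. d1 (m s) (m r)) \<longlongrightarrow> 0) (at r within {0..})" using curve r by (auto simp: P1_curve_def)
    from tendsto_mult_left[OF this, of "\<Lambda> + K"]
    have lim: "((\<lambda>s. (\<Lambda> + K) * d1 (m s) (m r)) \<longlongrightarrow> 0) (at r within {0..})" by simp
    have "\<forall>\<^sub>F s in at r within {0..}. norm (g s - g r) \<le> (\<Lambda> + K) * d1 (m s) (m r)"
      using gd[OF _ r] by (auto simp: eventually_at_filter)
    then have "((\<lambda>s. g s - g r) \<longlongrightarrow> 0) (at r within {0..})" using lim by (rule Lim_null_comparison)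
    then show "(g \<longlongrightarrow> g r) (at r within {0..})" by (rule LIM_zero_cancel)
  qed
  obtain R where R: "\<And>x. R < norm x \<Longrightarrow> \<psi> x = 0" unfolding \<psi>_def by (rule molli_bounded_support[OF \<sigma> \<phi>]) blast
  have C\<psi>: "C_class k \<psi>" for k unfolding \<psi>_def by (rule molli_C_class[OF \<sigma> \<phi>])
  have d\<psi>: "\<psi> differentiable (at x)" "grad \<psi> differentiable (at x)" for x using C_class_2_grad(1,2)[OF C\<psi>] by auto
  have gradc: "grad (\<lambda>y. \<psi> y * c) x = c *\<^sub>R grad \<psi> x" for c x
  proof (rule grad_eqI)
    have "(\<psi> has_derivative (\<lambda>h. h \<bullet> grad \<psi> x)) (at x)" using gderiv_grad[OF d\<psi>(1)] by (simp add: gderiv_def)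
    from has_derivative_mult_left[OF this, of c]
    show "GDERIV (\<lambda>y. \<psi> y * c) x :> c *\<^sub>R grad \<psi> x" by (simp add: gderiv_def mult.commute)
  qed
  have laplc: "laplacian (\<lambda>y. \<psi> y * c) x = c * laplacian \<psi> x" for c x
  proof -
    have C: "C_class (Suc (Suc 0)) (\<lambda>y. \<psi> y * c)" by (rule C_class_mult[OF C\<psi> C_class_const])
    have p: "pd i (pd i (\<lambda>y. \<psi> y * c)) = (\<lambda>y. c * pd i (pd i \<psi>) y)" if "i \<in> Basis" for i
    proof -
      have "(\<lambda>y. \<psi> y * c) = (\<lambda>y. c * \<psi> y)" by (simp add: mult.commute)
      then have "pd i (\<lambda>y. \<psi> y * c) = (\<lambda>y. c * pd i \<psi> y)" using pd_cmult[OF d\<psi>(1)] by simp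
      moreover have "pd i \<psi> differentiable (at x)" for x unfolding \<psi>_def by (rule molli_differentiable(3)[OF \<sigma> \<phi> that])
      ultimately show ?thesis using pd_cmult[of "pd i \<psi>" i c] by simp
    qed
    show ?thesis unfolding laplacian_eq[OF C_class_2_grad(1,2)[OF C]] laplacian_eq[OF d\<psi>]
      using p by (simp add: sum_distrib_left)
  qed
  have "(f has_real_derivative g t) (at t)"
  proof (rule du_Bois_Reymond[OF cf cg t])
    fix \<theta> \<theta>' :: "real \<Rightarrow> real" and c d :: real
    assume c: "0 < c" and \<theta>: "\<And>k. C_class k \<theta>" "\<And>s. (\<theta> has_real_derivative \<theta>' s) (at s)" "\<And>s. s \<notin> {c..d} \<Longrightarrow> \<theta> s = 0"
    define \<Phi> where "\<Phi> z = \<psi> (fst z) * \<theta> (snd z)" for z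
    have "C_class k \<Phi>" for k
      unfolding \<Phi>_def[abs_def] using C_class_linear_compose[OF bounded_linear_fst C\<psi>, of k 0]
        C_class_linear_compose[OF bounded_linear_snd \<theta>(1), of k 0]
      by (intro C_class_mult) (simp_all del: C_class.simps)
    moreover have sub: "closure {z. \<Phi> z \<noteq> 0} \<subseteq> cball 0 R \<times> {c..d}"
    proof (rule closure_minimal)
      show "{z. \<Phi> z \<noteq> 0} \<subseteq> cball 0 R \<times> {c..d}"
      proof
        fix z assume "z \<in> {z. \<Phi> z \<noteq> 0}"
        then have "\<not> R < norm (fst z)" "snd z \<in> {c..d}" using R \<theta>(3) by (auto simp: \<Phi>_def)
        then show "z \<in> cball 0 R \<times> {c..d}" by (cases z) auto
      qed
    qed (intro closed_Times closed_cball closed_atLeastAtMost)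
    moreover have "compact (closure {z. \<Phi> z \<noteq> 0})"
    proof -
      have "compact (cball (0::real^'n) R \<times> {c..d})" by (intro compact_Times compact_cball compact_Icc)
      then have "compact (cball 0 R \<times> {c..d} \<inter> closure {z. \<Phi> z \<noteq> 0})" by (rule compact_Int_closed[OF _ closed_closure])
      moreover have "cball 0 R \<times> {c..d} \<inter> closure {z. \<Phi> z \<noteq> 0} = closure {z. \<Phi> z \<noteq> 0}" using sub by (rule Int_absorb1)
      ultimately show ?thesis by (simp only:)
    qed
    ultimately have "test_function \<Phi>" using c unfolding test_function_def by auto
    then have "(LINT s:{0<..}|lborel. (LINT x|m s.
          vector_derivative (\<lambda>s. \<Phi> (x, s)) (at s) + laplacian (\<lambda>y. \<Phi> (y, s)) x
          - Dp H (grad (\<lambda>y. F y (m s)) x) x \<bullet> grad (\<lambda>y. \<Phi> (y, s)) x)) = 0"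
      using sol unfolding MF_limit_solution_def by blast
    also have "(LINT s:{0<..}|lborel. (LINT x|m s.
          vector_derivative (\<lambda>s. \<Phi> (x, s)) (at s) + laplacian (\<lambda>y. \<Phi> (y, s)) x
          - Dp H (grad (\<lambda>y. F y (m s)) x) x \<bullet> grad (\<lambda>y. \<Phi> (y, s)) x)) =
        (LINT s:{0<..}|lborel. \<theta>' s * f s + \<theta> s * g s)"
    proof (rule set_lebesgue_integral_cong)
      show "\<forall>s. s \<in> {0<..} \<longrightarrow> (LINT x|m s.
          vector_derivative (\<lambda>s. \<Phi> (x, s)) (at s) + laplacian (\<lambda>y. \<Phi> (y, s)) x
          - Dp H (grad (\<lambda>y. F y (m s)) x) x \<bullet> grad (\<lambda>y. \<Phi> (y, s)) x) = \<theta>' s * f s + \<theta> s * g s"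
      proof (intro allI impI)
        fix s :: real assume "s \<in> {0<..}"
        then have s: "0 \<le> s" by simp
        have vd: "vector_derivative (\<lambda>s. \<Phi> (x, s)) (at s) = \<theta>' s * \<psi> x" for x
        proof (rule vector_derivative_at)
          have "((\<lambda>s. \<psi> x * \<theta> s) has_real_derivative \<psi> x * \<theta>' s) (at s)" by (rule DERIV_cmult[OF \<theta>(2)])
          then show "((\<lambda>s. \<Phi> (x, s)) has_vector_derivative \<theta>' s * \<psi> x) (at s)"
            by (simp add: \<Phi>_def has_real_derivative_iff_has_vector_derivative mult.commute)
        qed
        have "vector_derivative (\<lambda>s. \<Phi> (x, s)) (at s) + laplacian (\<lambda>y. \<Phi> (y, s)) x
          - Dp H (grad (\<lambda>y. F y (m s)) x) x \<bullet> grad (\<lambda>y. \<Phi> (y, s)) x = \<theta>' s * \<psi> x + \<theta> s * generator \<sigma> \<phi> (b s) x" for x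
          unfolding vd by (simp add: \<Phi>_def gradc laplc generator_def \<psi>_def[symmetric] b_def right_diff_distrib)
        then show "(LINT x|m s.
          vector_derivative (\<lambda>s. \<Phi> (x, s)) (at s) + laplacian (\<lambda>y. \<Phi> (y, s)) x
          - Dp H (grad (\<lambda>y. F y (m s)) x) x \<bullet> grad (\<lambda>y. \<Phi> (y, s)) x) = \<theta>' s * f s + \<theta> s * g s"
          using i\<psi>[OF s] iG[OF s P[OF s]] by (simp add: f_def g_def)
      qed
    qed simp
    finally show "(LINT s:{0<..}|lborel. \<theta>' s * f s + \<theta> s * g s) = 0" .
  qed
  then show "((\<lambda>t. LINT x|m t. molli \<sigma> \<phi> x) has_real_derivative
      (LINT x|m t. generator \<sigma> \<phi> (\<lambda>x. Dp H (grad (\<lambda>y. F y (m t)) x) x) x)) (at t)"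
    by (simp add: f_def[abs_def] g_def \<psi>_def b_def[abs_def])
qed

end

section \<open>Convergence\<close>

definition momentum_bound :: "real \<Rightarrow> real"
  where "momentum_bound L = 2 * L + 1"

definition drift_bound :: "real \<Rightarrow> real \<Rightarrow> real"
  where "drift_bound Co L = 6 * Co * (1 + momentum_bound L)"

text \<open>The constant of \<open>gradient_estimate\<close> with
  \<open>c1 = 2 + molli_const\<close>, \<open>c2 = drift_bound\<close> and
  \<open>K = momentum_bound\<close>; \<open>c1\<close> and \<open>c2\<close> are the coefficients of
  \<open>time_modulus\<close>.\<close>

definition gradient_const :: "'n::finite itself \<Rightarrow> real \<Rightarrow> real \<Rightarrow> real"
  where "gradient_const _ Co L = L * (1 + 2 * (2 + molli_const TYPE('n)) + drift_bound Co L + real CARD('n)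
    + 6 * Co * (1 + momentum_bound L)) + Co * (1 + momentum_bound L)"

text \<open>The bound of \<open>stability\<close> at time \<open>\<tau>\<close> with Lipschitz
  constant \<open>Co * (1 + 2 * L)\<close> and error \<open>Co * gradient_const / sqrt lam\<close>,
  the factor \<open>1 / sqrt lam\<close> being left out.\<close>

definition distance_const :: "'n::finite itself \<Rightarrow> real \<Rightarrow> real \<Rightarrow> real \<Rightarrow> real"
  where "distance_const _ Co L \<tau> = \<tau> * exp (2 * (Co * (1 + 2 * L)) * \<tau>) * (Co * gradient_const TYPE('n) Co L)"

lemma gradient_const_pos:
  assumes "1 \<le> Co" "0 < L"
  shows "0 < gradient_const TYPE('n::finite) Co L"
proof -
  have "0 < Co * (1 + momentum_bound L)" using assms by (simp add: momentum_bound_def)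
  moreover have "0 \<le> L * (1 + 2 * (2 + molli_const TYPE('n)) + drift_bound Co L + real CARD('n) + 6 * Co * (1 + momentum_bound L))"
    using assms by (intro mult_nonneg_nonneg add_nonneg_nonneg) (auto simp: drift_bound_def momentum_bound_def kernel_const_nonneg)
  ultimately show ?thesis unfolding gradient_const_def by linarith
qed

section \<open>From the momentum to the measures and back\<close>

context mfg_data
begin

context
  fixes lam u \<nu> \<mu>
  assumes lam: "2 * Co \<le> lam" and sol: "MFG_solution lam m0 F H u \<nu>" and lim: "MF_limit_solution m0 F H \<mu>"
begin

lemma lam_pos: "0 < lam" and lam_ge_1: "1 \<le> lam"
  using lam Co by auto

lemma curves_P1: "0 \<le> t \<Longrightarrow> \<mu> t \<in> P1" "0 \<le> t \<Longrightarrow> \<nu> t \<in> P1"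
  using lim m_P1[OF lam_pos sol] by (auto simp: MF_limit_solution_def P1_curve_def)

lemma MFG_drift_bound:
  "0 \<le> t \<Longrightarrow> norm (Dp H (lam *\<^sub>R grad (\<lambda>z. u z t) y) y) \<le> drift_bound Co L"
  using gradient_bound[OF lam sol, of t y] Co unfolding drift_bound_def momentum_bound_def
  by (intro order_trans[OF norm_Dp] mult_left_mono) auto

text \<open>The a priori bound on the momentum bounds the drift, and a bounded drift gives the curve
  the time modulus that the sharper estimate asks for.\<close>

lemma momentum_estimate_own_measure:
  assumes t: "0 \<le> t"
  shows "norm (lam *\<^sub>R grad (\<lambda>y. u y t) x - grad (\<lambda>y. F y (\<nu> t)) x) \<le> gradient_const TYPE('n) Co L / sqrt lam"
  unfolding gradient_const_def
proof (rule gradient_estimate[OF lam_ge_1 sol t])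
  show "norm (lam *\<^sub>R grad (\<lambda>y. u y s) x) \<le> momentum_bound L" if "0 \<le> s" for s x
    unfolding momentum_bound_def by (rule gradient_bound[OF lam sol that])
  show "0 < 2 + molli_const TYPE('n)" by (simp add: kernel_const_nonneg add_pos_nonneg)
  show "0 \<le> drift_bound Co L" using Co L by (simp add: drift_bound_def momentum_bound_def)
  show "d1 (\<nu> s) (\<nu> t) \<le> (2 + molli_const TYPE('n)) * sqrt (s - t) + drift_bound Co L * (s - t)" if "t \<le> s" for s
    using weak_fp_time_modulus[OF MFG_weak_fp[OF lam_pos sol] m_curve[OF lam_pos sol] _ _ t that, of "drift_bound Co L"]
      MFG_drift_continuous[OF lam_pos sol] MFG_drift_bound
    unfolding time_modulus_def by simp
qed

text \<open>An error in the momentum becomes at most \<open>Co\<close> times as large in the drift.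
  The momentum is close to the gradient of \<open>F\<close> at the system's own measure; exchanging
  that measure for the limit costs \<open>L * d1\<close>, which is the feedback term of
  \<open>fp_pair\<close>.\<close>

lemma measure_estimate:
  assumes t: "0 \<le> t" "t \<le> \<tau>"
  shows "d1 (\<mu> t) (\<nu> t) \<le> distance_const TYPE('n) Co L \<tau> / sqrt lam"
proof -
  let ?C = "gradient_const TYPE('n) Co L"
  have C0: "0 < ?C" using Co L by (rule gradient_const_pos)
  interpret fp_pair \<mu> \<nu> "\<lambda>t x. Dp H (grad (\<lambda>y. F y (\<mu> t)) x) x" "\<lambda>t y. Dp H (lam *\<^sub>R grad (\<lambda>z. u z t) y) y"
    "drift_bound Co L" "Co * (1 + 2 * L)" "Co * (?C / sqrt lam)"
  proof
    show "P1_curve \<mu>" using lim by (simp add: MF_limit_solution_def)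
    show "P1_curve \<nu>" by (rule m_curve[OF lam_pos sol])
    show "weak_fp (\<lambda>t x. Dp H (grad (\<lambda>y. F y (\<mu> t)) x) x) \<mu>" by (rule MF_limit_weak_fp[OF lim])
    show "weak_fp (\<lambda>t y. Dp H (lam *\<^sub>R grad (\<lambda>z. u z t) y) y) \<nu>" by (rule MFG_weak_fp[OF lam_pos sol])
    show "norm (Dp H (grad (\<lambda>y. F y (\<mu> t)) x) x) \<le> drift_bound Co L" if "0 \<le> t" for t x
      using Co L unfolding drift_bound_def momentum_bound_def
      by (intro order_trans[OF norm_limit_drift[OF curves_P1(1)[OF that]]] mult_left_mono) auto
    show "norm (Dp H (grad (\<lambda>y. F y (\<mu> t)) x) x - Dp H (grad (\<lambda>y. F y (\<mu> t)) y) y) \<le> Co * (1 + 2 * L) * norm (x - y)" if "0 \<le> t" for t x y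
      using limit_drift_diff[OF curves_P1(1)[OF that] curves_P1(1)[OF that], of x y] d1_self[OF curves_P1(1)[OF that]] by simp
    show "norm (Dp H (grad (\<lambda>y. F y (\<mu> s)) x) x - Dp H (grad (\<lambda>y. F y (\<mu> t)) x) x) \<le> Co * (1 + 2 * L) * d1 (\<mu> s) (\<mu> t)"
      if "0 \<le> s" "0 \<le> t" for s t x
      using limit_drift_diff[OF curves_P1(1)[OF that(1)] curves_P1(1)[OF that(2)], of x x] by simp
    show "norm (Dp H (lam *\<^sub>R grad (\<lambda>z. u z t) x) x) \<le> drift_bound Co L" if "0 < t" for t x
      using that by (intro MFG_drift_bound) simp
    show "continuous_on UNIV (\<lambda>y. Dp H (lam *\<^sub>R grad (\<lambda>z. u z t) y) y)" if "0 < t" for t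
      using that by (intro MFG_drift_continuous[OF lam_pos sol]) simp
    show "\<mu> 0 = \<nu> 0" using lim sol by (simp add: MF_limit_solution_def MFG_solution_def)
    show "0 \<le> Co * (?C / sqrt lam)" using Co C0 lam_pos by simp
    show "norm (Dp H (lam *\<^sub>R grad (\<lambda>z. u z t) x) x - Dp H (grad (\<lambda>y. F y (\<mu> t)) x) x)
      \<le> Co * (?C / sqrt lam) + Co * (1 + 2 * L) * d1 (\<mu> t) (\<nu> t)" if "0 < t" for t x
    proof -
      have t: "0 \<le> t" using that by simp
      let ?p = "lam *\<^sub>R grad (\<lambda>z. u z t) x" and ?q = "grad (\<lambda>y. F y (\<nu> t)) x" and ?r = "grad (\<lambda>y. F y (\<mu> t)) x"
      have "norm (?q - ?r) \<le> L * d1 (\<mu> t) (\<nu> t)"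
        using DF_lipschitz[OF curves_P1(2)[OF t] curves_P1(1)[OF t], of x x] d1_commute[OF curves_P1(2)[OF t] curves_P1(1)[OF t]] by simp
      then have "norm (?p - ?r) \<le> ?C / sqrt lam + L * d1 (\<mu> t) (\<nu> t)"
        using momentum_estimate_own_measure[OF t, of x] norm_triangle_ineq[of "?p - ?q" "?q - ?r"] by simp
      then have "Co * norm (?p - ?r) \<le> Co * (?C / sqrt lam + L * d1 (\<mu> t) (\<nu> t))" using Co by (intro mult_left_mono) auto
      also have "\<dots> \<le> Co * (?C / sqrt lam + (1 + 2 * L) * d1 (\<mu> t) (\<nu> t))"
        using Co L d1_nonneg[of "\<mu> t" "\<nu> t"] by (intro mult_left_mono add_left_mono mult_right_mono) auto
      also have "\<dots> = Co * (?C / sqrt lam) + Co * (1 + 2 * L) * d1 (\<mu> t) (\<nu> t)" by (simp add: algebra_simps)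
      finally show ?thesis using Dp_lipschitz_p[of x ?p ?r] by linarith
    qed
  qed
  have "d1 (\<mu> t) (\<nu> t) \<le> t * exp (2 * (Co * (1 + 2 * L)) * t) * (Co * (?C / sqrt lam))" by (rule stability[OF t(1)])
  also have "\<dots> \<le> \<tau> * exp (2 * (Co * (1 + 2 * L)) * \<tau>) * (Co * (?C / sqrt lam))"
    using t Co L C0 lam_pos by (intro mult_right_mono mult_mono) auto
  also have "\<dots> = distance_const TYPE('n) Co L \<tau> / sqrt lam" by (simp add: distance_const_def)
  finally show ?thesis .
qed

lemma momentum_estimate:
  assumes t: "0 \<le> t" "t \<le> \<tau>"
  shows "norm (lam *\<^sub>R grad (\<lambda>y. u y t) x - grad (\<lambda>y. F y (\<mu> t)) x)
    \<le> (gradient_const TYPE('n) Co L + L * distance_const TYPE('n) Co L \<tau>) / sqrt lam"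
proof -
  let ?p = "lam *\<^sub>R grad (\<lambda>z. u z t) x" and ?q = "grad (\<lambda>y. F y (\<nu> t)) x" and ?r = "grad (\<lambda>y. F y (\<mu> t)) x"
  have "norm (?q - ?r) \<le> L * d1 (\<mu> t) (\<nu> t)"
    using DF_lipschitz[OF curves_P1(2)[OF t(1)] curves_P1(1)[OF t(1)], of x x] d1_commute[OF curves_P1(2)[OF t(1)] curves_P1(1)[OF t(1)]] by simp
  also have "\<dots> \<le> L * (distance_const TYPE('n) Co L \<tau> / sqrt lam)"
    using L by (intro mult_left_mono measure_estimate t) auto
  finally show ?thesis
    using momentum_estimate_own_measure[OF t(1), of x] norm_triangle_ineq[of "?p - ?q" "?q - ?r"] by (simp add: add_divide_distrib)
qed

end

end

text \<open>\<open>lam0\<close> and the constant are chosen before the Hoelder exponent and the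
  data, which expresses that they depend on \<open>Co\<close>, \<open>L\<close>, the dimension and,
  for the constant, \<open>\<tau>\<close>. The value \<open>lam0 = 2 * Co\<close> is the absorption
  threshold of \<open>gradient_bound\<close>.\<close>

theorem proposition3p3:
  fixes Co L :: real
  assumes "1 \<le> Co" and "0 < L"
  shows "\<exists>lam0\<ge>1.
    (\<forall>\<tau>>0. \<exists>C>0. \<forall>\<alpha> (m0 :: (real^'n) measure) F H m.
      mfg_data Co L \<alpha> m0 F H \<and> MF_limit_solution m0 F H m \<longrightarrow>
      (\<forall>lam\<ge>lam0. \<forall>u mlam. MFG_solution lam m0 F H u mlam \<longrightarrow>
        (\<forall>t\<in>{0..\<tau>}. \<forall>x.
          norm (lam *\<^sub>R grad (\<lambda>y. u y t) x - grad (\<lambda>y. F y (m t)) x) \<le> C / sqrt lam) \<and>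
        (\<forall>t\<in>{0..\<tau>}. d1 (mlam t) (m t) \<le> C / sqrt lam))) \<and>
    (\<forall>\<alpha> (m0 :: (real^'n) measure) F H m u mu.
      mfg_data Co L \<alpha> m0 F H \<and> MF_limit_solution m0 F H m \<and>
      (\<forall>lam\<ge>lam0. MFG_solution lam m0 F H (u lam) (mu lam)) \<longrightarrow>
      (\<forall>\<tau>>0. uniform_limit (UNIV \<times> {0..\<tau>})
        (\<lambda>lam (x, t). lam *\<^sub>R grad (\<lambda>y. u lam y t) x)
        (\<lambda>(x, t). grad (\<lambda>y. F y (m t)) x) at_top))"
proof -
  \<comment> \<open>The factor \<open>1 + L\<close> covers both estimates: \<open>L\<close> for
    exchanging the measure in the gradient of \<open>F\<close>, 1 for the distance itself.\<close>
  define C where "C \<tau> = gradient_const TYPE('n) Co L + (1 + L) * distance_const TYPE('n) Co L \<tau>" for \<tau>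
  have G: "0 < gradient_const TYPE('n) Co L" using assms by (rule gradient_const_pos)
  have D: "0 \<le> distance_const TYPE('n) Co L \<tau>" if "0 < \<tau>" for \<tau>
    using that assms G by (simp add: distance_const_def)
  have Cpos: "0 < C \<tau>" if "0 < \<tau>" for \<tau>
    unfolding C_def using G D[OF that] assms by (intro add_pos_nonneg mult_nonneg_nonneg) auto
  have main: "norm (lam *\<^sub>R grad (\<lambda>y. u y t) x - grad (\<lambda>y. F y (m t)) x) \<le> C \<tau> / sqrt lam"
    "d1 (mlam t) (m t) \<le> C \<tau> / sqrt lam"
    if \<tau>: "0 < \<tau>" and data: "mfg_data Co L \<alpha> m0 F H" and lim: "MF_limit_solution m0 F H m"
      and lam: "2 * Co \<le> lam" and sol: "MFG_solution lam m0 F H u mlam" and t: "t \<in> {0..\<tau>}"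
    for \<tau> \<alpha> lam t x u mlam m F H and m0 :: "(real^'n) measure"
  proof -
    interpret mfg_data Co L \<alpha> m0 F H by (rule data)
    have t': "0 \<le> t" "t \<le> \<tau>" using t by auto
    have lam0: "0 < sqrt lam" using lam assms by simp
    have "0 \<le> L * distance_const TYPE('n) Co L \<tau>" using D[OF \<tau>] assms by simp
    then have "gradient_const TYPE('n) Co L + L * distance_const TYPE('n) Co L \<tau> \<le> C \<tau>" "distance_const TYPE('n) Co L \<tau> \<le> C \<tau>"
      unfolding C_def distrib_right using G D[OF \<tau>] by linarith+
    then have "(gradient_const TYPE('n) Co L + L * distance_const TYPE('n) Co L \<tau>) / sqrt lam \<le> C \<tau> / sqrt lam"
      "distance_const TYPE('n) Co L \<tau> / sqrt lam \<le> C \<tau> / sqrt lam"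
      using lam0 by (auto intro!: divide_right_mono)
    then show "norm (lam *\<^sub>R grad (\<lambda>y. u y t) x - grad (\<lambda>y. F y (m t)) x) \<le> C \<tau> / sqrt lam"
      "d1 (mlam t) (m t) \<le> C \<tau> / sqrt lam"
      using momentum_estimate[OF lam sol lim t', of x] measure_estimate[OF lam sol lim t']
        d1_commute[OF curves_P1[OF lam sol lim t'(1)]] by linarith+
  qed
  have unif: "uniform_limit (UNIV \<times> {0..\<tau>}) (\<lambda>lam (x, t). lam *\<^sub>R grad (\<lambda>y. u lam y t) x)
        (\<lambda>(x, t). grad (\<lambda>y. F y (m t)) x) at_top"
    if \<tau>: "0 < \<tau>" and data: "mfg_data Co L \<alpha> m0 F H" and lim: "MF_limit_solution m0 F H m"
      and sol: "\<forall>lam\<ge>2 * Co. MFG_solution lam m0 F H (u lam) (mu lam)"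
    for \<tau> \<alpha> u mu m F H and m0 :: "(real^'n) measure"
  proof (rule uniform_limitI)
    fix e :: real assume e: "0 < e"
    \<comment> \<open>The second condition makes \<open>C \<tau> / sqrt lam\<close> smaller than
      \<open>e\<close>.\<close>
    have "\<forall>\<^sub>F lam in at_top. 2 * Co \<le> lam \<and> (C \<tau> / e)\<^sup>2 < lam"
      by (intro eventually_conj eventually_ge_at_top eventually_gt_at_top)
    then show "\<forall>\<^sub>F lam in at_top. \<forall>z\<in>UNIV \<times> {0..\<tau>}.
      dist (case z of (x, t) \<Rightarrow> lam *\<^sub>R grad (\<lambda>y. u lam y t) x) (case z of (x, t) \<Rightarrow> grad (\<lambda>y. F y (m t)) x) < e"
    proof eventually_elim
      case (elim lam)
      then have lam: "2 * Co \<le> lam" "0 < lam" using assms by auto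
      have "C \<tau> / e < sqrt lam" using elim by (intro real_less_rsqrt) auto
      then have le: "C \<tau> / sqrt lam < e" using e lam by (simp add: field_simps)
      show ?case
      proof (rule ballI)
        fix z :: "(real^'n) \<times> real" assume "z \<in> UNIV \<times> {0..\<tau>}"
        then obtain x t where z: "z = (x, t)" "t \<in> {0..\<tau>}" by auto
        have "MFG_solution lam m0 F H (u lam) (mu lam)" using sol lam(1) by simp
        from main(1)[OF \<tau> data lim lam(1) this z(2), of x] le
        show "dist (case z of (x, t) \<Rightarrow> lam *\<^sub>R grad (\<lambda>y. u lam y t) x) (case z of (x, t) \<Rightarrow> grad (\<lambda>y. F y (m t)) x) < e"
          by (simp add: z(1) dist_norm)
      qed
    qed
  qed
  show ?thesis
  proof (rule exI[of _ "2 * Co"], intro conjI allI impI)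
    show "1 \<le> 2 * Co" using assms by simp
    show "\<exists>C>0. \<forall>\<alpha> (m0 :: (real^'n) measure) F H m.
      mfg_data Co L \<alpha> m0 F H \<and> MF_limit_solution m0 F H m \<longrightarrow>
      (\<forall>lam\<ge>2 * Co. \<forall>u mlam. MFG_solution lam m0 F H u mlam \<longrightarrow>
        (\<forall>t\<in>{0..\<tau>}. \<forall>x.
          norm (lam *\<^sub>R grad (\<lambda>y. u y t) x - grad (\<lambda>y. F y (m t)) x) \<le> C / sqrt lam) \<and>
        (\<forall>t\<in>{0..\<tau>}. d1 (mlam t) (m t) \<le> C / sqrt lam))" if "0 < \<tau>" for \<tau>
      using Cpos[OF that] main[OF that] by (intro exI[of _ "C \<tau>"]) blast
  qed (use unif in blast)
qed

end
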